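(* Let $f:\mathbb{R}^d\to[0,\infty)$ be an arbitrary probability density. Let $N_f(n)$ be the number of packed balls in the random sequential packing model in which $n$ balls of volume $n^{-1}$, with independent centers having common density $f$, arrive sequentially. Let $\xi$ be the packing indicator functional on marked point sets and $\xi_\infty$ its limit. Then, as $n\to\infty$, $$n^{-1}N_f(n)\to\int_{\mathbb{R}^d}E[\xi_\infty(\mathcal{P}_{f(x)})]\,f(x)\,dx\quad\text{in }L^2 .$$
   Context: Packing model: let $B_{n,1},\ldots,B_{n,n}$ be a sequence of $d$-dimensional balls of volume $n^{-1}$ whose centers are independent random $d$-vectors with common density $f$. The first ball $B_{n,1}$ is packed, and recursively for $i=2,\ldots,n$ the ball $B_{n,i}$ is packed iff it does not overlap any ball among $B_{n,1},\ldots,B_{n,i-1}$ which has already been packed; otherwise it is discarded. $N_f(n)$ is the number of packed balls. Functional $\xi$: for a finite point set $\mathcal{X}\subset\mathbb{R}^d$ whose points carry marks in $[0,1]$ (marks are suppressed in the notation), unit volume balls centered at the points of $\mathcal{X}$ arrive sequentially in the order determined by the marks, and each ball is packed or discarded according to whether or not it overlaps a previously packed ball. For $x\in\mathcal{X}$, $\xi(x;\mathcal{X})$ is $1$ if the ball centered at $x$ is packed and $0$ if it is discarded. In random settings the marks are independent, uniformly distributed on $[0,1]$, and independent of the point set. Limit: $\mathcal{P}_\tau$ is a homogeneous Poisson process of intensity $\tau$ on $\mathbb{R}^d$ with i.i.d. uniform $[0,1]$ marks, $\mathbf{0}$ is the origin, carrying its own independent uniform mark, and $B(\mathbf{0};m)$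 is the closed ball of radius $m$ at $\mathbf{0}$. For a locally finite marked point set $\mathcal{S}$ and $m\in\mathbb{N}$ let $$\overline{\xi}(\mathcal{S};m)=\sup_{n\in\mathbb{N}}\Big(\operatorname{ess\,sup}_{m,n}\{\xi(\mathbf{0};(\mathcal{S}\cap B(\mathbf{0};m))\cup\mathcal{A})\}\Big),$$ where $\operatorname{ess\,sup}_{m,n}$ is the essential supremum over marked sets $\mathcal{A}$ of $n$ points located in $\mathbb{R}^d\setminus B(\mathbf{0};m)$ (with respect to Lebesgue measure for the locations and the uniform distribution for the marks), and the point $\mathbf{0}$ is inserted into the set when evaluating $\xi(\mathbf{0};\cdot)$. Then $\xi_\infty(\mathcal{S})=\limsup_{m\to\infty}\overline{\xi}(\mathcal{S};m)$. The integrand in the limit is read as $0$ where $f(x)=0$. *)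

theory Defs
  imports "HOL-Probability.Probability"
begin

section \<open>Random sequential packing\<close>

definition ball_radius :: "'a::euclidean_space itself \<Rightarrow> real \<Rightarrow> real" where
  "ball_radius _ v = root DIM('a) (v / unit_ball_vol (real DIM('a)))"

lemma ball_radius_nonneg: "0 \<le> v \<Longrightarrow> 0 \<le> ball_radius TYPE('a::euclidean_space) v"
  unfolding ball_radius_def
  by (intro real_root_ge_zero divide_nonneg_nonneg less_imp_le[OF unit_ball_vol_pos]) auto

lemma content_cball_ball_radius:
  fixes x :: "'a::euclidean_space"
  assumes "0 \<le> v"
  shows "measure lborel (cball x (ball_radius TYPE('a) v)) = v"
proof -
  have "unit_ball_vol (real DIM('a)) \<noteq> 0"
    using unit_ball_vol_pos[of "real DIM('a)"] by linarith
  moreover have "ball_radius TYPE('a) v ^ DIM('a) = v / unit_ball_vol (real DIM('a))"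
    unfolding ball_radius_def
    by (intro real_root_pow_pos2 DIM_positive divide_nonneg_nonneg assms
          less_imp_le[OF unit_ball_vol_pos]) auto
  ultimately show ?thesis
    using ball_radius_nonneg[OF assms, where 'a = 'a] by (simp add: content_cball)
qed

text \<open>Overlapping means that the open balls meet: tangent balls do not overlap.
  (In all random settings below tangency has probability zero.)\<close>

definition overlap :: "real \<Rightarrow> 'a::metric_space \<Rightarrow> 'a \<Rightarrow> bool" where
  "overlap r x y \<longleftrightarrow> ball x r \<inter> ball y r \<noteq> {}"

text \<open>Balls of radius \<open>r\<close> with labels in the finite set \<open>I\<close>; ball \<open>i\<close> has centre \<open>c i\<close>
  and arrives at time \<open>t i\<close>. A ball is packed iff it overlaps no previously packed ball.
  Balls with equal arrival times (a null event for random marks) ignore each other.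
  For infinite \<open>I\<close> the predicate is \<open>False\<close> by convention.\<close>

function packed ::
  "real \<Rightarrow> ('i \<Rightarrow> 'a::metric_space) \<Rightarrow> ('i \<Rightarrow> 't::linorder) \<Rightarrow> 'i set \<Rightarrow> 'i \<Rightarrow> bool" where
  "packed r c t I i \<longleftrightarrow>
     (if finite I \<and> i \<in> I
      then \<not> (\<exists>j\<in>I. if t j < t i then packed r c t I j \<and> overlap r (c j) (c i) else False)
      else False)"
  by pat_completeness auto
termination
proof (relation "Wellfounded.measure (\<lambda>(r, c, t, I, i). card {k \<in> I. t k < t i})", goal_cases)
  case (2 r c t I i j)
  then have "{k \<in> I. t k < t j} \<subset> {k \<in> I. t k < t i}" by force
  with 2 show ?case by (auto intro: psubset_card_mono)
qed auto

declare packed.simps [simp del]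

lemma packed_iff:
  "packed r c t I i \<longleftrightarrow> finite I \<and> i \<in> I \<and>
     \<not> (\<exists>j\<in>I. t j < t i \<and> packed r c t I j \<and> overlap r (c j) (c i))"
  by (subst packed.simps) auto

text \<open>Number of packed balls when balls of volume \<open>1/n\<close> centred at \<open>x 1, \<dots>, x n\<close>
  arrive in this order.\<close>

definition num_packed :: "nat \<Rightarrow> (nat \<Rightarrow> 'a::euclidean_space) \<Rightarrow> nat" where
  "num_packed n x =
     card {i \<in> {1..n}. packed (ball_radius TYPE('a) (1 / real n)) x (\<lambda>i. i) {1..n} i}"

section \<open>The packing functional and its limit\<close>

text \<open>A marked point is a pair (location, mark), a marked point set a set of such pairs.\<close>

definition xi :: "'a::euclidean_space \<times> real \<Rightarrow> ('a \<times> real) set \<Rightarrow> real" where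
  "xi p S = (if packed (ball_radius TYPE('a) 1) fst snd S p then 1 else 0)"

definition uniform01 :: "real measure" where
  "uniform01 = uniform_measure lborel {0..1}"

text \<open>Reference measure for \<open>n\<close> marked points located outside the closed ball of
  radius \<open>m\<close> at the origin.\<close>

definition outer_points :: "nat \<Rightarrow> nat \<Rightarrow> (nat \<Rightarrow> 'a::euclidean_space \<times> real) measure" where
  "outer_points m n =
     PiM {..<n} (\<lambda>_. restrict_space lborel (- cball 0 (real m)) \<Otimes>\<^sub>M uniform01)"

text \<open>Here and below \<open>u\<close> is the mark carried by the origin.\<close>

definition xi_bar :: "real \<Rightarrow> ('a::euclidean_space \<times> real) set \<Rightarrow> nat \<Rightarrow> ereal" where
  "xi_bar u S m =
     (SUP n. esssup (outer_points m n)
        (\<lambda>a. ereal (xi (0, u)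
           (insert (0, u) ((S \<inter> cball 0 (real m) \<times> UNIV) \<union> a ` {..<n})))))"

definition xi_infinity :: "real \<Rightarrow> ('a::euclidean_space \<times> real) set \<Rightarrow> real" where
  "xi_infinity u S = real_of_ereal (limsup (\<lambda>m. xi_bar u S m))"

section \<open>Poisson processes\<close>

text \<open>A homogeneous Poisson process of intensity \<open>\<tau> > 0\<close>, given by a measurable enumeration
  \<open>Z 0, Z 1, \<dots>\<close> of its (almost surely infinitely many) points. Since points are counted with
  multiplicity, the Poisson counts force the \<open>Z i\<close> to be almost surely distinct.\<close>

definition poisson_process ::
  "'v measure \<Rightarrow> real \<Rightarrow> (nat \<Rightarrow> 'v \<Rightarrow> 'a::euclidean_space) \<Rightarrow> bool" where
  "poisson_process Q \<tau> Z \<longleftrightarrow>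
     prob_space Q \<and>
     (\<forall>i. Z i \<in> Q \<rightarrow>\<^sub>M borel) \<and>
     (\<forall>A\<in>sets borel. bounded A \<longrightarrow>
        (AE \<omega> in Q. finite {i. Z i \<omega> \<in> A}) \<and>
        (\<forall>k. measure Q {\<omega> \<in> space Q. card {i. Z i \<omega> \<in> A} = k} =
           (\<tau> * measure lborel A) ^ k / fact k * exp (- (\<tau> * measure lborel A)))) \<and>
     (\<forall>F. finite F \<and> disjoint F \<and> (\<forall>A\<in>F. A \<in> sets borel \<and> bounded A) \<longrightarrow>
        prob_space.indep_vars Q (\<lambda>_. count_space UNIV) (\<lambda>A \<omega>. card {i. Z i \<omega> \<in> A}) F)"

text \<open>Such a process together with i.i.d. uniform marks that are independent of the locations:
  \<open>U 0\<close> is the mark of the origin and \<open>U (Suc i)\<close> the mark of the point \<open>Z i\<close>.\<close>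

definition marked_poisson_process ::
  "'v measure \<Rightarrow> real \<Rightarrow> (nat \<Rightarrow> 'v \<Rightarrow> 'a::euclidean_space) \<Rightarrow> (nat \<Rightarrow> 'v \<Rightarrow> real) \<Rightarrow> bool" where
  "marked_poisson_process Q \<tau> Z U \<longleftrightarrow>
     poisson_process Q \<tau> Z \<and>
     prob_space.indep_vars Q (\<lambda>_. borel) U UNIV \<and>
     (\<forall>i. distr Q borel (U i) = uniform01) \<and>
     distr Q (PiM UNIV (\<lambda>_. borel) \<Otimes>\<^sub>M PiM UNIV (\<lambda>_. borel)) (\<lambda>\<omega>. (\<lambda>i. Z i \<omega>, \<lambda>i. U i \<omega>)) =
       distr Q (PiM UNIV (\<lambda>_. borel)) (\<lambda>\<omega> i. Z i \<omega>) \<Otimes>\<^sub>M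
       distr Q (PiM UNIV (\<lambda>_. borel)) (\<lambda>\<omega> i. U i \<omega>)"

definition marked_points ::
  "(nat \<Rightarrow> 'v \<Rightarrow> 'a) \<Rightarrow> (nat \<Rightarrow> 'v \<Rightarrow> real) \<Rightarrow> 'v \<Rightarrow> ('a \<times> real) set" where
  "marked_points Z U \<omega> = range (\<lambda>i. (Z i \<omega>, U (Suc i) \<omega>))"

section \<open>Convergence in L2\<close>

definition tendsto_L2 ::
  "'w measure \<Rightarrow> (nat \<Rightarrow> 'w \<Rightarrow> real) \<Rightarrow> ('w \<Rightarrow> real) \<Rightarrow> bool" where
  "tendsto_L2 M Y Y' \<longleftrightarrow>
     (\<forall>n. Y n \<in> borel_measurable M \<and> integrable M (\<lambda>\<omega>. (Y n \<omega>)\<^sup>2)) \<and>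
     Y' \<in> borel_measurable M \<and> integrable M (\<lambda>\<omega>. (Y' \<omega>)\<^sup>2) \<and>
     (\<lambda>n. \<integral>\<omega>. (Y n \<omega> - Y' \<omega>)\<^sup>2 \<partial>M) \<longlonglongrightarrow> 0"

end

theory Submission
  imports Defs
begin

text \<open>
  Whether a ball is packed depends on chains of earlier balls of unbounded length. Cutting the
  recursion off at depth \<open>k\<close> (\<open>packed_trunc k\<close>, with every ball counted as packed at depth \<open>0\<close>)
  makes the rule local: at depth \<open>k\<close> it sees only earlier points within \<open>k\<close> ball diameters
  (\<open>packed_trunc_local\<close>). Each step of the recursion is a negation, so
  the error alternates in sign: even depths overestimate packing and odd depths underestimate it
  (\<open>packed_trunc_sandwich\<close>). The same sandwich holds for the number of packed balls and for the limit
  functional \<open>xi_infinity\<close> (\<open>xi_infinity_sandwich\<close>). Two things remain.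

  First, let \<open>p\<^sub>k(\<tau>)\<close> be the probability that the origin is packed at depth \<open>k\<close> in the Poisson process
  of intensity \<open>\<tau>\<close>. If depths \<open>k\<close> and \<open>k + 1\<close> disagree at the origin, there is a chain of \<open>k + 1\<close>
  successively overlapping balls with decreasing marks. The expected number of such chains is at most
  \<open>(\<tau> v)^(k+1) / (k+1)!\<close> with \<open>v\<close> the volume of a ball of twice the radius, because the marks come in
  the required order with probability at most \<open>1 / (k+1)!\<close>. Hence \<open>p\<^sub>k(\<tau>)\<close> tends to the expectation of
  \<open>xi_infinity\<close> (\<open>poisson_packed_prob_tendsto\<close>).

  Second, for fixed \<open>k\<close> the fraction \<open>S\<^sub>k\<close> of the \<open>n\<close> balls packed at depth \<open>k\<close> tends in mean square
  to \<open>c\<^sub>k\<close>, the integral of \<open>p\<^sub>k(f x) f x\<close>. It suffices that the mean of \<open>S\<^sub>k S\<^sub>k'\<close> tends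
  to \<open>c\<^sub>k c\<^sub>k'\<close> for all \<open>k\<close> and \<open>k'\<close> (\<open>trunc_count_product_limit\<close>), since \<open>S\<^sub>0 = 1\<close>. Moebius inversion
  over sets of points writes the truncated indicator as a finite sum of bounded \<open>cluster_weight\<close>s,
  which vanish unless the whole cluster lies close to the site (\<open>cluster_weight_eq_0\<close>) and depend only
  on the relative positions and the order of arrival. For the Poisson process the factorial moment
  measures are \<open>\<tau>^m\<close> times Lebesgue measure (\<open>poisson_process_factorial_measure\<close>), so \<open>p\<^sub>k(\<tau>)\<close> is a
  power series in \<open>\<tau>\<close> with coefficients \<open>cluster_integral k m / (m+1)!\<close>
  (\<open>expectation_origin_packed_trunc\<close>). For the sample, conditioning on two centres \<open>x\<close> and \<open>y\<close> at
  positive distance leaves, for large \<open>n\<close>, only pairs of disjoint clusters, and these are independent; counting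
  them gives binomial sums (\<open>pair_kernel_far\<close>) in the mean cluster weights at \<open>x\<close> and at \<open>y\<close>.

  No continuity or boundedness of \<open>f\<close> is available to compare these means with the cluster integrals.
  Instead, translation is continuous in the mean (\<open>translation_gap_tendsto_0\<close>), so along a subsequence
  the mean oscillation of \<open>f\<close> on the shrinking ball of interaction vanishes at almost every \<open>x\<close>
  (\<open>local_oscillation_AE_subseq\<close>), and at such \<open>x\<close> the rescaled mean of the weights of clusters of size \<open>m\<close> tends to
  \<open>(f x)^m\<close> times the cluster integral (\<open>mean_cluster_weight_limit\<close>). Dominated convergence and
  the fact that subsequences suffice finish the second part.
\<close>

section \<open>Depth-truncated packing\<close>

text \<open>The recursion for \<open>packed\<close> stopped after \<open>k\<close> steps, where every remaining ball counts as packed.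
  No finiteness of \<open>I\<close> is built in, so the same predicate serves finite samples and the locally finite
  Poisson process.\<close>

primrec packed_trunc ::
  "nat \<Rightarrow> real \<Rightarrow> ('i \<Rightarrow> 'a::metric_space) \<Rightarrow> ('i \<Rightarrow> 't::linorder) \<Rightarrow> 'i set \<Rightarrow> 'i \<Rightarrow> bool" where
  "packed_trunc 0 r c t I i = True"
| "packed_trunc (Suc k) r c t I i =
     (\<forall>j\<in>I. t j < t i \<and> overlap r (c j) (c i) \<longrightarrow> \<not> packed_trunc k r c t I j)"

lemma overlap_imp_dist: "overlap r x y \<Longrightarrow> dist x y < 2 * r"
proof -
  assume "overlap r x y"
  then obtain z where "dist x z < r" "dist y z < r" by (auto simp: overlap_def)
  then show "dist x y < 2 * r" using dist_triangle2[of x y z] by linarith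
qed

lemma overlap_iff_dist:
  fixes x y :: "'a::euclidean_space"
  assumes "0 < r"
  shows "overlap r x y \<longleftrightarrow> dist x y < 2 * r"
proof
  assume *: "dist x y < 2 * r"
  have "midpoint x y \<in> ball x r \<inter> ball y r"
    using * by (simp add: dist_midpoint)
  then show "overlap r x y" by (auto simp: overlap_def)
qed (rule overlap_imp_dist)

text \<open>Depth \<open>0\<close> overestimates, and one more step of the recursion negates, so it turns an
  overestimate for the earlier balls into an underestimate for the later one and conversely.\<close>

lemma packed_trunc_sandwich:
  assumes "finite I"
  shows "\<forall>i\<in>I. (even k \<longrightarrow> packed r c t I i \<longrightarrow> packed_trunc k r c t I i) \<and>
                (odd k \<longrightarrow> packed_trunc k r c t I i \<longrightarrow> packed r c t I i)"
proof (induction k)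
  case (Suc k)
  show ?case
  proof (intro ballI conjI impI)
    fix i assume "i \<in> I" "even (Suc k)" "packed r c t I i"
    then show "packed_trunc (Suc k) r c t I i"
      using Suc by (auto simp: packed_iff[of r c t I i])
  next
    fix i assume "i \<in> I" "odd (Suc k)" "packed_trunc (Suc k) r c t I i"
    then show "packed r c t I i"
      using Suc assms by (auto simp: packed_iff[of r c t I i])
  qed
qed simp

text \<open>The recursion at \<open>i\<close> descends strictly in arrival time, so it bottoms out by itself once the
  depth exceeds the number of earlier balls.\<close>

lemma packed_trunc_eventually:
  assumes "finite I" "i \<in> I" "card {j\<in>I. t j < t i} < k"
  shows "packed_trunc k r c t I i \<longleftrightarrow> packed r c t I i"
  using assms(2,3)
proof (induction k arbitrary: i)
  case (Suc k)
  have "packed_trunc k r c t I j \<longleftrightarrow> packed r c t I j" if "j \<in> I" "t j < t i" for j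
  proof (rule Suc.IH)
    have "{l\<in>I. t l < t j} \<subset> {l\<in>I. t l < t i}" using that by force
    then have "card {l\<in>I. t l < t j} < card {l\<in>I. t l < t i}"
      using assms(1) by (intro psubset_card_mono) auto
    then show "card {l\<in>I. t l < t j} < k" using Suc.prems by linarith
  qed fact
  then show ?case using Suc.prems assms(1) by (auto simp: packed_iff[of r c t I i])
qed simp

text \<open>Expresses \<open>packed\<close> through countably many truncated predicates; this is what makes it measurable
  as a function of a random point set.\<close>

lemma packed_iff_trunc:
  "packed r c t I i \<longleftrightarrow> finite I \<and> i \<in> I \<and> (\<exists>K. \<forall>k\<ge>K. packed_trunc k r c t I i)"
proof (cases "finite I \<and> i \<in> I")
  case True
  let ?K = "Suc (card {j\<in>I. t j < t i})"
  have "packed_trunc k r c t I i \<longleftrightarrow> packed r c t I i" if "k \<ge> ?K" for k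
    using that True by (intro packed_trunc_eventually) auto
  then show ?thesis using True by (metis nle_le)
qed (auto simp: packed_iff[of r c t I i])

lemma packed_trunc_relabel:
  "packed_trunc k r c t (e ` J) (e i) = packed_trunc k r (c \<circ> e) (t \<circ> e) J i"
  by (induction k arbitrary: i) auto

lemma packed_trunc_cong:
  assumes "\<And>a. a \<in> insert i I \<Longrightarrow> c a = c' a"
    and "\<And>a b. a \<in> insert i I \<Longrightarrow> b \<in> insert i I \<Longrightarrow> t a < t b \<longleftrightarrow> t' a < t' b"
  shows "packed_trunc k r c t I i = packed_trunc k r c' t' I i"
  using assms
proof (induction k arbitrary: i)
  case (Suc k)
  have "packed_trunc k r c t I j = packed_trunc k r c' t' I j" if "j \<in> I" for j
    using that Suc.prems by (intro Suc.IH) auto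
  then show ?case using Suc.prems by auto
qed simp

text \<open>Each step of the recursion moves to an earlier overlapping ball, whose centre is less than
  \<open>2 * r\<close> away, so \<open>k\<close> steps stay within distance \<open>2 * r * k\<close>. Points outside \<open>J\<close> are never
  inspected.\<close>

lemma packed_trunc_local:
  assumes "0 \<le> r" "J \<subseteq> I"
    and "\<And>j. j \<in> I \<Longrightarrow> t j < t i \<Longrightarrow> dist (c j) (c i) < 2 * r * real k \<Longrightarrow> j \<in> J"
  shows "packed_trunc k r c t I i = packed_trunc k r c t J i"
  using assms(3)
proof (induction k arbitrary: i)
  case (Suc k)
  have near: "j \<in> J \<and> (packed_trunc k r c t I j = packed_trunc k r c t J j)"
    if j: "j \<in> I" "t j < t i" "overlap r (c j) (c i)" for j
  proof
    have d: "dist (c j) (c i) < 2 * r" by (rule overlap_imp_dist) fact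
    show "j \<in> J"
    proof (rule Suc.prems)
      show "dist (c j) (c i) < 2 * r * real (Suc k)"
      proof -
        have "2 * r * 1 \<le> 2 * r * real (Suc k)"
          using assms(1) by (intro mult_left_mono) auto
        then show ?thesis using d by simp
      qed
    qed (use j in auto)
    show "packed_trunc k r c t I j = packed_trunc k r c t J j"
    proof (rule Suc.IH, rule Suc.prems)
      fix l assume l: "l \<in> I" "t l < t j" "dist (c l) (c j) < 2 * r * real k"
      show "l \<in> I" "t l < t i" using l j by auto
      show "dist (c l) (c i) < 2 * r * real (Suc k)"
        using l(3) d dist_triangle[of "c l" "c i" "c j"] by (simp add: algebra_simps)
    qed
  qed
  show ?case using near assms(2) by (auto simp: subset_iff)
qed simp

lemma packed_trunc_scale:
  fixes c :: "'i \<Rightarrow> 'a::euclidean_space"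
  assumes "0 < r" "0 < s"
  shows "packed_trunc k (s * r) (\<lambda>i. x + s *\<^sub>R c i) t I i = packed_trunc k r c t I i"
proof -
  have "overlap (s * r) (x + s *\<^sub>R a) (x + s *\<^sub>R b) = overlap r a b" for a b
  proof -
    have "dist (x + s *\<^sub>R a) (x + s *\<^sub>R b) = s * dist a b"
      using assms by (simp add: dist_norm flip: scaleR_right_diff_distrib)
    then show ?thesis using assms by (simp add: overlap_iff_dist mult.left_commute)
  qed
  then show ?thesis by (induction k arbitrary: i) auto
qed

text \<open>Where two consecutive depths disagree, some earlier overlapping ball must disagree one level
  below. Following these witnesses down gives a chain of \<open>k + 1\<close> balls ending at \<open>i\<close>.\<close>

lemma packed_trunc_differ_chain:
  assumes "packed_trunc k r c t I i \<noteq> packed_trunc (Suc k) r c t I i"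
  shows "\<exists>s. s (Suc k) = i \<and> (\<forall>j\<le>k. s j \<in> I \<and> t (s j) < t (s (Suc j)) \<and>
            overlap r (c (s j)) (c (s (Suc j))))"
  using assms
proof (induction k arbitrary: i)
  case 0
  then obtain j where "j \<in> I" "t j < t i" "overlap r (c j) (c i)" by auto
  then show ?case by (intro exI[of _ "\<lambda>n. if n = 0 then j else i"]) auto
next
  case (Suc k)
  obtain j where j: "j \<in> I" "t j < t i" "overlap r (c j) (c i)"
      "packed_trunc k r c t I j \<noteq> packed_trunc (Suc k) r c t I j"
    using Suc.prems unfolding packed_trunc.simps(2)[of "Suc k"] packed_trunc.simps(2)[of k r c t I i]
    by auto
  obtain s where s: "s (Suc k) = j" "\<forall>l\<le>k. s l \<in> I \<and> t (s l) < t (s (Suc l)) \<and>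
            overlap r (c (s l)) (c (s (Suc l)))"
    using Suc.IH[OF j(4)] by auto
  show ?case
    by (rule exI[of _ "s(Suc (Suc k) := i)"]) (use s j in \<open>auto simp: le_Suc_eq\<close>)
qed

section \<open>Moebius inversion on finite sets\<close>

text \<open>The Moebius transform on the lattice of finite sets, that is the coefficients of inclusion and
  exclusion.\<close>

definition moebius :: "('i set \<Rightarrow> real) \<Rightarrow> 'i set \<Rightarrow> real" where
  "moebius H T = (\<Sum>T'\<in>Pow T. (- 1) ^ card (T - T') * H T')"

lemma sum_minus_one_Pow:
  assumes "finite A"
  shows "(\<Sum>B\<in>Pow A. (- 1 :: real) ^ card B) = (if A = {} then 1 else 0)"
proof (cases "A = {}")
  case False
  then obtain a where a: "a \<in> A" by auto
  let ?C = "A - {a}"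
  have A: "Pow A = Pow ?C \<union> insert a ` Pow ?C"
    using a Pow_insert[of a ?C] by (simp add: insert_absorb)
  have fin: "finite ?C" using assms by simp
  have "(\<Sum>B\<in>Pow A. (- 1 :: real) ^ card B)
      = (\<Sum>B\<in>Pow ?C. (-1) ^ card B) + (\<Sum>B\<in>insert a ` Pow ?C. (-1) ^ card B)"
    unfolding A using fin by (intro sum.union_disjoint) auto
  also have "(\<Sum>B\<in>insert a ` Pow ?C. (-1::real) ^ card B) = (\<Sum>B\<in>Pow ?C. (-1) ^ card (insert a B))"
    by (subst sum.reindex) (auto simp: inj_on_def)
  also have "\<dots> = (\<Sum>B\<in>Pow ?C. - ((-1) ^ card B))"
  proof (rule sum.cong)
    fix B assume "B \<in> Pow ?C"
    then have "finite B" "a \<notin> B" using fin finite_subset by auto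
    then show "(-1::real) ^ card (insert a B) = - ((-1) ^ card B)" by simp
  qed simp
  finally show ?thesis using False by (simp add: sum_negf)
qed simp

lemma moebius_inversion:
  assumes "finite S"
  shows "(\<Sum>T\<in>Pow S. moebius H T) = H S"
proof -
  have "(\<Sum>T\<in>Pow S. moebius H T)
      = (\<Sum>T\<in>Pow S. \<Sum>T'\<in>Pow S. if T' \<subseteq> T then (- 1) ^ card (T - T') * H T' else 0)"
    unfolding moebius_def
  proof (rule sum.cong)
    fix T assume "T \<in> Pow S"
    then have "{T' \<in> Pow S. T' \<subseteq> T} = Pow T" by auto
    then show "(\<Sum>T'\<in>Pow T. (- 1) ^ card (T - T') * H T')
        = (\<Sum>T'\<in>Pow S. if T' \<subseteq> T then (- 1) ^ card (T - T') * H T' else 0)"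
      using assms by (simp add: sum.If_cases Int_def)
  qed simp
  also have "\<dots> = (\<Sum>T'\<in>Pow S. \<Sum>T\<in>Pow S. if T' \<subseteq> T then (- 1) ^ card (T - T') * H T' else 0)"
    by (rule sum.swap)
  also have "\<dots> = (\<Sum>T'\<in>Pow S. if T' = S then H S else 0)"
  proof (rule sum.cong)
    fix T' assume T': "T' \<in> Pow S"
    have "(\<Sum>T\<in>Pow S. if T' \<subseteq> T then (- 1) ^ card (T - T') * H T' else 0)
        = (\<Sum>T\<in>{T\<in>Pow S. T' \<subseteq> T}. (- 1) ^ card (T - T')) * H T'"
      using assms by (simp add: sum.If_cases Int_def sum_distrib_right)
    also have "(\<Sum>T\<in>{T\<in>Pow S. T' \<subseteq> T}. (- 1::real) ^ card (T - T')) = (\<Sum>B\<in>Pow (S - T'). (- 1) ^ card B)"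
      by (rule sum.reindex_bij_witness[of _ "\<lambda>B. B \<union> T'" "\<lambda>T. T - T'"])
        (use T' in \<open>auto intro!: arg_cong[where f=card]\<close>)
    also have "\<dots> = (if S - T' = {} then 1 else 0)"
      using assms by (intro sum_minus_one_Pow) auto
    finally show "(\<Sum>T\<in>Pow S. if T' \<subseteq> T then (- 1) ^ card (T - T') * H T' else 0)
        = (if T' = S then H S else 0)" using T' by auto
  qed simp
  also have "\<dots> = H S" using assms by simp
  finally show ?thesis .
qed

text \<open>The subsets with and without an irrelevant point \<open>a\<close> cancel in pairs.\<close>

lemma moebius_eq_0:
  assumes "finite T" "a \<in> T" "\<And>T'. T' \<subseteq> T - {a} \<Longrightarrow> H (insert a T') = H T'"
  shows "moebius H T = 0"
proof -
  let ?C = "T - {a}"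
  have A: "Pow T = Pow ?C \<union> insert a ` Pow ?C"
    using assms(2) Pow_insert[of a ?C] by (simp add: insert_absorb)
  have fin: "finite ?C" using assms by simp
  have "moebius H T = (\<Sum>B\<in>Pow ?C. (-1) ^ card (T - B) * H B)
      + (\<Sum>B\<in>insert a ` Pow ?C. (-1) ^ card (T - B) * H B)"
    unfolding A moebius_def using fin by (intro sum.union_disjoint) auto
  also have "(\<Sum>B\<in>insert a ` Pow ?C. (-1) ^ card (T - B) * H B)
      = (\<Sum>B\<in>Pow ?C. (-1) ^ card (T - insert a B) * H (insert a B))"
    by (subst sum.reindex) (auto simp: inj_on_def)
  also have "\<dots> = (\<Sum>B\<in>Pow ?C. - ((-1) ^ card (T - B) * H B))"
  proof (rule sum.cong)
    fix B assume B: "B \<in> Pow ?C"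
    then have "T - B = insert a (T - insert a B)" using assms by auto
    then have "card (T - B) = Suc (card (T - insert a B))"
      using assms(1) by (metis DiffE card_insert_disjoint finite_Diff insertI1)
    then show "(-1) ^ card (T - insert a B) * H (insert a B) = - ((-1) ^ card (T - B) * H B)"
      using B assms(3)[of B] by simp
  qed simp
  finally show ?thesis by (simp add: sum_negf)
qed

lemma abs_moebius_le:
  assumes "finite T" "\<And>T'. \<bar>H T'\<bar> \<le> 1"
  shows "\<bar>moebius H T\<bar> \<le> 2 ^ card T"
proof -
  have "\<bar>moebius H T\<bar> \<le> (\<Sum>T'\<in>Pow T. \<bar>(- 1) ^ card (T - T') * H T'\<bar>)"
    unfolding moebius_def by (rule sum_abs)
  also have "\<dots> \<le> (\<Sum>T'\<in>Pow T. 1)"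
    using assms(2) by (intro sum_mono) (simp add: abs_mult power_abs)
  finally show ?thesis using assms(1) by (simp add: card_Pow)
qed

lemma moebius_relabel:
  assumes "inj_on e A"
  shows "moebius H (e ` A) = moebius (\<lambda>T. H (e ` T)) A"
proof -
  have "inj_on ((`) e) (Pow A)" using assms by (simp add: inj_on_image_Pow)
  moreover have "card (e ` A - e ` T) = card (A - T)" if "T \<subseteq> A" for T
    using assms that by (metis Diff_subset card_image inj_on_image_set_diff inj_on_subset subset_refl)
  ultimately show ?thesis
    unfolding moebius_def by (simp add: image_Pow_surj[symmetric] sum.reindex)
qed

section \<open>Cluster weights\<close>

text \<open>The contribution of the point set \<open>T\<close>, taken jointly, to the truncated packing of site \<open>i\<close>.
  Cluster weights replace a nonlinear indicator by a sum over point sets, whose mean is governed by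
  factorial moments.\<close>

definition cluster_weight ::
  "nat \<Rightarrow> real \<Rightarrow> ('i \<Rightarrow> 'a::metric_space) \<Rightarrow> ('i \<Rightarrow> 't::linorder) \<Rightarrow> 'i set \<Rightarrow> 'i \<Rightarrow> real" where
  "cluster_weight k r c t T i = moebius (\<lambda>T'. of_bool (packed_trunc k r c t T' i)) T"

lemma sum_cluster_weight:
  "finite S \<Longrightarrow> (\<Sum>T\<in>Pow S. cluster_weight k r c t T i) = of_bool (packed_trunc k r c t S i)"
  unfolding cluster_weight_def by (rule moebius_inversion)

lemma abs_cluster_weight_le: "finite T \<Longrightarrow> \<bar>cluster_weight k r c t T i\<bar> \<le> 2 ^ card T"
  unfolding cluster_weight_def by (rule abs_moebius_le) auto

text \<open>A point that is not earlier than the site, or out of range, does not influence the truncated rule,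
  so it makes the alternating sum cancel.\<close>

lemma cluster_weight_eq_0:
  assumes "0 \<le> r" "finite T" "j \<in> T" "\<not> (t j < t i \<and> dist (c j) (c i) < 2 * r * real k)"
  shows "cluster_weight k r c t T i = 0"
  unfolding cluster_weight_def
proof (rule moebius_eq_0)
  fix T'
  have "packed_trunc k r c t (insert j T') i = packed_trunc k r c t T' i"
    using assms by (intro packed_trunc_local) auto
  then show "of_bool (packed_trunc k r c t (insert j T') i) = (of_bool (packed_trunc k r c t T' i) :: real)"
    by simp
qed (use assms in auto)

lemma cluster_weight_relabel:
  "inj_on e A \<Longrightarrow> cluster_weight k r c t (e ` A) (e i) = cluster_weight k r (c \<circ> e) (t \<circ> e) A i"
  unfolding cluster_weight_def by (simp add: moebius_relabel packed_trunc_relabel)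

lemma cluster_weight_cong:
  assumes "\<And>a. a \<in> insert i T \<Longrightarrow> c a = c' a"
    and "\<And>a b. a \<in> insert i T \<Longrightarrow> b \<in> insert i T \<Longrightarrow> t a < t b \<longleftrightarrow> t' a < t' b"
  shows "cluster_weight k r c t T i = cluster_weight k r c' t' T i"
proof -
  have "packed_trunc k r c t T' i = packed_trunc k r c' t' T' i" if "T' \<subseteq> T" for T'
    using that by (intro packed_trunc_cong assms) auto
  then show ?thesis unfolding cluster_weight_def moebius_def by (intro sum.cong) auto
qed

lemma cluster_weight_scale:
  fixes c :: "'i \<Rightarrow> 'a::euclidean_space"
  assumes "0 < r" "0 < s"
  shows "cluster_weight k (s * r) (\<lambda>i. x + s *\<^sub>R c i) t T i = cluster_weight k r c t T i"
  unfolding cluster_weight_def packed_trunc_scale[OF assms] ..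

text \<open>The index set itself may be random, as needed for the points of a Poisson process in a
  window. The labels are countable, so each step of the recursion is a countable conjunction.\<close>

lemma measurable_packed_trunc:
  fixes I :: "'w \<Rightarrow> 'i::countable set"
  assumes mem: "\<And>j. Measurable.pred M (\<lambda>\<omega>. j \<in> I \<omega>)" and sub: "\<And>\<omega>. I \<omega> \<subseteq> J"
    and t: "\<And>j l. j \<in> J \<Longrightarrow> l \<in> J \<Longrightarrow> Measurable.pred M (\<lambda>\<omega>. t \<omega> j < t \<omega> l)"
    and c: "\<And>j l. j \<in> J \<Longrightarrow> l \<in> J \<Longrightarrow> Measurable.pred M (\<lambda>\<omega>. overlap r (c \<omega> j) (c \<omega> l))"
    and "i \<in> J"
  shows "Measurable.pred M (\<lambda>\<omega>. packed_trunc k r (c \<omega>) (t \<omega>) (I \<omega>) i)"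
  using \<open>i \<in> J\<close>
proof (induction k arbitrary: i)
  case (Suc k)
  have [measurable]: "Measurable.pred M (\<lambda>\<omega>. j \<in> I \<omega> \<longrightarrow> t \<omega> j < t \<omega> i \<and> overlap r (c \<omega> j) (c \<omega> i)
      \<longrightarrow> \<not> packed_trunc k r (c \<omega>) (t \<omega>) (I \<omega>) j)" for j
  proof (cases "j \<in> J")
    case True
    note [measurable] = mem t[OF True Suc.prems] c[OF True Suc.prems] Suc.IH[OF True]
    show ?thesis by measurable
  next
    case False
    then have "j \<notin> I \<omega>" for \<omega> using sub by auto
    then show ?thesis by simp
  qed
  have "(\<lambda>\<omega>. packed_trunc (Suc k) r (c \<omega>) (t \<omega>) (I \<omega>) i) = (\<lambda>\<omega>. \<forall>j. j \<in> I \<omega> \<longrightarrow>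
     t \<omega> j < t \<omega> i \<and> overlap r (c \<omega> j) (c \<omega> i) \<longrightarrow> \<not> packed_trunc k r (c \<omega>) (t \<omega>) (I \<omega>) j)"
    by (auto simp: fun_eq_iff)
  then show ?case by simp
qed simp

lemma measurable_overlap:
  fixes f g :: "'w \<Rightarrow> 'a::euclidean_space"
  assumes "0 < r" and [measurable]: "f \<in> borel_measurable M" "g \<in> borel_measurable M"
  shows "Measurable.pred M (\<lambda>\<omega>. overlap r (f \<omega>) (g \<omega>))"
  unfolding overlap_iff_dist[OF assms(1)] by measurable

lemma measurable_cluster_weight:
  fixes T :: "'i::countable set" and c :: "'w \<Rightarrow> 'i \<Rightarrow> 'a::euclidean_space"
  assumes "0 < r"
    and t: "\<And>j l. j \<in> insert i T \<Longrightarrow> l \<in> insert i T \<Longrightarrow> Measurable.pred M (\<lambda>\<omega>. t \<omega> j < t \<omega> l)"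
    and c: "\<And>j. j \<in> insert i T \<Longrightarrow> (\<lambda>\<omega>. c \<omega> j) \<in> borel_measurable M"
  shows "(\<lambda>\<omega>. cluster_weight k r (c \<omega>) (t \<omega>) T i) \<in> borel_measurable M"
proof -
  have "Measurable.pred M (\<lambda>\<omega>. packed_trunc k r (c \<omega>) (t \<omega>) T' i)" if "T' \<subseteq> T" for T'
    by (rule measurable_packed_trunc[where J="insert i T"])
      (use that assms in \<open>auto intro!: measurable_overlap\<close>)
  then have [measurable]: "(\<lambda>\<omega>. of_bool (packed_trunc k r (c \<omega>) (t \<omega>) T' i) :: real) \<in> borel_measurable M" if "T' \<subseteq> T" for T'
    using that by measurable
  show ?thesis unfolding cluster_weight_def moebius_def
    by (intro borel_measurable_sum borel_measurable_times) auto
qed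

section \<open>Factorial moment measures of a Poisson process\<close>

text \<open>Ordered tuples of pairwise distinct labels. Summing over them, rather than over sets of labels,
  gives the factorial moment measures.\<close>

definition inj_tuples :: "nat \<Rightarrow> (nat \<Rightarrow> nat) set" where
  "inj_tuples m = {e \<in> PiE {..<m} (\<lambda>_. UNIV). inj_on e {..<m}}"

lemma countable_inj_tuples [simp]: "countable (inj_tuples m)"
  unfolding inj_tuples_def by (rule countable_subset[of _ "PiE {..<m} (\<lambda>_. UNIV)"]) (auto intro!: countable_PiE)

definition ffact_real :: "real \<Rightarrow> nat \<Rightarrow> real" where
  "ffact_real x n = (\<Prod>i<n. x - real i)"

lemma ffact_real_nat: "ffact_real (real k) n = (if k < n then 0 else fact k / fact (k - n))"
proof (induction n)
  case (Suc n)
  have *: "ffact_real (real k) (Suc n) = ffact_real (real k) n * (real k - real n)"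
    by (simp add: ffact_real_def)
  show ?case
  proof (cases "k < Suc n")
    case True
    then show ?thesis unfolding * using Suc by (cases "k = n") auto
  next
    case False
    then have "k - n = Suc (k - Suc n)" by simp
    then have "fact (k - n) = (real k - real n) * fact (k - Suc n)"
      using False by (simp add: of_nat_diff)
    then show ?thesis using Suc False by (simp add: *)
  qed
qed (simp add: ffact_real_def)

lemma ffact_real_nonneg: "0 \<le> ffact_real (real k) n"
  by (simp add: ffact_real_nat)

lemma poisson_ffact_sums:
  fixes l :: real
  shows "(\<lambda>k. ffact_real (real k) n * (l ^ k / fact k * exp (- l))) sums (l ^ n)"
proof -
  let ?f = "\<lambda>k. ffact_real (real k) n * (l ^ k / fact k * exp (- l))"
  have "(\<lambda>k. l ^ n * exp (- l) * (l ^ k /\<^sub>R fact k)) sums (l ^ n * exp (- l) * exp l)"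
    by (intro sums_mult exp_converges)
  moreover have "?f (k + n) = l ^ n * exp (- l) * (l ^ k /\<^sub>R fact k)" for k
  proof -
    have "ffact_real (real (k + n)) n = fact (k + n) / fact k" by (simp only: ffact_real_nat) simp
    then show ?thesis by (simp add: field_simps power_add del: of_nat_add)
  qed
  moreover have "l ^ n * exp (- l) * exp l = l ^ n" by (simp add: exp_minus)
  ultimately have "(\<lambda>k. ?f (k + n)) sums (l ^ n)"
    by simp
  then have "?f sums (l ^ n + sum ?f {..<n})" using sums_iff_shift[of ?f n "l ^ n"] by simp
  moreover have "sum ?f {..<n} = 0" by (intro sum.neutral) (auto simp: ffact_real_nat)
  ultimately show ?thesis by simp
qed

text \<open>Coordinates with different values of \<open>K\<close> range over disjoint sets and never collide; the
  coordinates with a common value \<open>a\<close> are an injective tuple in \<open>N a\<close>, of which there are a falling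
  factorial. The induction adds the last coordinate, which must avoid the earlier ones of its class.\<close>

lemma card_inj_tuples_disjoint:
  fixes N :: "'k \<Rightarrow> nat set" and K :: "nat \<Rightarrow> 'k"
  assumes "finite F" "\<And>j. j < m \<Longrightarrow> K j \<in> F" "\<And>a. a \<in> F \<Longrightarrow> finite (N a)"
    and "\<And>a b. a \<in> F \<Longrightarrow> b \<in> F \<Longrightarrow> a \<noteq> b \<Longrightarrow> N a \<inter> N b = {}"
  shows "real (card {e \<in> PiE {..<m} (\<lambda>j. N (K j)). inj_on e {..<m}})
    = (\<Prod>a\<in>F. ffact_real (real (card (N a))) (card {l. l < m \<and> K l = a}))"
  using assms(2)
proof (induction m)
  case 0
  then show ?case by (simp add: ffact_real_def)
next
  case (Suc m)
  let ?E = "\<lambda>m. {e \<in> PiE {..<m} (\<lambda>j. N (K j)). inj_on e {..<m}}"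
  let ?S = "SIGMA e : ?E m. N (K m) - e ` {..<m}"
  have finE: "finite (?E m)"
    using Suc.prems assms(3) by (intro finite_subset[OF _ finite_PiE[of "{..<m}" "\<lambda>j. N (K j)"]]) auto
  have "bij_betw (\<lambda>(e, x). e(m := x)) ?S (?E (Suc m))"
  proof (rule bij_betwI[where g = "\<lambda>e. (restrict e {..<m}, e m)"])
    show "(\<lambda>(e, x). e(m := x)) \<in> ?S \<rightarrow> ?E (Suc m)"
      by (auto simp: lessThan_Suc PiE_iff inj_on_def extensional_def image_iff)
    show "(\<lambda>e. (restrict e {..<m}, e m)) \<in> ?E (Suc m) \<rightarrow> ?S"
    proof
      fix e assume e: "e \<in> ?E (Suc m)"
      then have "e m \<notin> e ` {..<m}" using inj_on_image_mem_iff[of e "{..<Suc m}" m "{..<m}"] by auto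
      moreover have "inj_on (restrict e {..<m}) {..<m}" using e by (auto simp: inj_on_def)
      ultimately show "(restrict e {..<m}, e m) \<in> ?S" using e by (simp add: PiE_iff)
    qed
    show "(\<lambda>e. (restrict e {..<m}, e m)) ((\<lambda>(e, x). e(m := x)) p) = p" if "p \<in> ?S" for p
      using that by (auto simp: PiE_iff extensional_def fun_eq_iff)
    show "(\<lambda>(e, x). e(m := x)) ((\<lambda>e. (restrict e {..<m}, e m)) e) = e" if "e \<in> ?E (Suc m)" for e
      using that by (auto simp: PiE_iff extensional_def fun_eq_iff)
  qed
  then have "card (?E (Suc m)) = card ?S" by (simp add: bij_betw_same_card)
  also have "\<dots> = (\<Sum>e\<in>?E m. card (N (K m) - e ` {..<m}))"
    using finE assms(3) Suc.prems by (intro card_SigmaI) auto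
  finally have "real (card (?E (Suc m))) = (\<Sum>e\<in>?E m. real (card (N (K m) - e ` {..<m})))" by simp
  also have "\<dots> = (\<Sum>e\<in>?E m. real (card (N (K m))) - real (card {l. l < m \<and> K l = K m}))"
  proof (rule sum.cong)
    fix e assume e: "e \<in> ?E m"
    have eN: "e l \<in> N (K l)" if "l < m" for l
      using e that PiE_mem[of e "{..<m}" "\<lambda>j. N (K j)" l] by simp
    have int: "N (K m) \<inter> e ` {..<m} = e ` {l. l < m \<and> K l = K m}"
    proof (intro subset_antisym subsetI)
      fix x assume "x \<in> N (K m) \<inter> e ` {..<m}"
      then obtain l where l: "l < m" "x = e l" "e l \<in> N (K m)" by auto
      then have "K l = K m" using eN[of l] assms(4)[of "K l" "K m"] Suc.prems[of l] Suc.prems[of m] by auto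
      then show "x \<in> e ` {l. l < m \<and> K l = K m}" using l by auto
    next
      fix x assume "x \<in> e ` {l. l < m \<and> K l = K m}"
      then obtain l where l: "l < m" "x = e l" "K l = K m" by auto
      then show "x \<in> N (K m) \<inter> e ` {..<m}" using eN[of l] by simp
    qed
    have fin: "finite (N (K m))" using assms(3) Suc.prems by auto
    have "card (N (K m) \<inter> e ` {..<m}) = card {l. l < m \<and> K l = K m}"
      unfolding int
    proof (rule card_image)
      have "inj_on e {..<m}" using e by simp
      then show "inj_on e {l. l < m \<and> K l = K m}" by (rule inj_on_subset) auto
    qed
    moreover have "card (N (K m) - e ` {..<m}) = card (N (K m)) - card (N (K m) \<inter> e ` {..<m})"
      using fin by (intro card_Diff_subset_Int) auto
    moreover have "card (N (K m) \<inter> e ` {..<m}) \<le> card (N (K m))" using fin by (intro card_mono) auto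
    ultimately show "real (card (N (K m) - e ` {..<m})) = real (card (N (K m))) - real (card {l. l < m \<and> K l = K m})"
      by (simp add: of_nat_diff)
  qed simp
  also have "\<dots> = real (card (?E m)) * (real (card (N (K m))) - real (card {l. l < m \<and> K l = K m}))"
    by simp
  also have "\<dots> = (\<Prod>a\<in>F. ffact_real (real (card (N a))) (card {l. l < m \<and> K l = a})) *
      (\<Prod>a\<in>F. if a = K m then real (card (N (K m))) - real (card {l. l < m \<and> K l = K m}) else 1)"
    using Suc assms(1) by simp
  also have "\<dots> = (\<Prod>a\<in>F. ffact_real (real (card (N a))) (card {l. l < Suc m \<and> K l = a}))"
    unfolding prod.distrib[symmetric]
  proof (rule prod.cong)
    fix a assume "a \<in> F"
    show "ffact_real (real (card (N a))) (card {l. l < m \<and> K l = a}) *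
        (if a = K m then real (card (N (K m))) - real (card {l. l < m \<and> K l = K m}) else 1)
      = ffact_real (real (card (N a))) (card {l. l < Suc m \<and> K l = a})"
    proof (cases "a = K m")
      case True
      then have "{l. l < Suc m \<and> K l = a} = insert m {l. l < m \<and> K l = a}" by auto
      then have "card {l. l < Suc m \<and> K l = a} = Suc (card {l. l < m \<and> K l = a})" by simp
      then show ?thesis using True by (simp add: ffact_real_def)
    next
      case False
      then have "{l. l < Suc m \<and> K l = a} = {l. l < m \<and> K l = a}" by (auto simp: less_Suc_eq)
      then show ?thesis using False by simp
    qed
  qed simp
  finally show ?case .
qed

lemma poisson_process_AE_finite:
  assumes "poisson_process Q \<tau> Z" "A \<in> sets borel" "bounded A"
  shows "AE \<omega> in Q. finite {i. Z i \<omega> \<in> A}"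
  using assms by (auto simp: poisson_process_def)

lemma measurable_card_count_space:
  fixes P :: "nat \<Rightarrow> 'v \<Rightarrow> bool"
  assumes [measurable]: "\<And>i. Measurable.pred Q (P i)"
  shows "(\<lambda>\<omega>. card {i. P i \<omega>}) \<in> Q \<rightarrow>\<^sub>M count_space UNIV"
  by measurable

text \<open>The factorial moments of a Poisson variable are the powers of its mean.\<close>

lemma poisson_process_ffact_moment:
  assumes pp: "poisson_process Q \<tau> Z" and A: "A \<in> sets borel" "bounded A" and "0 \<le> \<tau>"
  shows "(\<integral>\<^sup>+\<omega>. ennreal (ffact_real (real (card {i. Z i \<omega> \<in> A})) n) \<partial>Q) = ennreal ((\<tau> * measure lborel A) ^ n)"
proof -
  interpret prob_space Q using pp by (simp add: poisson_process_def)
  have [measurable]: "Z i \<in> Q \<rightarrow>\<^sub>M borel" for i using pp by (simp add: poisson_process_def)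
  note [measurable] = A(1)
  let ?N = "\<lambda>\<omega>. card {i. Z i \<omega> \<in> A}"
  have [measurable]: "?N \<in> Q \<rightarrow>\<^sub>M count_space UNIV" by (rule measurable_card_count_space) measurable
  have "(\<integral>\<^sup>+\<omega>. ennreal (ffact_real (real (?N \<omega>)) n) \<partial>Q)
      = (\<integral>\<^sup>+\<omega>. (\<Sum>k. ennreal (ffact_real (real k) n) * indicator {\<omega>\<in>space Q. ?N \<omega> = k} \<omega>) \<partial>Q)"
  proof (rule nn_integral_cong)
    fix \<omega> assume "\<omega> \<in> space Q"
    moreover have "(\<Sum>k. ennreal (ffact_real (real k) n) * indicator {\<omega>\<in>space Q. ?N \<omega> = k} \<omega>)
        = (\<Sum>k\<in>{?N \<omega>}. ennreal (ffact_real (real k) n) * indicator {\<omega>\<in>space Q. ?N \<omega> = k} \<omega>)"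
      by (rule suminf_finite) auto
    ultimately show "ennreal (ffact_real (real (?N \<omega>)) n)
        = (\<Sum>k. ennreal (ffact_real (real k) n) * indicator {\<omega>\<in>space Q. ?N \<omega> = k} \<omega>)"
      by simp
  qed
  also have "\<dots> = (\<Sum>k. ennreal (ffact_real (real k) n) * emeasure Q {\<omega>\<in>space Q. ?N \<omega> = k})"
    by (subst nn_integral_suminf) (auto simp: nn_integral_cmult)
  also have "\<dots> = (\<Sum>k. ennreal (ffact_real (real k) n * ((\<tau> * measure lborel A) ^ k / fact k * exp (- (\<tau> * measure lborel A)))))"
  proof (intro suminf_cong)
    fix k
    have "measure Q {\<omega>\<in>space Q. ?N \<omega> = k} = (\<tau> * measure lborel A) ^ k / fact k * exp (- (\<tau> * measure lborel A))"
      using pp A by (simp add: poisson_process_def)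
    then show "ennreal (ffact_real (real k) n) * emeasure Q {\<omega>\<in>space Q. ?N \<omega> = k}
      = ennreal (ffact_real (real k) n * ((\<tau> * measure lborel A) ^ k / fact k * exp (- (\<tau> * measure lborel A))))"
      using assms(4) by (simp only: emeasure_eq_measure) (simp add: ennreal_mult[symmetric] ffact_real_nonneg)
  qed
  also have "\<dots> = ennreal ((\<tau> * measure lborel A) ^ n)"
    using assms(4) by (intro suminf_ennreal_eq poisson_ffact_sums) (auto simp: ffact_real_nonneg)
  finally show ?thesis .
qed

text \<open>For windows that are equal or disjoint, the number of tuples is a product of falling
  factorials of independent Poisson counts.\<close>

lemma poisson_process_inj_tuples_atoms:
  fixes Z :: "nat \<Rightarrow> 'v \<Rightarrow> 'a::euclidean_space"
  assumes pp: "poisson_process Q \<tau> Z" and "0 \<le> \<tau>"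
    and F: "finite F" "disjoint F" "\<And>a. a \<in> F \<Longrightarrow> a \<in> sets borel \<and> bounded a"
    and K: "\<And>j. j < m \<Longrightarrow> K j \<in> F"
  shows "(\<integral>\<^sup>+\<omega>. ennreal (real (card {e \<in> inj_tuples m. \<forall>j<m. Z (e j) \<omega> \<in> K j})) \<partial>Q)
    = (\<Prod>j<m. ennreal (\<tau> * measure lborel (K j)))"
proof -
  interpret prob_space Q using pp by (simp add: poisson_process_def)
  have [measurable]: "Z i \<in> Q \<rightarrow>\<^sub>M borel" for i using pp by (simp add: poisson_process_def)
  let ?N = "\<lambda>\<omega> a. {i. Z i \<omega> \<in> a}"
  let ?mult = "\<lambda>a. card {l. l < m \<and> K l = a}"
  have fin: "AE \<omega> in Q. \<forall>a\<in>F. finite (?N \<omega> a)"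
    using F poisson_process_AE_finite[OF pp] by (subst AE_finite_all) auto
  have "(\<integral>\<^sup>+\<omega>. ennreal (real (card {e \<in> inj_tuples m. \<forall>j<m. Z (e j) \<omega> \<in> K j})) \<partial>Q)
      = (\<integral>\<^sup>+\<omega>. (\<Prod>a\<in>F. ennreal (ffact_real (real (card (?N \<omega> a))) (?mult a))) \<partial>Q)"
  proof (rule nn_integral_cong_AE, use fin in eventually_elim)
    case (elim \<omega>)
    have "{e \<in> inj_tuples m. \<forall>j<m. Z (e j) \<omega> \<in> K j} = {e \<in> PiE {..<m} (\<lambda>j. ?N \<omega> (K j)). inj_on e {..<m}}"
      by (auto simp: inj_tuples_def PiE_iff)
    moreover have "real (card {e \<in> PiE {..<m} (\<lambda>j. ?N \<omega> (K j)). inj_on e {..<m}})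
       = (\<Prod>a\<in>F. ffact_real (real (card (?N \<omega> a))) (?mult a))"
      using F K elim by (intro card_inj_tuples_disjoint) (auto simp: disjoint_def)
    ultimately show ?case by (simp add: prod_ennreal ffact_real_nonneg)
  qed
  also have "\<dots> = (\<Prod>a\<in>F. \<integral>\<^sup>+\<omega>. ennreal (ffact_real (real (card (?N \<omega> a))) (?mult a)) \<partial>Q)"
  proof (rule indep_vars_nn_integral)
    have "indep_vars (\<lambda>_. count_space UNIV) (\<lambda>A \<omega>. card {i. Z i \<omega> \<in> A}) F"
      using pp F by (auto simp: poisson_process_def)
    from indep_vars_compose2[OF this, of "\<lambda>a k. ennreal (ffact_real (real k) (?mult a))" "\<lambda>_. borel"]
    show "indep_vars (\<lambda>_. borel) (\<lambda>a \<omega>. ennreal (ffact_real (real (card (?N \<omega> a))) (?mult a))) F"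
      by simp
  qed (use F in auto)
  also have "\<dots> = (\<Prod>a\<in>F. ennreal ((\<tau> * measure lborel a) ^ ?mult a))"
    using F assms(2) by (intro prod.cong refl poisson_process_ffact_moment[OF pp]) auto
  also have "\<dots> = (\<Prod>a\<in>F. \<Prod>j\<in>{j\<in>{..<m}. K j = a}. ennreal (\<tau> * measure lborel (K j)))"
    using assms(2) by (intro prod.cong refl) (simp add: ennreal_power)
  also have "\<dots> = (\<Prod>j<m. ennreal (\<tau> * measure lborel (K j)))"
    using F K by (intro prod.group) auto
  finally show ?thesis .
qed

lemma measurable_pair_count:
  assumes "countable I" "\<And>i. i \<in> I \<Longrightarrow> f i \<in> M \<rightarrow>\<^sub>M N"
  shows "(\<lambda>(x, i). f i x) \<in> M \<Otimes>\<^sub>M count_space I \<rightarrow>\<^sub>M N"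
proof -
  have "(\<lambda>p. f (snd p) (fst p)) \<in> M \<Otimes>\<^sub>M count_space I \<rightarrow>\<^sub>M N"
    by (rule measurable_compose_countable'[where g=snd and I=I])
      (auto intro!: measurable_compose[OF measurable_fst] assms)
  then show ?thesis by (simp add: case_prod_beta')
qed

text \<open>The number of tuples is a countable sum of indicators; since \<open>card\<close> is \<open>0\<close> on infinite sets,
  the value \<open>\<infinity>\<close> of that sum has to be replaced by \<open>0\<close>.\<close>

lemma measurable_card_inj_tuples:
  fixes Z :: "nat \<Rightarrow> 'v \<Rightarrow> 'a::topological_space"
  assumes [measurable]: "\<And>i. Z i \<in> Q \<rightarrow>\<^sub>M borel" "\<And>j. j < m \<Longrightarrow> K j \<in> sets borel"
  shows "(\<lambda>\<omega>. ennreal (real (card {e \<in> inj_tuples m. \<forall>j<m. Z (e j) \<omega> \<in> K j}))) \<in> borel_measurable Q"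
proof -
  let ?E = "\<lambda>\<omega>. {e \<in> inj_tuples m. \<forall>j<m. Z (e j) \<omega> \<in> K j}"
  let ?g = "\<lambda>\<omega>. \<integral>\<^sup>+e. indicator {\<omega>\<in>space Q. \<forall>j\<in>{..<m}. Z (e j) \<omega> \<in> K j} \<omega> \<partial>count_space (inj_tuples m)"
  have "{\<omega>\<in>space Q. \<forall>j\<in>{..<m}. Z (e j) \<omega> \<in> K j} \<in> sets Q" for e
    by measurable
  then have "(\<lambda>(\<omega>, e). indicator {\<omega>\<in>space Q. \<forall>j\<in>{..<m}. Z (e j) \<omega> \<in> K j} \<omega> :: ennreal)
      \<in> borel_measurable (Q \<Otimes>\<^sub>M count_space (inj_tuples m))"
    by (intro measurable_pair_count borel_measurable_indicator) auto
  then have [measurable]: "?g \<in> borel_measurable Q"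
    by (intro sigma_finite_measure.borel_measurable_nn_integral sigma_finite_measure_count_space_countable) auto
  have "?g \<omega> = emeasure (count_space (inj_tuples m)) (?E \<omega>)" if "\<omega> \<in> space Q" for \<omega>
  proof -
    have "?g \<omega> = (\<integral>\<^sup>+e. indicator (?E \<omega>) e \<partial>count_space (inj_tuples m))"
      using that by (intro nn_integral_cong) (auto simp: indicator_def)
    then show ?thesis by simp
  qed
  then have "ennreal (real (card (?E \<omega>))) = (if ?g \<omega> = \<infinity> then 0 else ?g \<omega>)" if "\<omega> \<in> space Q" for \<omega>
    using that by (cases "finite (?E \<omega>)")
      (auto simp: emeasure_count_space_finite emeasure_count_space_infinite ennreal_of_nat_eq_real_of_nat)
  then show ?thesis by (subst measurable_cong) auto
qed

text \<open>Overlapping windows are cut into the atoms of the finite algebra they generate; a tuple falls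
  into exactly one choice of atoms, and both sides are additive over these choices.\<close>

lemma poisson_process_inj_tuples_bounded:
  fixes Z :: "nat \<Rightarrow> 'v \<Rightarrow> 'a::euclidean_space"
  assumes pp: "poisson_process Q \<tau> Z" and "0 \<le> \<tau>"
    and A: "\<And>j. j < m \<Longrightarrow> A j \<in> sets borel \<and> bounded (A j)"
  shows "(\<integral>\<^sup>+\<omega>. emeasure (count_space (inj_tuples m)) {e \<in> inj_tuples m. \<forall>j<m. Z (e j) \<omega> \<in> A j} \<partial>Q)
    = (\<Prod>j<m. ennreal (\<tau> * measure lborel (A j)))"
proof -
  interpret prob_space Q using pp by (simp add: poisson_process_def)
  have [measurable]: "Z i \<in> Q \<rightarrow>\<^sub>M borel" for i using pp by (simp add: poisson_process_def)
  define B where "B = (\<Union>j<m. A j)"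
  define atom where "atom y = {x\<in>B. \<forall>j<m. x \<in> A j \<longleftrightarrow> y \<in> A j}" for y
  define F where "F = atom ` B"
  have [measurable]: "j < m \<Longrightarrow> A j \<in> sets borel" for j using A by auto
  have B: "B \<in> sets borel" "bounded B" using A by (auto simp: B_def intro!: bounded_UN)
  have fin: "finite F"
  proof (rule finite_subset)
    show "F \<subseteq> (\<lambda>S. {x\<in>B. \<forall>j<m. x \<in> A j \<longleftrightarrow> j \<in> S}) ` Pow {..<m}"
    proof
      fix a assume "a \<in> F"
      then obtain y where "a = atom y" by (auto simp: F_def)
      then have "a = (\<lambda>S. {x\<in>B. \<forall>j<m. x \<in> A j \<longleftrightarrow> j \<in> S}) {j. j < m \<and> y \<in> A j}"
        by (auto simp: atom_def)
      then show "a \<in> (\<lambda>S. {x\<in>B. \<forall>j<m. x \<in> A j \<longleftrightarrow> j \<in> S}) ` Pow {..<m}"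
        by (rule image_eqI) auto
    qed
  qed auto
  have disj: "disjoint F"
    unfolding disjoint_def F_def by (auto simp: atom_def)
  have sets: "a \<in> sets borel \<and> bounded a" if "a \<in> F" for a
  proof -
    from that obtain y where a: "a = atom y" by (auto simp: F_def)
    have "atom y = {x \<in> space borel. x \<in> B \<and> (\<forall>j\<in>{..<m}. x \<in> A j \<longleftrightarrow> y \<in> A j)}"
      by (auto simp: atom_def)
    also have "\<dots> \<in> sets borel"
      using B(1) by measurable
    finally show ?thesis using B bounded_subset[OF B(2), of a] by (auto simp: a atom_def)
  qed
  \<comment> \<open>The atoms below the \<open>j\<close>-th window, which they partition.\<close>
  define Fs where "Fs j = {a\<in>F. a \<subseteq> A j}" for j
  have finFs: "finite (Fs j)" for j using fin by (auto simp: Fs_def)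
  have A_Un: "A j = \<Union>(Fs j)" if "j < m" for j
  proof (intro subset_antisym subsetI)
    fix x assume "x \<in> A j"
    then have "x \<in> atom x" "atom x \<in> Fs j" using that by (auto simp: Fs_def F_def atom_def B_def)
    then show "x \<in> \<Union>(Fs j)" by auto
  qed (auto simp: Fs_def)
  have unique: "a = b" if "a \<in> F" "b \<in> F" "x \<in> a" "x \<in> b" for a b x
    using disj that by (auto simp: disjoint_def)
  let ?E = "\<lambda>\<omega> K. {e \<in> inj_tuples m. \<forall>j<m. Z (e j) \<omega> \<in> K j}"
  have "(\<integral>\<^sup>+\<omega>. emeasure (count_space (inj_tuples m)) (?E \<omega> A) \<partial>Q)
     = (\<integral>\<^sup>+\<omega>. (\<Sum>K\<in>PiE {..<m} Fs. ennreal (real (card (?E \<omega> K)))) \<partial>Q)"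
  proof (rule nn_integral_cong_AE)
    have "AE \<omega> in Q. finite {i. Z i \<omega> \<in> B}" by (rule poisson_process_AE_finite[OF pp B])
    then show "AE \<omega> in Q. emeasure (count_space (inj_tuples m)) (?E \<omega> A)
       = (\<Sum>K\<in>PiE {..<m} Fs. ennreal (real (card (?E \<omega> K))))"
    proof eventually_elim
      case (elim \<omega>)
      have finE: "finite (?E \<omega> A)"
      proof (rule finite_subset)
        show "?E \<omega> A \<subseteq> PiE {..<m} (\<lambda>_. {i. Z i \<omega> \<in> B})"
        proof
          fix e assume e: "e \<in> ?E \<omega> A"
          then have "Z (e j) \<omega> \<in> B" if "j < m" for j using that by (auto simp: B_def)
          then show "e \<in> PiE {..<m} (\<lambda>_. {i. Z i \<omega> \<in> B})"
            using e by (auto simp: inj_tuples_def PiE_iff)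
        qed
        show "finite (PiE {..<m} (\<lambda>_. {i. Z i \<omega> \<in> B}))" using elim by (intro finite_PiE) auto
      qed
      have sub: "?E \<omega> K \<subseteq> ?E \<omega> A" if "K \<in> PiE {..<m} Fs" for K
        using that by (auto simp: PiE_iff Fs_def)
      have "?E \<omega> A \<subseteq> (\<Union>K\<in>PiE {..<m} Fs. ?E \<omega> K)"
      proof
        fix e assume e: "e \<in> ?E \<omega> A"
        have inB: "Z (e j) \<omega> \<in> B" if "j < m" for j using that e by (auto simp: B_def)
        then have "atom (Z (e j) \<omega>) \<in> F" if "j < m" for j
          using that unfolding F_def by blast
        then have "atom (Z (e j) \<omega>) \<in> Fs j" if "j < m" for j
        proof -
          have "atom (Z (e j) \<omega>) \<subseteq> A j"
            using that e unfolding atom_def by blast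
          then show ?thesis using \<open>\<And>j. j < m \<Longrightarrow> atom (Z (e j) \<omega>) \<in> F\<close> that unfolding Fs_def by blast
        qed
        then have "restrict (\<lambda>j. atom (Z (e j) \<omega>)) {..<m} \<in> PiE {..<m} Fs" by auto
        moreover have "e \<in> ?E \<omega> (restrict (\<lambda>j. atom (Z (e j) \<omega>)) {..<m})"
          using e inB unfolding atom_def by simp
        ultimately show "e \<in> (\<Union>K\<in>PiE {..<m} Fs. ?E \<omega> K)" by blast
      qed
      then have "?E \<omega> A = (\<Union>K\<in>PiE {..<m} Fs. ?E \<omega> K)"
        by (rule subset_antisym) (intro UN_least sub)
      moreover have "card (\<Union>K\<in>PiE {..<m} Fs. ?E \<omega> K) = (\<Sum>K\<in>PiE {..<m} Fs. card (?E \<omega> K))"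
      proof (rule card_UN_disjoint)
        show "\<forall>K\<in>PiE {..<m} Fs. \<forall>K'\<in>PiE {..<m} Fs. K \<noteq> K' \<longrightarrow> ?E \<omega> K \<inter> ?E \<omega> K' = {}"
        proof (intro ballI impI, rule ccontr)
          fix K K' assume K: "K \<in> PiE {..<m} Fs" "K' \<in> PiE {..<m} Fs" "K \<noteq> K'"
            and "?E \<omega> K \<inter> ?E \<omega> K' \<noteq> {}"
          then obtain e where e: "e \<in> ?E \<omega> K" "e \<in> ?E \<omega> K'" by blast
          have "K j = K' j" for j
          proof (cases "j < m")
            case True
            then show ?thesis using e K unique[of "K j" "K' j" "Z (e j) \<omega>"]
              by (auto simp: PiE_iff Fs_def)
          qed (use K in \<open>auto simp: PiE_iff extensional_def\<close>)
          then show False using K(3) by auto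
        qed
        show "finite (PiE {..<m} Fs)" using finFs by (intro finite_PiE) auto
        show "\<forall>K\<in>PiE {..<m} Fs. finite (?E \<omega> K)" by (intro ballI finite_subset[OF sub finE])
      qed
      moreover have "emeasure (count_space (inj_tuples m)) (?E \<omega> A) = ennreal (real (card (?E \<omega> A)))"
        using finE by (subst emeasure_count_space_finite) (auto simp: ennreal_of_nat_eq_real_of_nat)
      ultimately show ?case by (simp add: sum_ennreal)
    qed
  qed
  also have "\<dots> = (\<Sum>K\<in>PiE {..<m} Fs. \<integral>\<^sup>+\<omega>. ennreal (real (card (?E \<omega> K))) \<partial>Q)"
  proof (rule nn_integral_sum)
    fix K assume K: "K \<in> PiE {..<m} Fs"
    have [measurable]: "K j \<in> sets borel" if "j < m" for j
      using K that sets by (auto simp: Fs_def PiE_iff)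
    show "(\<lambda>\<omega>. ennreal (real (card (?E \<omega> K)))) \<in> borel_measurable Q"
      by (rule measurable_card_inj_tuples) auto
  qed
  also have "\<dots> = (\<Sum>K\<in>PiE {..<m} Fs. \<Prod>j<m. ennreal (\<tau> * measure lborel (K j)))"
    by (intro sum.cong refl poisson_process_inj_tuples_atoms[OF pp \<open>0 \<le> \<tau>\<close> fin disj sets])
      (auto simp: PiE_iff Fs_def)
  also have "\<dots> = (\<Prod>j<m. \<Sum>a\<in>Fs j. ennreal (\<tau> * measure lborel a))"
    by (rule prod_sum_PiE[symmetric]) (use finFs in auto)
  also have "\<dots> = (\<Prod>j<m. ennreal (\<tau> * measure lborel (A j)))"
  proof (rule prod.cong)
    fix j assume "j \<in> {..<m}"
    then have j: "j < m" by simp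
    have "measure lborel (A j) = (\<Sum>a\<in>Fs j. measure lborel a)"
      unfolding A_Un[OF j]
    proof (rule measure_Union')
      show "disjoint (Fs j)" using disj by (auto simp: Fs_def disjoint_def)
      show "a \<in> fmeasurable lborel" if "a \<in> Fs j" for a
        using that sets[of a] emeasure_bounded_finite[of a] by (auto simp: Fs_def fmeasurable_def)
    qed fact+
    then show "(\<Sum>a\<in>Fs j. ennreal (\<tau> * measure lborel a)) = ennreal (\<tau> * measure lborel (A j))"
      using \<open>0 \<le> \<tau>\<close> by (simp add: sum_distrib_left sum_ennreal)
  qed simp
  finally show ?thesis .
qed

abbreviation scaled_lborel :: "real \<Rightarrow> 'a::euclidean_space measure" where
  "scaled_lborel \<tau> \<equiv> density lborel (\<lambda>_. ennreal \<tau>)"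

lemma sigma_finite_scaled_lborel: "sigma_finite_measure (scaled_lborel \<tau>)"
  by (subst sigma_finite_measure.sigma_finite_iff_density_finite'[OF sigma_finite_lborel]) auto

lemma product_sigma_finite_scaled_lborel: "product_sigma_finite (\<lambda>_. scaled_lborel \<tau>)"
  by (simp add: product_sigma_finite_def sigma_finite_scaled_lborel)

lemma emeasure_scaled_lborel: "A \<in> sets borel \<Longrightarrow> emeasure (scaled_lborel \<tau>) A = ennreal \<tau> * emeasure lborel A"
  by (subst emeasure_density_const) auto

definition tuple_locations ::
  "(nat \<Rightarrow> 'v \<Rightarrow> 'a) \<Rightarrow> nat \<Rightarrow> 'v \<times> (nat \<Rightarrow> nat) \<Rightarrow> nat \<Rightarrow> 'a" where
  "tuple_locations Z m = (\<lambda>(\<omega>, e). \<lambda>j\<in>{..<m}. Z (e j) \<omega>)"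

text \<open>Labels of the marks that belong to a tuple of points. In \<open>marked_poisson_process\<close> the mark of
  the point \<open>Z i\<close> is \<open>U (Suc i)\<close>, and \<open>U 0\<close> belongs to the origin; the origin is appended to the tuple
  at position \<open>m\<close>.\<close>

definition tuple_index :: "nat \<Rightarrow> (nat \<Rightarrow> nat) \<Rightarrow> nat \<Rightarrow> nat" where
  "tuple_index m e j = (if j < m then Suc (e j) else 0)"

definition tuple_marks ::
  "(nat \<Rightarrow> 'v \<Rightarrow> real) \<Rightarrow> nat \<Rightarrow> 'v \<times> (nat \<Rightarrow> nat) \<Rightarrow> nat \<Rightarrow> real" where
  "tuple_marks U m = (\<lambda>(\<omega>, e). \<lambda>j\<in>{..m}. U (tuple_index m e j) \<omega>)"

lemma measurable_tuple_locations:
  fixes Z :: "nat \<Rightarrow> 'v \<Rightarrow> 'a::topological_space"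
  assumes [measurable]: "\<And>i. Z i \<in> Q \<rightarrow>\<^sub>M borel"
  shows "tuple_locations Z m \<in> Q \<Otimes>\<^sub>M count_space (inj_tuples m) \<rightarrow>\<^sub>M PiM {..<m} (\<lambda>_. borel)"
  unfolding tuple_locations_def by (rule measurable_pair_count) auto

lemma measurable_tuple_marks:
  assumes [measurable]: "\<And>i. U i \<in> Q \<rightarrow>\<^sub>M borel"
  shows "tuple_marks U m \<in> Q \<Otimes>\<^sub>M count_space (inj_tuples m) \<rightarrow>\<^sub>M PiM {..m} (\<lambda>_. borel)"
  unfolding tuple_marks_def by (rule measurable_pair_count) auto

text \<open>Counting injective tuples by their locations yields the \<open>m\<close>-th factorial moment measure. It is
  \<open>\<tau>^m\<close> times Lebesgue measure: this holds on products of bounded sets, and exhausting space by balls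
  extends it to all products, which determine the measure.\<close>

lemma poisson_process_factorial_measure:
  fixes Z :: "nat \<Rightarrow> 'v \<Rightarrow> 'a::euclidean_space"
  assumes pp: "poisson_process Q \<tau> Z" and "0 \<le> \<tau>"
  shows "distr (Q \<Otimes>\<^sub>M count_space (inj_tuples m)) (PiM {..<m} (\<lambda>_. borel)) (tuple_locations Z m)
    = PiM {..<m} (\<lambda>_. scaled_lborel \<tau>)"
proof -
  interpret prob_space Q using pp by (simp add: poisson_process_def)
  have Z[measurable]: "Z i \<in> Q \<rightarrow>\<^sub>M borel" for i using pp by (simp add: poisson_process_def)
  note [measurable] = measurable_tuple_locations[of Z, OF Z]
  interpret C: sigma_finite_measure "count_space (inj_tuples m)"
    by (rule sigma_finite_measure_count_space_countable) simp
  interpret S: product_sigma_finite "\<lambda>_::nat. scaled_lborel \<tau>" by (rule product_sigma_finite_scaled_lborel)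
  let ?P = "distr (Q \<Otimes>\<^sub>M count_space (inj_tuples m)) (PiM {..<m} (\<lambda>_. borel)) (tuple_locations Z m)"
  have rect: "emeasure ?P (PiE {..<m} A)
      = (\<integral>\<^sup>+\<omega>. emeasure (count_space (inj_tuples m)) {e \<in> inj_tuples m. \<forall>j<m. Z (e j) \<omega> \<in> A j} \<partial>Q)"
    if A: "\<And>j. j < m \<Longrightarrow> A j \<in> sets borel" for A
  proof -
    have [measurable]: "PiE {..<m} A \<in> sets (PiM {..<m} (\<lambda>_. borel))"
      using A by (intro sets_PiM_I_finite) auto
    have "emeasure ?P (PiE {..<m} A) = emeasure (Q \<Otimes>\<^sub>M count_space (inj_tuples m))
        (tuple_locations Z m -` PiE {..<m} A \<inter> space (Q \<Otimes>\<^sub>M count_space (inj_tuples m)))"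
      by (rule emeasure_distr) measurable
    also have "\<dots> = (\<integral>\<^sup>+\<omega>. emeasure (count_space (inj_tuples m)) (Pair \<omega> -`
        (tuple_locations Z m -` PiE {..<m} A \<inter> space (Q \<Otimes>\<^sub>M count_space (inj_tuples m)))) \<partial>Q)"
      by (rule C.emeasure_pair_measure_alt) measurable
    also have "\<dots> = (\<integral>\<^sup>+\<omega>. emeasure (count_space (inj_tuples m)) {e \<in> inj_tuples m. \<forall>j<m. Z (e j) \<omega> \<in> A j} \<partial>Q)"
    proof (intro nn_integral_cong arg_cong[where f="emeasure (count_space (inj_tuples m))"])
      fix \<omega> assume "\<omega> \<in> space Q"
      then show "Pair \<omega> -` (tuple_locations Z m -` PiE {..<m} A \<inter> space (Q \<Otimes>\<^sub>M count_space (inj_tuples m)))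
          = {e \<in> inj_tuples m. \<forall>j<m. Z (e j) \<omega> \<in> A j}"
        by (intro set_eqI) (simp add: tuple_locations_def space_pair_measure restrict_PiE_iff Pi_iff Ball_def conj_commute)
    qed
    finally show ?thesis .
  qed
  show ?thesis
  proof (rule S.PiM_eqI)
    show "sets ?P = sets (PiM {..<m} (\<lambda>_. scaled_lborel \<tau>))"
      by (auto intro!: sets_PiM_cong)
    fix A :: "nat \<Rightarrow> 'a set" assume "\<And>i. i \<in> {..<m} \<Longrightarrow> A i \<in> sets (scaled_lborel \<tau>)"
    then have A: "A i \<in> sets borel" if "i < m" for i using that by auto
    let ?A = "\<lambda>N i. A i \<inter> ball 0 (real N)"
    have mono: "incseq (\<lambda>N. PiE {..<m} (?A N))"
      by (force simp: incseq_def PiE_iff)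
    have un: "(\<Union>N. PiE {..<m} (?A N)) = PiE {..<m} A"
    proof (intro subset_antisym subsetI)
      fix z assume z: "z \<in> PiE {..<m} A"
      obtain N :: nat where N: "Max (insert 0 ((\<lambda>i. norm (z i)) ` {..<m})) < real N"
        using reals_Archimedean2 by blast
      have "norm (z i) < real N" if "i < m" for i
      proof -
        have "norm (z i) \<le> Max (insert 0 ((\<lambda>i. norm (z i)) ` {..<m}))" using that by (intro Max_ge) auto
        then show ?thesis using N by (rule le_less_trans)
      qed
      then show "z \<in> (\<Union>N. PiE {..<m} (?A N))" using z by (auto simp: PiE_iff)
    qed (auto simp: PiE_iff)
    have bd: "emeasure ?P (PiE {..<m} (?A N)) = emeasure (PiM {..<m} (\<lambda>_. scaled_lborel \<tau>)) (PiE {..<m} (?A N))" for N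
    proof -
      have b: "bounded (?A N i)" for i by (rule bounded_subset[OF bounded_ball]) auto
      have "emeasure ?P (PiE {..<m} (?A N)) = (\<Prod>j<m. ennreal (\<tau> * measure lborel (?A N j)))"
      proof -
        have bdA: "?A N j \<in> sets borel \<and> bounded (?A N j)" if "j < m" for j using A[OF that] b by auto
        have "emeasure ?P (PiE {..<m} (?A N)) = (\<integral>\<^sup>+\<omega>. emeasure (count_space (inj_tuples m))
            {e \<in> inj_tuples m. \<forall>j<m. Z (e j) \<omega> \<in> ?A N j} \<partial>Q)"
          by (rule rect) (use bdA in blast)
        also have "\<dots> = (\<Prod>j<m. ennreal (\<tau> * measure lborel (?A N j)))"
          by (rule poisson_process_inj_tuples_bounded[OF pp \<open>0 \<le> \<tau>\<close> bdA])
        finally show ?thesis .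
      qed
      also have "\<dots> = (\<Prod>j<m. emeasure (scaled_lborel \<tau>) (?A N j))"
      proof (intro prod.cong refl)
        fix j assume "j \<in> {..<m}"
        then have "emeasure (scaled_lborel \<tau>) (?A N j) = ennreal \<tau> * emeasure lborel (?A N j)"
          using A by (intro emeasure_scaled_lborel) auto
        also have "emeasure lborel (?A N j) = ennreal (measure lborel (?A N j))"
          using emeasure_bounded_finite[OF b[of j]] by (simp add: emeasure_eq_ennreal_measure)
        finally show "ennreal (\<tau> * measure lborel (?A N j)) = emeasure (scaled_lborel \<tau>) (?A N j)"
          using \<open>0 \<le> \<tau>\<close> by (simp add: ennreal_mult)
      qed
      also have "\<dots> = emeasure (PiM {..<m} (\<lambda>_. scaled_lborel \<tau>)) (PiE {..<m} (?A N))"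
        using A by (intro S.emeasure_PiM[symmetric]) auto
      finally show ?thesis .
    qed
    have "emeasure ?P (PiE {..<m} A) = (SUP N. emeasure ?P (PiE {..<m} (?A N)))"
      unfolding un[symmetric] using A by (intro SUP_emeasure_incseq[symmetric] mono) (auto intro!: sets_PiM_I_finite)
    also have "\<dots> = (SUP N. emeasure (PiM {..<m} (\<lambda>_. scaled_lborel \<tau>)) (PiE {..<m} (?A N)))"
      unfolding bd ..
    also have "\<dots> = emeasure (PiM {..<m} (\<lambda>_. scaled_lborel \<tau>)) (PiE {..<m} A)"
      unfolding un[symmetric] using A by (intro SUP_emeasure_incseq mono) (auto intro!: sets_PiM_I_finite)
    also have "\<dots> = (\<Prod>i\<in>{..<m}. emeasure (scaled_lborel \<tau>) (A i))"
      using A by (intro S.emeasure_PiM) auto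
    finally show "emeasure ?P (PiE {..<m} A) = (\<Prod>i\<in>{..<m}. emeasure (scaled_lborel \<tau>) (A i))" .
  qed simp
qed

section \<open>Independent uniform marks\<close>

lemma prob_space_uniform01: "prob_space uniform01"
  unfolding uniform01_def by (rule prob_space_uniform_measure) auto

lemma sets_uniform01 [simp, measurable_cong]: "sets uniform01 = sets borel"
  unfolding uniform01_def by simp

lemma space_uniform01 [simp]: "space uniform01 = UNIV"
  unfolding uniform01_def by simp

lemma product_prob_space_uniform01: "product_prob_space (\<lambda>_. uniform01)"
  by (intro product_prob_spaceI prob_space_uniform01)

text \<open>For a fixed injective tuple the marks sit at distinct labels, hence are independent uniform
  variables, and they are independent of all locations.\<close>

lemma marked_poisson_process_tuple_prob:
  fixes Z :: "nat \<Rightarrow> 'v \<Rightarrow> 'a::euclidean_space"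
  assumes mp: "marked_poisson_process Q \<tau> Z U"
    and e: "e \<in> inj_tuples m"
    and A: "A \<in> sets (PiM {..<m} (\<lambda>_. borel))" and B: "B \<in> sets (PiM {..m} (\<lambda>_. borel))"
  shows "emeasure Q {\<omega>\<in>space Q. tuple_locations Z m (\<omega>, e) \<in> A \<and> tuple_marks U m (\<omega>, e) \<in> B}
    = emeasure Q {\<omega>\<in>space Q. tuple_locations Z m (\<omega>, e) \<in> A} * emeasure (PiM {..m} (\<lambda>_. uniform01)) B"
proof -
  have pp: "poisson_process Q \<tau> Z" using mp by (simp add: marked_poisson_process_def)
  interpret prob_space Q using pp by (simp add: poisson_process_def)
  have Z[measurable]: "Z i \<in> Q \<rightarrow>\<^sub>M borel" for i using pp by (simp add: poisson_process_def)
  have ind: "indep_vars (\<lambda>_. borel) U UNIV" using mp by (simp add: marked_poisson_process_def)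
  have U[measurable]: "U i \<in> Q \<rightarrow>\<^sub>M borel" for i using ind by (auto simp: indep_vars_def)
  let ?PB = "PiM UNIV (\<lambda>_::nat. borel :: real measure)" and ?PZ = "PiM UNIV (\<lambda>_::nat. borel :: 'a measure)"
  let ?a = "\<lambda>z::nat\<Rightarrow>'a. \<lambda>j\<in>{..<m}. z (e j)" and ?b = "\<lambda>u::nat\<Rightarrow>real. \<lambda>j\<in>{..m}. u (tuple_index m e j)"
  note [measurable] = A B
  let ?A = "?a -` A \<inter> space ?PZ" and ?B = "?b -` B \<inter> space ?PB"
  have mA[measurable]: "?A \<in> sets ?PZ" and [measurable]: "?B \<in> sets ?PB" by measurable
  have joint: "distr Q (?PZ \<Otimes>\<^sub>M ?PB) (\<lambda>\<omega>. (\<lambda>i. Z i \<omega>, \<lambda>i. U i \<omega>)) =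
       distr Q ?PZ (\<lambda>\<omega> i. Z i \<omega>) \<Otimes>\<^sub>M distr Q ?PB (\<lambda>\<omega> i. U i \<omega>)"
    using mp by (simp add: marked_poisson_process_def)
  have mZ[measurable]: "(\<lambda>\<omega> i. Z i \<omega>) \<in> Q \<rightarrow>\<^sub>M ?PZ" by (rule measurable_PiM_single') auto
  have [measurable]: "(\<lambda>\<omega> i. U i \<omega>) \<in> Q \<rightarrow>\<^sub>M ?PB" by (rule measurable_PiM_single') auto
  interpret DU: prob_space "distr Q ?PB (\<lambda>\<omega> i. U i \<omega>)" by (rule prob_space_distr) measurable
  have law: "distr Q ?PB (\<lambda>\<omega> i. U i \<omega>) = PiM UNIV (\<lambda>_. uniform01)"
    using indep_vars_iff_distr_eq_PiM[where M'="\<lambda>_. borel" and X=U and I=UNIV] ind U mp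
    by (simp add: marked_poisson_process_def restrict_UNIV)
  have re: "distr (PiM UNIV (\<lambda>_::nat. uniform01)) (PiM {..m} (\<lambda>_. uniform01)) ?b = PiM {..m} (\<lambda>_. uniform01)"
  proof (rule distr_PiM_reindex)
    show "inj_on (tuple_index m e) {..m}"
      using e by (auto simp: inj_on_def tuple_index_def inj_tuples_def)
  qed (auto intro: prob_space_uniform01)
  have sB: "B \<in> sets (PiM {..m} (\<lambda>_. uniform01))" using B by (simp cong: sets_PiM_cong)
  have "emeasure Q {\<omega>\<in>space Q. tuple_locations Z m (\<omega>, e) \<in> A \<and> tuple_marks U m (\<omega>, e) \<in> B}
     = emeasure (distr Q (?PZ \<Otimes>\<^sub>M ?PB) (\<lambda>\<omega>. (\<lambda>i. Z i \<omega>, \<lambda>i. U i \<omega>))) (?A \<times> ?B)"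
  proof -
    have AB: "?A \<times> ?B \<in> sets (?PZ \<Otimes>\<^sub>M ?PB)" by (rule pair_measureI) measurable
    have "emeasure (distr Q (?PZ \<Otimes>\<^sub>M ?PB) (\<lambda>\<omega>. (\<lambda>i. Z i \<omega>, \<lambda>i. U i \<omega>))) (?A \<times> ?B)
        = emeasure Q ((\<lambda>\<omega>. (\<lambda>i. Z i \<omega>, \<lambda>i. U i \<omega>)) -` (?A \<times> ?B) \<inter> space Q)"
      by (rule emeasure_distr[OF _ AB]) measurable
    then show ?thesis
      by (simp add: tuple_locations_def tuple_marks_def space_PiM vimage_def Int_def conj_commute)
  qed
  also have "\<dots> = emeasure (distr Q ?PZ (\<lambda>\<omega> i. Z i \<omega>)) ?A * emeasure (distr Q ?PB (\<lambda>\<omega> i. U i \<omega>)) ?B"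
    unfolding joint by (rule DU.emeasure_pair_measure_Times) auto
  also have "emeasure (distr Q ?PZ (\<lambda>\<omega> i. Z i \<omega>)) ?A = emeasure Q {\<omega>\<in>space Q. tuple_locations Z m (\<omega>, e) \<in> A}"
    unfolding emeasure_distr[OF mZ mA]
    by (auto intro!: arg_cong[where f="emeasure Q"] simp: tuple_locations_def space_PiM)
  also have "emeasure (distr Q ?PB (\<lambda>\<omega> i. U i \<omega>)) ?B = emeasure (PiM {..m} (\<lambda>_. uniform01)) B"
  proof -
    have mb: "?b \<in> PiM UNIV (\<lambda>_::nat. uniform01) \<rightarrow>\<^sub>M PiM {..m} (\<lambda>_. uniform01)"
      by (intro measurable_restrict measurable_component_singleton) auto
    have "emeasure (PiM {..m} (\<lambda>_. uniform01)) B
        = emeasure (distr (PiM UNIV (\<lambda>_::nat. uniform01)) (PiM {..m} (\<lambda>_. uniform01)) ?b) B"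
      unfolding re ..
    also have "\<dots> = emeasure (PiM UNIV (\<lambda>_. uniform01)) (?b -` B \<inter> space (PiM UNIV (\<lambda>_::nat. uniform01)))"
      by (rule emeasure_distr[OF mb sB])
    finally show ?thesis unfolding law by (simp add: space_PiM)
  qed
  finally show ?thesis .
qed

text \<open>For every tuple the marks have the same law, independently of the locations, so the joint
  measure is a product although it is infinite.\<close>

lemma marked_poisson_process_factorial_measure:
  fixes Z :: "nat \<Rightarrow> 'v \<Rightarrow> 'a::euclidean_space"
  assumes mp: "marked_poisson_process Q \<tau> Z U" and "0 \<le> \<tau>"
  shows "distr (Q \<Otimes>\<^sub>M count_space (inj_tuples m)) (PiM {..<m} (\<lambda>_. borel) \<Otimes>\<^sub>M PiM {..m} (\<lambda>_. borel))
      (\<lambda>p. (tuple_locations Z m p, tuple_marks U m p))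
    = PiM {..<m} (\<lambda>_. scaled_lborel \<tau>) \<Otimes>\<^sub>M PiM {..m} (\<lambda>_. uniform01)"
proof -
  have pp: "poisson_process Q \<tau> Z" using mp by (simp add: marked_poisson_process_def)
  interpret prob_space Q using pp by (simp add: poisson_process_def)
  have Z[measurable]: "Z i \<in> Q \<rightarrow>\<^sub>M borel" for i using pp by (simp add: poisson_process_def)
  have ind: "indep_vars (\<lambda>_. borel) U UNIV" using mp by (simp add: marked_poisson_process_def)
  have U[measurable]: "U i \<in> Q \<rightarrow>\<^sub>M borel" for i using ind by (auto simp: indep_vars_def)
  note [measurable] = measurable_tuple_locations[of Z, OF Z] measurable_tuple_marks[of U, OF U]
  interpret C: sigma_finite_measure "count_space (inj_tuples m)"
    by (rule sigma_finite_measure_count_space_countable) simp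
  interpret pair_sigma_finite Q "count_space (inj_tuples m)" ..
  interpret S: product_sigma_finite "\<lambda>_::nat. scaled_lborel \<tau>" by (rule product_sigma_finite_scaled_lborel)
  interpret P: product_prob_space "\<lambda>_::nat. uniform01" by (rule product_prob_space_uniform01)
  let ?QC = "Q \<Otimes>\<^sub>M count_space (inj_tuples m)"
  let ?L = "PiM {..<m} (\<lambda>_. scaled_lborel \<tau>) :: (nat \<Rightarrow> 'a) measure" and ?V = "PiM {..m} (\<lambda>_. uniform01)"
  have eqL: "distr ?QC (PiM {..<m} (\<lambda>_. borel)) (tuple_locations Z m) = ?L"
    by (rule poisson_process_factorial_measure[OF pp assms(2)])
  have setsL: "sets ?L = sets (PiM {..<m} (\<lambda>_. borel))" by (auto intro!: sets_PiM_cong)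
  have setsV: "sets ?V = sets (PiM {..m} (\<lambda>_. borel))" by (auto intro!: sets_PiM_cong)
  show ?thesis
  proof (rule pair_measure_eqI[symmetric])
    show "sigma_finite_measure ?L" by (rule S.sigma_finite) simp
    show "sigma_finite_measure ?V"
      by (intro prob_space_imp_sigma_finite prob_space_PiM prob_space_uniform01)
    show "sets (?L \<Otimes>\<^sub>M ?V) = sets (distr ?QC (PiM {..<m} (\<lambda>_. borel) \<Otimes>\<^sub>M PiM {..m} (\<lambda>_. borel))
      (\<lambda>p. (tuple_locations Z m p, tuple_marks U m p)))"
      by (simp add: setsL setsV cong: sets_pair_measure_cong)
    fix A B assume "A \<in> sets ?L" "B \<in> sets ?V"
    then have A[measurable]: "A \<in> sets (PiM {..<m} (\<lambda>_. borel))" and B[measurable]: "B \<in> sets (PiM {..m} (\<lambda>_. borel))"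
      by (simp_all add: setsL setsV)
    have sec: "emeasure ?QC {p\<in>space ?QC. P p} = (\<integral>\<^sup>+e. emeasure Q {\<omega>\<in>space Q. P (\<omega>, e)} \<partial>count_space (inj_tuples m))"
      if [measurable]: "Measurable.pred ?QC P" for P
    proof -
      have "emeasure ?QC {p\<in>space ?QC. P p} = (\<integral>\<^sup>+e. emeasure Q ((\<lambda>\<omega>. (\<omega>, e)) -` {p\<in>space ?QC. P p}) \<partial>count_space (inj_tuples m))"
        by (rule emeasure_pair_measure_alt2) measurable
      also have "\<dots> = (\<integral>\<^sup>+e. emeasure Q {\<omega>\<in>space Q. P (\<omega>, e)} \<partial>count_space (inj_tuples m))"
        by (intro nn_integral_cong arg_cong[where f="emeasure Q"]) (auto simp: space_pair_measure)
      finally show ?thesis .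
    qed
    have "emeasure (distr ?QC (PiM {..<m} (\<lambda>_. borel) \<Otimes>\<^sub>M PiM {..m} (\<lambda>_. borel))
      (\<lambda>p. (tuple_locations Z m p, tuple_marks U m p))) (A \<times> B)
      = emeasure ?QC {p\<in>space ?QC. tuple_locations Z m p \<in> A \<and> tuple_marks U m p \<in> B}"
      by (subst emeasure_distr) (auto intro!: arg_cong[where f="emeasure _"])
    also have "\<dots> = (\<integral>\<^sup>+e. emeasure Q {\<omega>\<in>space Q. tuple_locations Z m (\<omega>, e) \<in> A} * emeasure ?V B \<partial>count_space (inj_tuples m))"
      by (subst sec) (auto intro!: nn_integral_cong marked_poisson_process_tuple_prob[OF mp])
    also have "\<dots> = (\<integral>\<^sup>+e. emeasure Q {\<omega>\<in>space Q. tuple_locations Z m (\<omega>, e) \<in> A} \<partial>count_space (inj_tuples m)) * emeasure ?V B"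
      by (rule nn_integral_multc) simp
    also have "\<dots> = emeasure ?QC {p\<in>space ?QC. tuple_locations Z m p \<in> A} * emeasure ?V B"
      by (subst sec) auto
    also have "emeasure ?QC {p\<in>space ?QC. tuple_locations Z m p \<in> A} = emeasure ?L A"
      unfolding eqL[symmetric]
      by (subst emeasure_distr) (auto intro!: arg_cong[where f="emeasure _"])
    finally show "emeasure ?L A * emeasure ?V B = emeasure (distr ?QC (PiM {..<m} (\<lambda>_. borel) \<Otimes>\<^sub>M PiM {..m} (\<lambda>_. borel))
      (\<lambda>p. (tuple_locations Z m p, tuple_marks U m p))) (A \<times> B)" by simp
  qed
qed

section \<open>Cluster integrals\<close>

abbreviation unit_radius :: "'a::euclidean_space itself \<Rightarrow> real" where
  "unit_radius T \<equiv> ball_radius T 1"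

lemma ball_radius_pos: "0 < v \<Longrightarrow> 0 < ball_radius TYPE('a::euclidean_space) v"
  unfolding ball_radius_def
  by (intro real_root_gt_zero divide_pos_pos unit_ball_vol_pos) auto

text \<open>The coefficient common to both models: the total weight at the origin of clusters of \<open>m\<close> points
  that arrive in the order of their labels, all before the origin.\<close>

definition cluster_integral :: "'a::euclidean_space itself \<Rightarrow> nat \<Rightarrow> nat \<Rightarrow> real" where
  "cluster_integral _ k m = (\<integral>z. cluster_weight k (unit_radius TYPE('a)) (z(m := 0::'a)) (\<lambda>i. i) {..<m} m
     \<partial>PiM {..<m} (\<lambda>_. lborel))"

lemma product_sigma_finite_lborel: "product_sigma_finite (\<lambda>_. lborel :: 'a::euclidean_space measure)"
  by (simp add: product_sigma_finite_def sigma_finite_lborel)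

lemma PiM_scaled_lborel:
  "PiM {..<m::nat} (\<lambda>_. scaled_lborel \<tau> :: 'a::euclidean_space measure)
     = density (PiM {..<m} (\<lambda>_. lborel)) (\<lambda>_. ennreal \<tau> ^ m)"
proof -
  interpret S: product_sigma_finite "\<lambda>_::nat. scaled_lborel \<tau> :: 'a measure"
    by (rule product_sigma_finite_scaled_lborel)
  interpret L: product_sigma_finite "\<lambda>_::nat. lborel :: 'a measure"
    by (rule product_sigma_finite_lborel)
  show ?thesis
  proof (rule S.PiM_eqI[symmetric])
    show "sets (density (PiM {..<m} (\<lambda>_. lborel)) (\<lambda>_. ennreal \<tau> ^ m)) = sets (PiM {..<m} (\<lambda>_. scaled_lborel \<tau> :: 'a measure))"
      by (auto intro!: sets_PiM_cong)
    fix A :: "nat \<Rightarrow> 'a set" assume "\<And>i. i \<in> {..<m} \<Longrightarrow> A i \<in> sets (scaled_lborel \<tau>)"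
    then have A: "i < m \<Longrightarrow> A i \<in> sets lborel" for i by auto
    have "emeasure (density (PiM {..<m} (\<lambda>_. lborel)) (\<lambda>_. ennreal \<tau> ^ m)) (PiE {..<m} A)
      = ennreal \<tau> ^ m * (\<Prod>i<m. emeasure lborel (A i))"
    proof -
      have "PiE {..<m} A \<in> sets (PiM {..<m} (\<lambda>_. lborel))" using A by (intro sets_PiM_I_finite) auto
      then have "emeasure (density (PiM {..<m} (\<lambda>_. lborel)) (\<lambda>_. ennreal \<tau> ^ m)) (PiE {..<m} A)
        = ennreal \<tau> ^ m * emeasure (PiM {..<m} (\<lambda>_. lborel)) (PiE {..<m} A)"
        by (rule emeasure_density_const)
      also have "emeasure (PiM {..<m} (\<lambda>_. lborel)) (PiE {..<m} A) = (\<Prod>i<m. emeasure lborel (A i))"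
        by (rule L.emeasure_PiM) (use A in auto)
      finally show ?thesis .
    qed
    also have "\<dots> = (\<Prod>i<m. ennreal \<tau> * emeasure lborel (A i))"
      by (simp add: prod.distrib)
    also have "\<dots> = (\<Prod>i<m. emeasure (scaled_lborel \<tau>) (A i))"
      using A by (intro prod.cong) (auto simp: emeasure_scaled_lborel)
    finally show "emeasure (density (PiM {..<m} (\<lambda>_. lborel)) (\<lambda>_. ennreal \<tau> ^ m)) (PiE {..<m} A)
      = (\<Prod>i<m. emeasure (scaled_lborel \<tau>) (A i))" .
  qed simp
qed

lemma integral_PiM_scaled_lborel:
  assumes "0 \<le> \<tau>" "F \<in> borel_measurable (PiM {..<m} (\<lambda>_. borel))"
  shows "(\<integral>z. F z \<partial>PiM {..<m} (\<lambda>_. scaled_lborel \<tau> :: 'a::euclidean_space measure))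
    = \<tau> ^ m * (\<integral>z. F z \<partial>PiM {..<m} (\<lambda>_. lborel) :: real)"
proof -
  have "F \<in> borel_measurable (PiM {..<m} (\<lambda>_. lborel))"
    using assms(2) by (simp cong: measurable_cong_sets sets_PiM_cong)
  then show ?thesis
    unfolding PiM_scaled_lborel using assms(1)
    by (simp add: ennreal_power integral_density)
qed

lemma PiM_lborel_permute:
  assumes "bij_betw \<pi> {..<m::nat} {..<m}"
  shows "distr (PiM {..<m} (\<lambda>_. lborel)) (PiM {..<m} (\<lambda>_. lborel :: 'a::euclidean_space measure)) (\<lambda>z. \<lambda>j\<in>{..<m}. z (\<pi> j))
     = PiM {..<m} (\<lambda>_. lborel)"
proof -
  interpret L: product_sigma_finite "\<lambda>_::nat. lborel :: 'a measure"
    by (rule product_sigma_finite_lborel)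
  have \<pi>: "j < m \<Longrightarrow> \<pi> j < m" for j using assms bij_betw_apply by fastforce
  define \<rho> where "\<rho> = inv_into {..<m} \<pi>"
  have \<rho>: "\<rho> (\<pi> j) = j" if "j < m" for j
    using that assms by (auto simp: \<rho>_def bij_betw_def)
  have \<rho>': "j < m \<Longrightarrow> \<rho> j < m \<and> \<pi> (\<rho> j) = j" for j
    using assms unfolding \<rho>_def by (metis bij_betw_def f_inv_into_f inv_into_into lessThan_iff)
  have [measurable]: "(\<lambda>z. \<lambda>j\<in>{..<m}. z (\<pi> j)) \<in> PiM {..<m} (\<lambda>_. lborel :: 'a measure) \<rightarrow>\<^sub>M PiM {..<m} (\<lambda>_. lborel)"
    using \<pi> by (intro measurable_restrict measurable_component_singleton) auto
  show ?thesis
  proof (rule L.PiM_eqI)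
    fix A :: "nat \<Rightarrow> 'a set" assume "\<And>i. i \<in> {..<m} \<Longrightarrow> A i \<in> sets lborel"
    then have A: "i < m \<Longrightarrow> A i \<in> sets lborel" for i by auto
    have "(\<lambda>z. \<lambda>j\<in>{..<m}. z (\<pi> j)) -` PiE {..<m} A \<inter> space (PiM {..<m} (\<lambda>_. lborel)) = PiE {..<m} (A \<circ> \<rho>)"
    proof (intro set_eqI iffI)
      fix z assume z: "z \<in> (\<lambda>z. \<lambda>j\<in>{..<m}. z (\<pi> j)) -` PiE {..<m} A \<inter> space (PiM {..<m} (\<lambda>_. lborel))"
      then have zA: "z (\<pi> j) \<in> A j" if "j < m" for j
        using that by (auto dest!: PiE_mem[of _ _ _ j])
      have "z j \<in> A (\<rho> j)" if "j < m" for j using zA[of "\<rho> j"] \<rho>'[OF that] by simp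
      then show "z \<in> PiE {..<m} (A \<circ> \<rho>)" using z by (auto simp: space_PiM PiE_iff)
    next
      fix z assume z: "z \<in> PiE {..<m} (A \<circ> \<rho>)"
      have "z (\<pi> j) \<in> A j" if "j < m" for j using PiE_mem[OF z, of "\<pi> j"] \<rho>[OF that] \<pi>[OF that] by simp
      then show "z \<in> (\<lambda>z. \<lambda>j\<in>{..<m}. z (\<pi> j)) -` PiE {..<m} A \<inter> space (PiM {..<m} (\<lambda>_. lborel))"
        using z by (auto simp: space_PiM PiE_iff)
    qed
    then have "emeasure (distr (PiM {..<m} (\<lambda>_. lborel)) (PiM {..<m} (\<lambda>_. lborel)) (\<lambda>z. \<lambda>j\<in>{..<m}. z (\<pi> j))) (PiE {..<m} A)
       = emeasure (PiM {..<m} (\<lambda>_. lborel)) (PiE {..<m} (A \<circ> \<rho>))"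
      using A by (subst emeasure_distr) (auto intro!: sets_PiM_I_finite)
    also have "\<dots> = (\<Prod>i<m. emeasure lborel (A (\<rho> i)))"
      using A \<rho>' by (subst L.emeasure_PiM) auto
    also have "\<dots> = (\<Prod>i<m. emeasure lborel (A i))"
      by (rule prod.reindex_bij_witness[of _ \<pi> \<rho>]) (use \<rho> \<rho>' \<pi> in auto)
    finally show "emeasure (distr (PiM {..<m} (\<lambda>_. lborel)) (PiM {..<m} (\<lambda>_. lborel)) (\<lambda>z. \<lambda>j\<in>{..<m}. z (\<pi> j))) (PiE {..<m} A)
       = (\<Prod>i<m. emeasure lborel (A i))" .
  qed auto
qed

text \<open>Relabelling the points in the order of their marks preserves Lebesgue measure, and only the
  order of the marks enters a cluster weight.\<close>

lemma cluster_integral_order: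
  fixes u :: "nat \<Rightarrow> real"
  assumes "inj_on u {..m}" "\<And>j. j < m \<Longrightarrow> u j < u m"
  shows "(\<integral>z. cluster_weight k (unit_radius TYPE('a::euclidean_space)) (z(m := 0::'a)) u {..<m} m
     \<partial>PiM {..<m} (\<lambda>_. lborel)) = cluster_integral TYPE('a) k m"
proof -
  let ?r = "unit_radius TYPE('a)"
  have r: "0 < ?r" by (rule ball_radius_pos) simp
  have inj: "inj_on u {..<m}" using assms(1) by (rule inj_on_subset) auto
  have card: "card (u ` {..<m}) = m" using inj by (simp add: card_image)
  define h where "h = (!) (sorted_list_of_set (u ` {..<m}))"
  have h: "bij_betw h {..<m} (u ` {..<m})"
    unfolding h_def by (rule bij_betw_nth) (auto simp: card)
  have h_less: "h a < h b" if "a < b" "b < m" for a b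
    unfolding h_def using that card by (intro sorted_wrt_nth_less[OF strict_sorted_list_of_set]) auto
  define \<pi> where "\<pi> = inv_into {..<m} u \<circ> h"
  have \<pi>_bij: "bij_betw \<pi> {..<m} {..<m}"
    unfolding \<pi>_def by (rule bij_betw_trans[OF h bij_betw_inv_into[OF inj_on_imp_bij_betw[OF inj]]])
  have \<pi>: "j < m \<Longrightarrow> \<pi> j < m" for j using \<pi>_bij bij_betw_apply by fastforce
  have u\<pi>: "u (\<pi> j) = h j" if "j < m" for j
  proof -
    have "h j \<in> u ` {..<m}" using h that by (auto simp: bij_betw_def)
    then show ?thesis by (simp add: \<pi>_def f_inv_into_f)
  qed
  define e where "e = \<pi>(m := m)"
  have inje: "inj_on e {..<m}" using \<pi>_bij \<pi> by (auto simp: e_def bij_betw_def inj_on_def)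
  have ime: "e ` {..<m} = {..<m}" using \<pi>_bij by (auto simp: e_def bij_betw_def)
  have ord: "u (e a) < u (e b) \<longleftrightarrow> a < b" if "a \<in> insert m {..<m}" "b \<in> insert m {..<m}" for a b
  proof -
    have "h a < h b \<longleftrightarrow> a < b" if "a < m" "b < m" for a b
      using h_less[of a b] h_less[of b a] that by (cases a b rule: linorder_cases) auto
    moreover have "h a < u m" if "a < m" for a using assms(2)[OF \<pi>[OF that]] u\<pi>[OF that] by simp
    ultimately show ?thesis using that
      by (cases "a = m"; cases "b = m") (auto simp: e_def u\<pi> less_asym' dest: less_asym)
  qed
  have eq: "cluster_weight k ?r (z(m := 0)) u {..<m} m
      = cluster_weight k ?r ((\<lambda>j\<in>{..<m}. z (\<pi> j))(m := 0)) (\<lambda>i. i) {..<m} m" for z :: "nat \<Rightarrow> 'a"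
  proof -
    have "cluster_weight k ?r (z(m := 0)) u {..<m} m = cluster_weight k ?r (z(m := 0)) u (e ` {..<m}) (e m)"
      unfolding ime by (simp add: e_def)
    also have "\<dots> = cluster_weight k ?r (z(m := 0) \<circ> e) (u \<circ> e) {..<m} m"
      by (rule cluster_weight_relabel[OF inje])
    also have "\<dots> = cluster_weight k ?r ((\<lambda>j\<in>{..<m}. z (\<pi> j))(m := 0)) (\<lambda>i. i) {..<m} m"
      using \<pi> ord by (intro cluster_weight_cong) (auto simp: e_def)
    finally show ?thesis .
  qed
  have [measurable]: "(\<lambda>z. cluster_weight k ?r (z(m := 0)) (\<lambda>i. i) {..<m} m) \<in> borel_measurable (PiM {..<m} (\<lambda>_. lborel :: 'a measure))"
    by (rule measurable_cluster_weight[OF r]) (auto intro!: measurable_component_singleton)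
  have [measurable]: "(\<lambda>z. \<lambda>j\<in>{..<m}. z (\<pi> j)) \<in> PiM {..<m} (\<lambda>_. lborel :: 'a measure) \<rightarrow>\<^sub>M PiM {..<m} (\<lambda>_. lborel)"
    using \<pi> by (intro measurable_restrict measurable_component_singleton) auto
  have "cluster_integral TYPE('a) k m = (\<integral>z. cluster_weight k ?r (z(m := 0::'a)) (\<lambda>i. i) {..<m} m
      \<partial>distr (PiM {..<m} (\<lambda>_. lborel)) (PiM {..<m} (\<lambda>_. lborel)) (\<lambda>z. \<lambda>j\<in>{..<m}. z (\<pi> j)))"
    unfolding PiM_lborel_permute[OF \<pi>_bij] cluster_integral_def ..
  also have "\<dots> = (\<integral>z. cluster_weight k ?r ((\<lambda>j\<in>{..<m}. z (\<pi> j))(m := 0::'a)) (\<lambda>i. i) {..<m} m \<partial>PiM {..<m} (\<lambda>_. lborel))"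
    by (rule integral_distr) measurable
  finally show ?thesis unfolding eq by simp
qed

lemma emeasure_uniform01_lessThan:
  "emeasure uniform01 {..<y} = ennreal (min 1 (max 0 y))"
proof -
  have "emeasure uniform01 {..<y} = emeasure lborel ({0..1} \<inter> {..<y})"
    unfolding uniform01_def by (simp add: divide_ennreal_def)
  also have "\<dots> = ennreal (min 1 (max 0 y))"
  proof (cases "y \<le> 0")
    case True
    then have "{0..1} \<inter> {..<y} = {}" by auto
    then show ?thesis using True by (simp add: max_def)
  next
    case False
    show ?thesis
    proof (cases "y \<le> 1")
      case True
      then have "{0..1} \<inter> {..<y} = {0..<y}" using False by auto
      then show ?thesis using True False by simp
    next
      case F: False
      then have "{0..1} \<inter> {..<y} = {0..1}" by auto
      then show ?thesis using F by simp
    qed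
  qed
  finally show ?thesis .
qed

lemma nn_integral_uniform01:
  assumes "f \<in> borel_measurable borel"
  shows "(\<integral>\<^sup>+x. f x \<partial>uniform01) = (\<integral>\<^sup>+x. f x * indicator {0..1} x \<partial>lborel)"
  using assms unfolding uniform01_def by (simp add: nn_integral_uniform_measure divide_ennreal_def)

lemma nn_integral_uniform01_power:
  "(\<integral>\<^sup>+x. ennreal x ^ m \<partial>uniform01) = ennreal (1 / real (Suc m))"
proof -
  have "(\<integral>\<^sup>+x. ennreal x ^ m \<partial>uniform01) = (\<integral>\<^sup>+x. ennreal x ^ m * indicator {0..1} x \<partial>lborel)"
    by (rule nn_integral_uniform01) measurable
  also have "\<dots> = (\<integral>\<^sup>+x. ennreal (x ^ m) * indicator {0..1} x \<partial>lborel)"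
    by (intro nn_integral_cong) (auto simp: ennreal_power indicator_def)
  also have "\<dots> = ennreal (1 ^ Suc m / real (Suc m) - 0 ^ Suc m / real (Suc m))"
  proof (rule nn_integral_FTC_Icc)
    fix x :: real
    have "DERIV (\<lambda>x. x ^ Suc m / real (Suc m)) x :> (real (Suc m) * x ^ (Suc m - Suc 0)) / real (Suc m)"
      by (rule DERIV_cdivide[OF DERIV_pow])
    then show "DERIV (\<lambda>x. x ^ Suc m / real (Suc m)) x :> x ^ m" by simp
  qed auto
  finally show ?thesis by simp
qed

text \<open>Given the last mark \<open>y\<close>, all others are smaller with probability \<open>y^m\<close>.\<close>

lemma PiM_uniform01_max:
  "emeasure (PiM {..m} (\<lambda>_. uniform01)) {u\<in>space (PiM {..m} (\<lambda>_. uniform01)). \<forall>j<m. u j < u m} = ennreal (1 / real (Suc m))"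
proof -
  interpret P: product_prob_space "\<lambda>_::nat. uniform01" by (rule product_prob_space_uniform01)
  let ?S = "{u\<in>space (PiM {..m} (\<lambda>_. uniform01)). \<forall>j<m. u j < u m}"
  have S: "?S = {u\<in>space (PiM {..m} (\<lambda>_. uniform01)). \<forall>j\<in>{..<m}. u j < u m}" by auto
  have [measurable]: "?S \<in> sets (PiM {..m} (\<lambda>_. uniform01))"
    unfolding S by measurable
  have ins: "{..m} = insert m {..<m}" by auto
  have "emeasure (PiM {..m} (\<lambda>_. uniform01)) ?S = (\<integral>\<^sup>+u. indicator ?S u \<partial>PiM (insert m {..<m}) (\<lambda>_. uniform01))"
    unfolding ins[symmetric] by simp
  also have "\<dots> = (\<integral>\<^sup>+y. (\<integral>\<^sup>+u. indicator ?S (u(m := y)) \<partial>PiM {..<m} (\<lambda>_. uniform01)) \<partial>uniform01)"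
    by (rule P.product_nn_integral_insert_rev) (auto simp flip: ins)
  also have "\<dots> = (\<integral>\<^sup>+y. ennreal (min 1 (max 0 y)) ^ m \<partial>uniform01)"
  proof (intro nn_integral_cong)
    fix y
    have "(\<integral>\<^sup>+u. indicator ?S (u(m := y)) \<partial>PiM {..<m} (\<lambda>_. uniform01))
      = (\<integral>\<^sup>+u. indicator (PiE {..<m} (\<lambda>_. {..<y})) u \<partial>PiM {..<m} (\<lambda>_. uniform01))"
      by (intro nn_integral_cong) (auto simp: indicator_def space_PiM PiE_iff extensional_def)
    also have "\<dots> = (\<Prod>i<m. emeasure uniform01 {..<y})"
      by (subst nn_integral_indicator) (auto intro!: sets_PiM_I_finite simp: P.emeasure_PiM)
    finally show "(\<integral>\<^sup>+u. indicator ?S (u(m := y)) \<partial>PiM {..<m} (\<lambda>_. uniform01)) = ennreal (min 1 (max 0 y)) ^ m"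
      by (simp add: emeasure_uniform01_lessThan)
  qed
  also have "\<dots> = (\<integral>\<^sup>+y. ennreal y ^ m \<partial>uniform01)"
  proof -
    have "(\<integral>\<^sup>+y. ennreal (min 1 (max 0 y)) ^ m * indicator {0..1} y \<partial>lborel)
       = (\<integral>\<^sup>+y. ennreal y ^ m * indicator {0..1} y \<partial>lborel)"
      by (intro nn_integral_cong) (auto simp: indicator_def)
    then show ?thesis by (simp add: nn_integral_uniform01)
  qed
  finally show ?thesis by (simp add: nn_integral_uniform01_power)
qed

lemma AE_PiM_uniform01_inj: "AE u in PiM {..m::nat} (\<lambda>_. uniform01). inj_on u {..m}"
proof -
  interpret P: product_prob_space "\<lambda>_::nat. uniform01" by (rule product_prob_space_uniform01)
  have "AE u in PiM {..m} (\<lambda>_. uniform01). u i \<noteq> u j" if ij: "i \<le> m" "j \<le> m" "i \<noteq> j" for i j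
  proof -
    let ?I = "{..m} - {i}"
    let ?S = "{u\<in>space (PiM {..m} (\<lambda>_. uniform01)). u i = u j}"
    have ins: "{..m} = insert i ?I" using ij by auto
    have [measurable]: "(\<lambda>u. u i) \<in> borel_measurable (PiM {..m} (\<lambda>_. uniform01))"
        "(\<lambda>u. u j) \<in> borel_measurable (PiM {..m} (\<lambda>_. uniform01))"
      using ij by (auto intro!: measurable_component_singleton measurable_compose[OF measurable_component_singleton])
    have m[measurable]: "?S \<in> sets (PiM {..m} (\<lambda>_. uniform01))"
      using ij by measurable
    have "emeasure (PiM {..m} (\<lambda>_. uniform01)) ?S = (\<integral>\<^sup>+u. indicator ?S u \<partial>PiM (insert i ?I) (\<lambda>_. uniform01))"
      unfolding ins[symmetric] by simp
    also have "\<dots> = (\<integral>\<^sup>+u. (\<integral>\<^sup>+y. indicator ?S (u(i := y)) \<partial>uniform01) \<partial>PiM ?I (\<lambda>_. uniform01))"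
    proof (rule P.product_nn_integral_insert)
      show "indicator ?S \<in> borel_measurable (PiM (insert i ?I) (\<lambda>_. uniform01))"
        unfolding ins[symmetric] by measurable
    qed auto
    also have "\<dots> = (\<integral>\<^sup>+u. (\<integral>\<^sup>+y. indicator {u j} y \<partial>uniform01) \<partial>PiM ?I (\<lambda>_. uniform01))"
      using ij by (intro nn_integral_cong) (auto simp: indicator_def space_PiM PiE_iff extensional_def)
    also have "\<dots> = 0"
      by (simp add: uniform01_def emeasure_lborel_countable)
    finally show ?thesis using m by (intro AE_I[of _ _ ?S]) auto
  qed
  then have "AE u in PiM {..m} (\<lambda>_. uniform01). \<forall>i\<in>{..m}. \<forall>j\<in>{..m}. i \<noteq> j \<longrightarrow> u i \<noteq> u j"
    by (auto simp: AE_finite_all intro: AE_impI)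
  then show ?thesis by eventually_elim (auto simp: inj_on_def)
qed

lemma emeasure_PiM_scaled_lborel_ball:
  assumes "0 \<le> \<tau>"
  shows "emeasure (PiM {..<m::nat} (\<lambda>_. scaled_lborel \<tau>)) (PiE {..<m} (\<lambda>_. ball (0::'a::euclidean_space) R))
     = ennreal ((\<tau> * measure lborel (ball (0::'a) R)) ^ m)"
proof -
  interpret S: product_sigma_finite "\<lambda>_::nat. scaled_lborel \<tau> :: 'a measure"
    by (rule product_sigma_finite_scaled_lborel)
  have "emeasure lborel (ball (0::'a) R) = ennreal (measure lborel (ball (0::'a) R))"
    using emeasure_bounded_finite[OF bounded_ball[of "0::'a" R]] by (simp add: emeasure_eq_ennreal_measure)
  then have "emeasure (scaled_lborel \<tau>) (ball (0::'a) R) = ennreal (\<tau> * measure lborel (ball (0::'a) R))"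
    using assms by (simp add: emeasure_scaled_lborel ennreal_mult)
  then show ?thesis
    using assms by (subst S.emeasure_PiM) (auto simp: ennreal_power)
qed

text \<open>The weight is bounded by \<open>2 ^ card T\<close>, so it is integrable as soon as it vanishes off a set of
  finite measure; \<open>far\<close> provides this in the form in which the range of interaction is known.\<close>

lemma integrable_cluster_weight:
  fixes c :: "'w \<Rightarrow> nat \<Rightarrow> 'a::euclidean_space"
  assumes "0 < r" and S: "S \<in> sets M" "emeasure M S < \<infinity>"
    and [measurable]: "(\<lambda>\<omega>. cluster_weight k r (c \<omega>) (t \<omega>) T i) \<in> borel_measurable M" and "finite T"
    and far: "\<And>\<omega>. \<omega> \<in> space M - S \<Longrightarrow> \<exists>j\<in>T. 2 * r * real k \<le> dist (c \<omega> j) (c \<omega> i)"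
  shows "integrable M (\<lambda>\<omega>. cluster_weight k r (c \<omega>) (t \<omega>) T i)"
    and "(\<integral>\<omega>. \<bar>cluster_weight k r (c \<omega>) (t \<omega>) T i\<bar> \<partial>M) \<le> 2 ^ card T * measure M S"
proof -
  let ?F = "\<lambda>\<omega>. cluster_weight k r (c \<omega>) (t \<omega>) T i"
  have null: "?F \<omega> = 0" if \<omega>: "\<omega> \<in> space M" "\<omega> \<notin> S" for \<omega>
  proof -
    obtain j where "j \<in> T" "2 * r * real k \<le> dist (c \<omega> j) (c \<omega> i)" using far \<omega> by blast
    then show ?thesis using assms by (intro cluster_weight_eq_0[of r T j]) auto
  qed
  show int: "integrable M ?F"
  proof (rule integrableI_bounded_set[OF S(1) _ S(2)])
    show "AE x in M. x \<in> S \<longrightarrow> norm (?F x) \<le> 2 ^ card T"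
      by (intro AE_I2 impI) (simp add: abs_cluster_weight_le[OF \<open>finite T\<close>])
    show "AE x in M. x \<notin> S \<longrightarrow> ?F x = 0" using null by (auto intro!: AE_I2)
  qed measurable
  have "(\<integral>\<omega>. \<bar>?F \<omega>\<bar> \<partial>M) \<le> (\<integral>\<omega>. 2 ^ card T * indicator S \<omega> \<partial>M)"
  proof (rule integral_mono)
    show "integrable M (\<lambda>\<omega>. \<bar>?F \<omega>\<bar>)" using int by simp
    show "integrable M (\<lambda>\<omega>. 2 ^ card T * indicator S \<omega> :: real)"
      using S by (intro integrable_mult_right integrable_real_indicator) auto
    show "\<bar>?F \<omega>\<bar> \<le> 2 ^ card T * indicator S \<omega>" if "\<omega> \<in> space M" for \<omega>
      using null[OF that] by (simp add: indicator_def abs_cluster_weight_le[OF \<open>finite T\<close>])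
  qed
  then show "(\<integral>\<omega>. \<bar>?F \<omega>\<bar> \<partial>M) \<le> 2 ^ card T * measure M S" using S by simp
qed

text \<open>A site interacts at depth \<open>k\<close> with points up to this distance when balls have unit volume.\<close>

abbreviation unit_range :: "'a::euclidean_space itself \<Rightarrow> nat \<Rightarrow> real" where
  "unit_range T k \<equiv> 2 * unit_radius T * real k"

text \<open>A cluster contributes only if its site is the last to arrive, which has probability
  \<open>1 / (m + 1)\<close>; given this, the order of the other marks is irrelevant by
  \<open>cluster_integral_order\<close>.\<close>

lemma marked_cluster_weight_integral:
  fixes k m :: nat and \<tau> :: real
  assumes "0 \<le> \<tau>"
  defines "G \<equiv> (\<lambda>(z, u :: nat \<Rightarrow> real). cluster_weight k (unit_radius TYPE('a::euclidean_space)) (z(m := 0::'a)) u {..<m} m)"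
  defines "N \<equiv> PiM {..<m} (\<lambda>_. scaled_lborel \<tau>) \<Otimes>\<^sub>M PiM {..m} (\<lambda>_. uniform01)"
  shows "G \<in> borel_measurable (PiM {..<m} (\<lambda>_. borel) \<Otimes>\<^sub>M PiM {..m} (\<lambda>_. borel))"
    and "integrable N G"
    and "(\<integral>p. \<bar>G p\<bar> \<partial>N) \<le> (2 * \<tau> * measure lborel (ball (0::'a) (unit_range TYPE('a) k))) ^ m"
    and "(\<integral>p. G p \<partial>N) = \<tau> ^ m * cluster_integral TYPE('a) k m / real (Suc m)"
proof -
  let ?r = "unit_radius TYPE('a)" and ?R = "unit_range TYPE('a) k"
  let ?Z = "PiM {..<m} (\<lambda>_. scaled_lborel \<tau> :: 'a measure)" and ?V = "PiM {..m} (\<lambda>_. uniform01)"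
  have r: "0 < ?r" by (rule ball_radius_pos) simp
  interpret S: product_sigma_finite "\<lambda>_::nat. scaled_lborel \<tau> :: 'a measure"
    by (rule product_sigma_finite_scaled_lborel)
  interpret Z: sigma_finite_measure ?Z by (rule S.sigma_finite) simp
  interpret V: prob_space ?V by (intro prob_space_PiM prob_space_uniform01)
  interpret ZV: pair_sigma_finite ?Z ?V ..
  have G: "G = (\<lambda>p. cluster_weight k ?r ((fst p)(m := 0)) (snd p) {..<m} m)"
    by (simp add: G_def case_prod_beta')
  show mG: "G \<in> borel_measurable (PiM {..<m} (\<lambda>_. borel) \<Otimes>\<^sub>M PiM {..m} (\<lambda>_. borel))"
    unfolding G
  proof (rule measurable_cluster_weight[OF r])
    fix j l assume "j \<in> insert m {..<m}" "l \<in> insert m {..<m}"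
    then have [measurable]: "(\<lambda>p. snd p j) \<in> borel_measurable (PiM {..<m} (\<lambda>_. borel :: 'a measure) \<Otimes>\<^sub>M PiM {..m} (\<lambda>_. borel :: real measure))"
      "(\<lambda>p. snd p l) \<in> borel_measurable (PiM {..<m} (\<lambda>_. borel :: 'a measure) \<Otimes>\<^sub>M PiM {..m} (\<lambda>_. borel :: real measure))"
      by (auto intro!: measurable_compose[OF measurable_snd] measurable_component_singleton)
    show "Measurable.pred (PiM {..<m} (\<lambda>_. borel :: 'a measure) \<Otimes>\<^sub>M PiM {..m} (\<lambda>_. borel :: real measure)) (\<lambda>p. snd p j < snd p l)"
      unfolding pred_def by (rule borel_measurable_less) fact+
  next
    fix j assume "j \<in> insert m {..<m}"
    then show "(\<lambda>p. ((fst p)(m := 0)) j) \<in> borel_measurable (PiM {..<m} (\<lambda>_. borel :: 'a measure) \<Otimes>\<^sub>M PiM {..m} (\<lambda>_. borel :: real measure))"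
      by (cases "j = m") (auto intro!: measurable_compose[OF measurable_fst] measurable_component_singleton)
  qed
  have sets_N: "sets N = sets (PiM {..<m} (\<lambda>_. borel :: 'a measure) \<Otimes>\<^sub>M PiM {..m} (\<lambda>_. borel :: real measure))"
    unfolding N_def by (intro sets_pair_measure_cong sets_PiM_cong) auto
  have mGN[measurable]: "G \<in> borel_measurable N"
    using mG by (simp cong: measurable_cong_sets add: sets_N)
  let ?B = "PiE {..<m} (\<lambda>_. ball (0::'a) ?R)" and ?v = "measure lborel (ball (0::'a) ?R)"
  have B[measurable]: "?B \<in> sets ?Z" by (intro sets_PiM_I_finite) auto
  have eB: "emeasure N (?B \<times> space ?V) = ennreal ((\<tau> * ?v) ^ m)"
    unfolding N_def using B
    by (subst V.emeasure_pair_measure_Times) (auto simp: V.emeasure_space_1 emeasure_PiM_scaled_lborel_ball[OF assms(1)])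
  have far: "\<exists>j\<in>{..<m}. ?R \<le> dist (((fst p)(m := 0)) j) (((fst p)(m := 0)) m)" if "p \<in> space N - ?B \<times> space ?V" for p
    using that by (auto simp: N_def space_pair_measure space_PiM PiE_iff dist_norm not_less) 
  have SB: "?B \<times> space ?V \<in> sets N" "emeasure N (?B \<times> space ?V) < \<infinity>"
    using B by (auto simp: N_def eB[unfolded N_def])
  note I = integrable_cluster_weight[where c="\<lambda>p. (fst p)(m := 0)" and t=snd, OF r SB mGN[unfolded G] finite_lessThan far]
  show intG: "integrable N G" using I(1) unfolding G .
  have "measure N (?B \<times> space ?V) = (\<tau> * ?v) ^ m"
    using eB assms(1) by (simp add: measure_def)
  then show "(\<integral>p. \<bar>G p\<bar> \<partial>N) \<le> (2 * \<tau> * ?v) ^ m"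
    using I(2) unfolding G by (simp add: power_mult_distrib mult_ac del: fun_upd_apply)
  let ?M = "{u\<in>space ?V. \<forall>j<m. u j < u m}"
  have M: "?M = {u\<in>space ?V. \<forall>j\<in>{..<m}. u j < u m}" by auto
  have [measurable]: "?M \<in> sets ?V" unfolding M by measurable
  have intG': "integrable (?Z \<Otimes>\<^sub>M ?V) (case_prod (\<lambda>z u. G (z, u)))"
    using intG by (simp add: N_def case_prod_beta')
  have inner: "(\<integral>z. G (z, u) \<partial>?Z) = \<tau> ^ m * cluster_integral TYPE('a) k m * indicator ?M u"
    if u: "inj_on u {..m}" "u \<in> space ?V" for u
  proof (cases "u \<in> ?M")
    case True
    have "(\<lambda>z. cluster_weight k ?r (z(m := 0::'a)) u {..<m} m) \<in> borel_measurable (PiM {..<m} (\<lambda>_. borel))"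
      by (rule measurable_cluster_weight[OF r]) (auto intro!: measurable_component_singleton)
    then show ?thesis
      using True that cluster_integral_order[of u m k, where 'a='a]
      by (simp add: G_def integral_PiM_scaled_lborel[OF assms(1)])
  next
    case False
    then obtain j where "j < m" "\<not> u j < u m" using u by auto
    then have "G (z, u) = 0" for z
      unfolding G_def using r by (auto intro!: cluster_weight_eq_0[of _ _ j])
    then show ?thesis using False by simp
  qed
  have "(\<integral>p. G p \<partial>N) = (\<integral>u. (\<integral>z. G (z, u) \<partial>?Z) \<partial>?V)"
    using ZV.integral_snd[OF intG'] by (simp add: N_def case_prod_beta')
  also have "\<dots> = (\<integral>u. \<tau> ^ m * cluster_integral TYPE('a) k m * indicator ?M u \<partial>?V)"
  proof (rule integral_cong_AE)
    show "AE u in ?V. (\<integral>z. G (z, u) \<partial>?Z) = \<tau> ^ m * cluster_integral TYPE('a) k m * indicator ?M u"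
      using AE_PiM_uniform01_inj AE_space by eventually_elim (rule inner)
    have "G \<in> borel_measurable (?Z \<Otimes>\<^sub>M ?V)" using mGN by (simp add: N_def)
    then have "(\<lambda>(u, z). G (z, u)) \<in> borel_measurable (?V \<Otimes>\<^sub>M ?Z)"
      using measurable_pair_swap[of G ?Z ?V borel] by (simp add: case_prod_beta')
    then show "(\<lambda>u. \<integral>z. G (z, u) \<partial>?Z) \<in> borel_measurable ?V"
      by (rule Z.borel_measurable_lebesgue_integral)
  qed measurable
  also have "\<dots> = \<tau> ^ m * cluster_integral TYPE('a) k m * measure ?V ?M" by simp
  also have "measure ?V ?M = 1 / real (Suc m)"
    using PiM_uniform01_max[of m] by (simp add: measure_def)
  finally show "(\<integral>p. G p \<partial>N) = \<tau> ^ m * cluster_integral TYPE('a) k m / real (Suc m)" by simp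
qed

section \<open>Truncated packing at the origin of a Poisson process\<close>

text \<open>The probability that the origin is packed at depth \<open>k\<close> in the Poisson process of intensity
  \<open>\<tau>\<close>, as shown in \<open>expectation_origin_packed_trunc\<close>. The power series makes sense
  without a probability space and is measurable in \<open>\<tau>\<close>.\<close>

definition poisson_packed_prob :: "'a::euclidean_space itself \<Rightarrow> nat \<Rightarrow> real \<Rightarrow> real" where
  "poisson_packed_prob T k \<tau> = (\<Sum>m. \<tau> ^ m * cluster_integral T k m / fact (Suc m))"

lemma finite_inj_tuples_into:
  assumes "finite N"
  shows "finite {e\<in>inj_tuples m. e ` {..<m} \<subseteq> N}"
proof (rule finite_subset)
  show "{e\<in>inj_tuples m. e ` {..<m} \<subseteq> N} \<subseteq> PiE {..<m} (\<lambda>_. N)"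
    by (simp add: inj_tuples_def PiE_iff subset_iff image_iff) blast
  show "finite (PiE {..<m} (\<lambda>_. N))" using assms by (intro finite_PiE) auto
qed

text \<open>Each set of \<open>m\<close> labels is the range of \<open>m!\<close> injective tuples.\<close>

lemma sum_inj_tuples:
  fixes g :: "nat set \<Rightarrow> real"
  assumes "finite N"
  shows "(\<Sum>e\<in>{e\<in>inj_tuples m. e ` {..<m} \<subseteq> N}. g (e ` {..<m})) = fact m * (\<Sum>S\<in>{S\<in>Pow N. card S = m}. g S)"
proof -
  let ?E = "{e\<in>inj_tuples m. e ` {..<m} \<subseteq> N}"
  have fin: "finite ?E"
    using assms by (rule finite_inj_tuples_into)
  have card_fibre: "real (card {e\<in>?E. e ` {..<m} = S}) = fact m" if S: "S \<subseteq> N" "card S = m" for S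
  proof -
    have finS: "finite S" using S assms finite_subset by auto
    have "{e\<in>?E. e ` {..<m} = S} = {e \<in> PiE {..<m} (\<lambda>_. S). inj_on e {..<m}}" (is "?A = ?B")
    proof
      show "?A \<subseteq> ?B" by (auto simp: inj_tuples_def PiE_iff)
      show "?B \<subseteq> ?A"
      proof
        fix e assume e: "e \<in> ?B"
        then have "e ` {..<m} \<subseteq> S" "card (e ` {..<m}) = card S" using S by (auto simp: card_image)
        then have "e ` {..<m} = S" using finS by (intro card_subset_eq) auto
        then show "e \<in> ?A" using e S by (auto simp: inj_tuples_def PiE_iff)
      qed
    qed
    then have "real (card {e\<in>?E. e ` {..<m} = S}) = ffact_real (real (card S)) m"
      using card_inj_tuples_disjoint[of "{()}" m "\<lambda>_. ()" "\<lambda>_. S"] finS by simp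
    then show ?thesis using S by (simp only: ffact_real_nat) simp
  qed
  have image: "(\<lambda>e. e ` {..<m}) ` ?E \<subseteq> {S\<in>Pow N. card S = m}"
    by (auto simp: inj_tuples_def card_image)
  have "(\<Sum>e\<in>?E. g (e ` {..<m})) = (\<Sum>S\<in>{S\<in>Pow N. card S = m}. \<Sum>e\<in>{e\<in>?E. e ` {..<m} = S}. g (e ` {..<m}))"
    using fin assms image by (intro sum.group[symmetric]) auto
  also have "\<dots> = (\<Sum>S\<in>{S\<in>Pow N. card S = m}. fact m * g S)"
  proof (rule sum.cong)
    fix S assume S: "S \<in> {S\<in>Pow N. card S = m}"
    have "(\<Sum>e\<in>{e\<in>?E. e ` {..<m} = S}. g (e ` {..<m})) = real (card {e\<in>?E. e ` {..<m} = S}) * g S"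
      by simp
    then show "(\<Sum>e\<in>{e\<in>?E. e ` {..<m} = S}. g (e ` {..<m})) = fact m * g S"
      using card_fibre S by simp
  qed simp
  finally show ?thesis by (simp add: sum_distrib_left)
qed

context
  fixes Q :: "'v measure" and Z :: "nat \<Rightarrow> 'v \<Rightarrow> 'a::euclidean_space" and U :: "nat \<Rightarrow> 'v \<Rightarrow> real" and \<tau> :: real
  assumes mp: "marked_poisson_process Q \<tau> Z U" and \<tau>: "0 < \<tau>"
begin

text \<open>Label \<open>0\<close> is the origin, to match the labelling of the marks.\<close>

abbreviation points_with_origin :: "'v \<Rightarrow> nat \<Rightarrow> 'a" where
  "points_with_origin \<omega> \<equiv> case_nat 0 (\<lambda>i. Z i \<omega>)"

definition origin_packed_trunc :: "nat \<Rightarrow> 'v \<Rightarrow> bool" where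
  "origin_packed_trunc k \<omega> = packed_trunc k (unit_radius TYPE('a)) (points_with_origin \<omega>) (\<lambda>i. U i \<omega>) (range Suc) 0"

text \<open>The summand of the cluster expansion at the origin, written as a function on sample points and
  tuples so that the factorial moment measure can be integrated against it.\<close>

definition tuple_weight :: "nat \<Rightarrow> nat \<Rightarrow> 'v \<times> (nat \<Rightarrow> nat) \<Rightarrow> real" where
  "tuple_weight k m p = cluster_weight k (unit_radius TYPE('a)) ((tuple_locations Z m p)(m := 0)) (tuple_marks U m p) {..<m} m"

lemma marked_poisson_facts:
  shows "poisson_process Q \<tau> Z" and "prob_space Q" and "Z i \<in> Q \<rightarrow>\<^sub>M borel" and "U i \<in> Q \<rightarrow>\<^sub>M borel"
proof -
  show pp: "poisson_process Q \<tau> Z" using mp by (simp add: marked_poisson_process_def)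
  show "prob_space Q" "Z i \<in> Q \<rightarrow>\<^sub>M borel" using pp by (simp_all add: poisson_process_def)
  have "prob_space.indep_vars Q (\<lambda>_. borel) U UNIV" using mp by (simp add: marked_poisson_process_def)
  then show "U i \<in> Q \<rightarrow>\<^sub>M borel" using \<open>prob_space Q\<close> by (auto simp: prob_space.indep_vars_def)
qed

lemma measurable_origin_packed_trunc: "Measurable.pred Q (origin_packed_trunc k)"
proof -
  note [measurable] = marked_poisson_facts(3,4)
  have r: "0 < unit_radius TYPE('a)" by (rule ball_radius_pos) simp
  have [measurable]: "(\<lambda>\<omega>. points_with_origin \<omega> j) \<in> borel_measurable Q" for j
    by (cases j) auto
  have "Measurable.pred Q (\<lambda>\<omega>. packed_trunc k (unit_radius TYPE('a)) (points_with_origin \<omega>) (\<lambda>i. U i \<omega>) (range Suc) 0)"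
    by (rule measurable_packed_trunc[where J=UNIV]) (auto intro!: measurable_overlap r)
  then show ?thesis by (simp add: origin_packed_trunc_def[abs_def])
qed

lemma tuple_weight_integrals:
  fixes k m
  defines "C \<equiv> count_space (inj_tuples m)"
  shows "integrable (Q \<Otimes>\<^sub>M C) (tuple_weight k m)"
    and "(\<integral>p. \<bar>tuple_weight k m p\<bar> \<partial>(Q \<Otimes>\<^sub>M C)) \<le> (2 * \<tau> * measure lborel (ball (0::'a) (unit_range TYPE('a) k))) ^ m"
    and "(\<integral>p. tuple_weight k m p \<partial>(Q \<Otimes>\<^sub>M C)) = \<tau> ^ m * cluster_integral TYPE('a) k m / real (Suc m)"
proof -
  note mZ = marked_poisson_facts(3) and mU = marked_poisson_facts(4)
  let ?M = "PiM {..<m} (\<lambda>_. borel :: 'a measure) \<Otimes>\<^sub>M PiM {..m} (\<lambda>_. borel :: real measure)"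
  let ?T = "\<lambda>p. (tuple_locations Z m p, tuple_marks U m p)"
  let ?G = "\<lambda>(z, u :: nat \<Rightarrow> real). cluster_weight k (unit_radius TYPE('a)) (z(m := 0::'a)) u {..<m} m"
  have [measurable]: "?T \<in> Q \<Otimes>\<^sub>M C \<rightarrow>\<^sub>M ?M"
    unfolding C_def using measurable_tuple_locations[of Z, OF mZ] measurable_tuple_marks[of U, OF mU]
    by (rule measurable_Pair)
  have d: "distr (Q \<Otimes>\<^sub>M C) ?M ?T = PiM {..<m} (\<lambda>_. scaled_lborel \<tau>) \<Otimes>\<^sub>M PiM {..m} (\<lambda>_. uniform01)"
    unfolding C_def using \<tau> by (intro marked_poisson_process_factorial_measure[OF mp]) simp
  have 0: "0 \<le> \<tau>" using \<tau> by simp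
  note I = marked_cluster_weight_integral[OF 0, where k=k and m=m and 'a='a]
  have GT: "tuple_weight k m = (\<lambda>p. ?G (?T p))" by (simp add: tuple_weight_def[abs_def])
  show "integrable (Q \<Otimes>\<^sub>M C) (tuple_weight k m)"
    unfolding GT
  proof (rule integrable_distr[of ?T _ ?M])
    show "integrable (distr (Q \<Otimes>\<^sub>M C) ?M ?T) ?G" unfolding d by (rule I(2))
  qed measurable
  have "(\<integral>p. \<bar>tuple_weight k m p\<bar> \<partial>(Q \<Otimes>\<^sub>M C)) = (\<integral>p. \<bar>?G p\<bar> \<partial>distr (Q \<Otimes>\<^sub>M C) ?M ?T)"
    unfolding GT using I(1) by (subst integral_distr) auto
  then show "(\<integral>p. \<bar>tuple_weight k m p\<bar> \<partial>(Q \<Otimes>\<^sub>M C)) \<le> (2 * \<tau> * measure lborel (ball (0::'a) (unit_range TYPE('a) k))) ^ m"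
    using I(3) by (simp add: d)
  have "(\<integral>p. tuple_weight k m p \<partial>(Q \<Otimes>\<^sub>M C)) = (\<integral>p. ?G p \<partial>distr (Q \<Otimes>\<^sub>M C) ?M ?T)"
    unfolding GT using I(1) by (subst integral_distr) auto
  then show "(\<integral>p. tuple_weight k m p \<partial>(Q \<Otimes>\<^sub>M C)) = \<tau> ^ m * cluster_integral TYPE('a) k m / real (Suc m)"
    using I(4) by (simp add: d)
qed

text \<open>Almost surely only finitely many points are within the range of interaction. Restricted to
  these, the truncated indicator is the sum of the cluster weights over all subsets; grouping by
  size and passing to ordered tuples gives the integral of \<open>tuple_weight\<close>, up to \<open>m!\<close>.\<close>

lemma origin_packed_trunc_expansion:
  assumes fin: "finite {i. Z i \<omega> \<in> ball 0 (unit_range TYPE('a) k)}"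
  defines "D \<equiv> \<lambda>m. (\<integral>e. tuple_weight k m (\<omega>, e) \<partial>count_space (inj_tuples m)) / fact m"
  shows "\<exists>n. (\<forall>m\<ge>n. D m = 0) \<and> of_bool (origin_packed_trunc k \<omega>) = (\<Sum>m<n. D m)"
proof -
  let ?r = "unit_radius TYPE('a)" and ?R = "unit_range TYPE('a) k"
  let ?c = "points_with_origin \<omega>" and ?t = "\<lambda>i. U i \<omega>"
  let ?w = "\<lambda>T. cluster_weight k ?r ?c ?t T 0"
  have r: "0 < ?r" by (rule ball_radius_pos) simp
  define N where "N = {i. Z i \<omega> \<in> ball 0 ?R}"
  have finN: "finite N" using fin by (simp add: N_def)
  have D: "D m = (\<Sum>S\<in>{S\<in>Pow N. card S = m}. ?w (Suc ` S))" for m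
  proof -
    have w: "tuple_weight k m (\<omega>, e) = ?w (Suc ` e ` {..<m})" if e: "e \<in> inj_tuples m" for e
    proof -
      have inj: "inj_on (tuple_index m e) {..<m}"
        using e by (auto simp: inj_on_def tuple_index_def inj_tuples_def)
      have "Suc ` e ` {..<m} = tuple_index m e ` {..<m}" "tuple_index m e m = 0"
        by (auto simp: tuple_index_def)
      then have "?w (Suc ` e ` {..<m}) = cluster_weight k ?r (?c \<circ> tuple_index m e) (?t \<circ> tuple_index m e) {..<m} m"
        using cluster_weight_relabel[OF inj, of k ?r ?c ?t m] by simp
      also have "\<dots> = tuple_weight k m (\<omega>, e)"
        unfolding tuple_weight_def
        by (rule cluster_weight_cong) (auto simp: tuple_index_def tuple_locations_def tuple_marks_def)
      finally show ?thesis by simp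
    qed
    have 0: "tuple_weight k m (\<omega>, e) = 0" if e: "e \<in> inj_tuples m" "\<not> e ` {..<m} \<subseteq> N" for e
    proof -
      obtain j where "j < m" "e j \<notin> N" using e(2) by auto
      then show ?thesis
        unfolding tuple_weight_def using r
        by (intro cluster_weight_eq_0[of _ _ j]) (simp_all add: tuple_locations_def N_def dist_norm)
    qed
    let ?E = "{e\<in>inj_tuples m. e ` {..<m} \<subseteq> N}"
    have finE: "finite ?E"
      using finN by (rule finite_inj_tuples_into)
    have sub: "{e. e \<in> inj_tuples m \<and> tuple_weight k m (\<omega>, e) \<noteq> 0} \<subseteq> ?E" using 0 by auto
    have "(\<integral>e. tuple_weight k m (\<omega>, e) \<partial>count_space (inj_tuples m))
      = (\<Sum>e | e \<in> inj_tuples m \<and> tuple_weight k m (\<omega>, e) \<noteq> 0. tuple_weight k m (\<omega>, e))"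
      using finite_subset[OF sub finE] by (intro lebesgue_integral_count_space_finite_support) auto
    also have "\<dots> = (\<Sum>e\<in>?E. tuple_weight k m (\<omega>, e))"
      using sub finE by (intro sum.mono_neutral_left) auto
    also have "\<dots> = (\<Sum>e\<in>?E. ?w (Suc ` e ` {..<m}))" using w by (intro sum.cong) auto
    also have "\<dots> = fact m * (\<Sum>S\<in>{S\<in>Pow N. card S = m}. ?w (Suc ` S))"
      by (rule sum_inj_tuples[OF finN])
    finally show ?thesis by (simp add: D_def)
  qed
  have "D m = 0" if "m \<ge> Suc (card N)" for m
  proof -
    have "card S \<noteq> m" if "S \<in> Pow N" for S
      using card_mono[OF finN, of S] that \<open>m \<ge> Suc (card N)\<close> by auto
    then have "{S\<in>Pow N. card S = m} = {}" by blast
    then show ?thesis unfolding D by (simp only: sum.empty)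
  qed
  moreover have "of_bool (origin_packed_trunc k \<omega>) = (\<Sum>m<Suc (card N). D m)"
  proof -
    have "origin_packed_trunc k \<omega> = packed_trunc k ?r ?c ?t (Suc ` N) 0"
      unfolding origin_packed_trunc_def using r
      by (intro packed_trunc_local) (auto simp: N_def)
    then have "of_bool (origin_packed_trunc k \<omega>) = (\<Sum>T\<in>Pow (Suc ` N). ?w T)"
      using finN by (simp add: sum_cluster_weight)
    also have "\<dots> = (\<Sum>S\<in>Pow N. ?w (Suc ` S))"
      by (simp add: image_Pow_surj[symmetric] sum.reindex inj_on_image_Pow)
    also have "\<dots> = (\<Sum>m<Suc (card N). \<Sum>S\<in>{S\<in>Pow N. card S = m}. ?w (Suc ` S))"
      using finN by (intro sum.group[symmetric]) (auto simp: less_Suc_eq_le intro: card_mono)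
    finally show ?thesis unfolding D .
  qed
  ultimately show ?thesis by blast
qed

text \<open>Term by term integration of the expansion. The factorial in the denominator makes the sum of
  the mean absolute terms an exponential series, which justifies the exchange for every intensity.\<close>

lemma expectation_origin_packed_trunc:
  "(\<integral>\<omega>. of_bool (origin_packed_trunc k \<omega>) \<partial>Q) = poisson_packed_prob TYPE('a) k \<tau>"
proof -
  interpret prob_space Q by (rule marked_poisson_facts)
  let ?v = "measure lborel (ball (0::'a) (unit_range TYPE('a) k))"
  define D where "D m \<omega> = (\<integral>e. tuple_weight k m (\<omega>, e) \<partial>count_space (inj_tuples m)) / fact m" for m \<omega>
  have intD: "integrable Q (D m)" and boundD: "(\<integral>\<omega>. norm (D m \<omega>) \<partial>Q) \<le> (2 * \<tau> * ?v) ^ m /\<^sub>R fact m"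
    and valD: "(\<integral>\<omega>. D m \<omega> \<partial>Q) = \<tau> ^ m * cluster_integral TYPE('a) k m / fact (Suc m)" for m
  proof -
    let ?C = "count_space (inj_tuples m)"
    interpret C: sigma_finite_measure ?C by (rule sigma_finite_measure_count_space_countable) simp
    interpret QC: pair_sigma_finite Q ?C ..
    note I = tuple_weight_integrals[where k=k and m=m]
    show "integrable Q (D m)"
      unfolding D_def[abs_def] using QC.integrable_fst'[OF I(1)] by simp
    have "(\<integral>\<omega>. D m \<omega> \<partial>Q) = (\<integral>p. tuple_weight k m p \<partial>(Q \<Otimes>\<^sub>M ?C)) / fact m"
      unfolding D_def using QC.integral_fst'[OF I(1)] by simp
    then show "(\<integral>\<omega>. D m \<omega> \<partial>Q) = \<tau> ^ m * cluster_integral TYPE('a) k m / fact (Suc m)"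
      by (simp add: I(3) field_simps)
    have "(\<integral>\<omega>. norm (D m \<omega>) \<partial>Q) \<le> (\<integral>\<omega>. (\<integral>e. \<bar>tuple_weight k m (\<omega>, e)\<bar> \<partial>?C) / fact m \<partial>Q)"
    proof (rule integral_mono)
      show "integrable Q (\<lambda>\<omega>. norm (D m \<omega>))" using \<open>integrable Q (D m)\<close> by simp
      show "integrable Q (\<lambda>\<omega>. (\<integral>e. \<bar>tuple_weight k m (\<omega>, e)\<bar> \<partial>?C) / fact m)"
        using QC.integrable_fst'[OF integrable_abs[OF I(1)]] by simp
      show "norm (D m \<omega>) \<le> (\<integral>e. \<bar>tuple_weight k m (\<omega>, e)\<bar> \<partial>?C) / fact m" for \<omega>
        unfolding D_def by (simp add: divide_right_mono integral_abs_bound)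
    qed
    also have "\<dots> = (\<integral>p. \<bar>tuple_weight k m p\<bar> \<partial>(Q \<Otimes>\<^sub>M ?C)) / fact m"
      using QC.integral_fst'[OF integrable_abs[OF I(1)]] by simp
    also have "\<dots> \<le> (2 * \<tau> * ?v) ^ m / fact m"
      using I(2) by (intro divide_right_mono) auto
    finally show "(\<integral>\<omega>. norm (D m \<omega>) \<partial>Q) \<le> (2 * \<tau> * ?v) ^ m /\<^sub>R fact m"
      by (simp add: field_simps)
  qed
  have expand: "AE \<omega> in Q. \<exists>n. (\<forall>m\<ge>n. D m \<omega> = 0) \<and> of_bool (origin_packed_trunc k \<omega>) = (\<Sum>m<n. D m \<omega>)"
  proof -
    have "AE \<omega> in Q. finite {i. Z i \<omega> \<in> ball 0 (unit_range TYPE('a) k)}"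
      by (rule poisson_process_AE_finite[OF marked_poisson_facts(1)]) auto
    then show ?thesis
      unfolding D_def by eventually_elim (rule origin_packed_trunc_expansion)
  qed
  have "(\<integral>\<omega>. of_bool (origin_packed_trunc k \<omega>) \<partial>Q) = (\<integral>\<omega>. (\<Sum>m. D m \<omega>) \<partial>Q)"
  proof (rule integral_cong_AE)
    note [measurable] = measurable_origin_packed_trunc borel_measurable_integrable[OF intD]
    show "(\<lambda>\<omega>. of_bool (origin_packed_trunc k \<omega>)) \<in> borel_measurable Q"
      "(\<lambda>\<omega>. \<Sum>m. D m \<omega>) \<in> borel_measurable Q" by measurable
    show "AE \<omega> in Q. of_bool (origin_packed_trunc k \<omega>) = (\<Sum>m. D m \<omega>)"
      using expand
    proof eventually_elim
      case (elim \<omega>)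
      then obtain n where "\<forall>m\<ge>n. D m \<omega> = 0" "of_bool (origin_packed_trunc k \<omega>) = (\<Sum>m<n. D m \<omega>)" by blast
      then show ?case using suminf_finite[of "{..<n}" "\<lambda>m. D m \<omega>"] by (simp add: not_less)
    qed
  qed
  also have "\<dots> = (\<Sum>m. \<integral>\<omega>. D m \<omega> \<partial>Q)"
  proof (rule integral_suminf[OF intD])
    show "AE \<omega> in Q. summable (\<lambda>m. norm (D m \<omega>))"
      using expand
    proof eventually_elim
      case (elim \<omega>)
      then obtain n where "\<forall>m\<ge>n. D m \<omega> = 0" by blast
      then show ?case by (intro summable_finite[of "{..<n}"]) (auto simp: not_less)
    qed
    show "summable (\<lambda>m. \<integral>\<omega>. norm (D m \<omega>) \<partial>Q)"
      by (rule summable_comparison_test_ev[OF _ summable_exp_generic[of "2 * \<tau> * ?v"]])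
        (use boundD in \<open>auto intro!: always_eventually\<close>)
  qed
  finally show ?thesis by (simp add: valD poisson_packed_prob_def)
qed

end

section \<open>Descending chains\<close>

text \<open>Chains are integrated from the fixed end \<open>y\<close> downwards: \<open>g m y\<close> bounds the measure of chains of
  \<open>m\<close> points below \<open>y\<close>, and \<open>g\<close> propagates along one link. The two uses are overlapping
  locations and ordered marks.\<close>

lemma emeasure_chain_le:
  fixes M :: "'b measure" and g :: "nat \<Rightarrow> 'b \<Rightarrow> ennreal"
  assumes M: "sigma_finite_measure M"
    and R[measurable]: "Measurable.pred (M \<Otimes>\<^sub>M M) (\<lambda>(x, y). R x y)"
    and g0: "\<And>y. y \<in> space M \<Longrightarrow> 1 \<le> g 0 y"
    and g: "\<And>m y. y \<in> space M \<Longrightarrow> (\<integral>\<^sup>+w. g m w * indicator {w. R w y} w \<partial>M) \<le> g (Suc m) y"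
    and y: "y \<in> space M"
  shows "emeasure (PiM {..<m} (\<lambda>_. M)) {z\<in>space (PiM {..<m} (\<lambda>_. M)). \<forall>j<m. R (z j) ((z(m := y)) (Suc j))} \<le> g m y"
  using y
proof (induction m arbitrary: y)
  case 0
  interpret P: product_sigma_finite "\<lambda>_::nat. M" using M by (simp add: product_sigma_finite_def)
  have "emeasure (PiM {..<0::nat} (\<lambda>_. M)) {z\<in>space (PiM {..<0::nat} (\<lambda>_. M)). \<forall>j<0. R (z j) ((z(0 := y)) (Suc j))} = 1"
    by (simp add: PiM_empty)
  then show ?case using g0[OF 0] by simp
next
  case (Suc m)
  interpret P: product_sigma_finite "\<lambda>_::nat. M" using M by (simp add: product_sigma_finite_def)
  let ?S = "\<lambda>m y. {z\<in>space (PiM {..<m} (\<lambda>_. M)). \<forall>j<m. R (z j) ((z(m := y)) (Suc j))}"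
  have sets: "?S m y \<in> sets (PiM {..<m} (\<lambda>_. M))" if "y \<in> space M" for m :: nat and y
  proof -
    have "Measurable.pred (PiM {..<m} (\<lambda>_. M)) (\<lambda>z. R (z j) ((z(m := y)) (Suc j)))" if "j < m" for j
    proof -
      have [measurable]: "(\<lambda>z. z j) \<in> PiM {..<m} (\<lambda>_. M) \<rightarrow>\<^sub>M M"
        using that by (intro measurable_component_singleton) auto
      have [measurable]: "(\<lambda>z. (z(m := y)) (Suc j)) \<in> PiM {..<m} (\<lambda>_. M) \<rightarrow>\<^sub>M M"
      proof (cases "Suc j = m")
        case True
        then show ?thesis using \<open>y \<in> space M\<close> by simp
      next
        case False
        then show ?thesis using that by (simp add: measurable_component_singleton)
      qed
      have "(\<lambda>z. (z j, (z(m := y)) (Suc j))) \<in> PiM {..<m} (\<lambda>_. M) \<rightarrow>\<^sub>M M \<Otimes>\<^sub>M M"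
        by (rule measurable_Pair) fact+
      from measurable_compose[OF this R] show ?thesis by (simp only: prod.case)
    qed
    then have S: "{z\<in>space (PiM {..<m} (\<lambda>_. M)). R (z j) ((z(m := y)) (Suc j))} \<in> sets (PiM {..<m} (\<lambda>_. M))"
      if "j \<in> {..<m}" for j
      using that pred_def[THEN iffD1] by blast
    have "{z\<in>space (PiM {..<m} (\<lambda>_. M)). \<forall>j\<in>{..<m}. R (z j) ((z(m := y)) (Suc j))} \<in> sets (PiM {..<m} (\<lambda>_. M))"
      by (rule sets.sets_Collect_finite_All[OF S finite_lessThan])
    then show ?thesis by (simp only: Ball_def lessThan_iff)
  qed
  have ins: "{..<Suc m} = insert m {..<m}" by auto
  have m1: "indicator (?S (Suc m) y) \<in> borel_measurable (PiM (insert m {..<m}) (\<lambda>_. M))"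
    unfolding ins[symmetric] by (rule borel_measurable_indicator[OF sets[OF Suc.prems]])
  have "emeasure (PiM {..<Suc m} (\<lambda>_. M)) (?S (Suc m) y) = (\<integral>\<^sup>+z. indicator (?S (Suc m) y) z \<partial>PiM (insert m {..<m}) (\<lambda>_. M))"
    unfolding ins[symmetric] by (rule nn_integral_indicator[OF sets[OF Suc.prems], symmetric])
  also have "\<dots> = (\<integral>\<^sup>+w. (\<integral>\<^sup>+z. indicator (?S (Suc m) y) (z(m := w)) \<partial>PiM {..<m} (\<lambda>_. M)) \<partial>M)"
    by (rule P.product_nn_integral_insert_rev[OF _ _ m1]) simp_all
  also have "\<dots> = (\<integral>\<^sup>+w. emeasure (PiM {..<m} (\<lambda>_. M)) (?S m w) * indicator {w. R w y} w \<partial>M)"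
  proof (rule nn_integral_cong)
    fix w assume w: "w \<in> space M"
    have "(\<integral>\<^sup>+z. indicator (?S (Suc m) y) (z(m := w)) \<partial>PiM {..<m} (\<lambda>_. M))
        = (\<integral>\<^sup>+z. indicator (?S m w) z * indicator {w. R w y} w \<partial>PiM {..<m} (\<lambda>_. M))"
    proof (rule nn_integral_cong)
      fix z assume z: "z \<in> space (PiM {..<m} (\<lambda>_. M))"
      have sp: "z(m := w) \<in> space (PiM {..<Suc m} (\<lambda>_. M))"
        unfolding space_PiM ins using z w by (intro PiE_fun_upd) (simp_all add: space_PiM)
      have eqv: "(\<forall>j<Suc m. R ((z(m := w)) j) ((z(m := w, Suc m := y)) (Suc j))) \<longleftrightarrow>
          (\<forall>j<m. R (z j) ((z(m := w)) (Suc j))) \<and> R w y"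
      proof -
        have "R ((z(m := w)) j) ((z(m := w, Suc m := y)) (Suc j)) \<longleftrightarrow> R (z j) ((z(m := w)) (Suc j))"
          if "j < m" for j using that by simp
        moreover have "R ((z(m := w)) m) ((z(m := w, Suc m := y)) (Suc m)) \<longleftrightarrow> R w y" by simp
        ultimately show ?thesis unfolding less_Suc_eq by blast
      qed
      have "z(m := w) \<in> ?S (Suc m) y \<longleftrightarrow> z \<in> ?S m w \<and> R w y"
        unfolding mem_Collect_eq eqv using sp z by blast
      then have "(of_bool (z(m := w) \<in> ?S (Suc m) y) :: ennreal) = of_bool (z \<in> ?S m w \<and> R w y)"
        by (rule arg_cong)
      also have "\<dots> = of_bool (z \<in> ?S m w) * of_bool (w \<in> {w. R w y})"
        unfolding of_bool_conj[of "z \<in> ?S m w"] mem_Collect_eq[of w] ..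
      finally show "indicator (?S (Suc m) y) (z(m := w)) = (indicator (?S m w) z * indicator {w. R w y} w :: ennreal)"
        unfolding indicator_def .
    qed
    also have "\<dots> = emeasure (PiM {..<m} (\<lambda>_. M)) (?S m w) * indicator {w. R w y} w"
      unfolding nn_integral_multc[OF borel_measurable_indicator[OF sets[OF w]]] nn_integral_indicator[OF sets[OF w]] ..
    finally show "(\<integral>\<^sup>+z. indicator (?S (Suc m) y) (z(m := w)) \<partial>PiM {..<m} (\<lambda>_. M))
       = emeasure (PiM {..<m} (\<lambda>_. M)) (?S m w) * indicator {w. R w y} w" .
  qed
  also have "\<dots> \<le> (\<integral>\<^sup>+w. g m w * indicator {w. R w y} w \<partial>M)"
    by (intro nn_integral_mono mult_right_mono Suc.IH) auto
  also have "\<dots> \<le> g (Suc m) y" by (rule g) fact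
  finally show ?case .
qed

lemma emeasure_location_chain_le:
  fixes y :: "'a::euclidean_space"
  assumes "0 < r" "0 \<le> \<tau>"
  shows "emeasure (PiM {..<m} (\<lambda>_. scaled_lborel \<tau>))
      {z\<in>space (PiM {..<m} (\<lambda>_. scaled_lborel \<tau>)). \<forall>j<m. overlap r (z j) ((z(m := y)) (Suc j))}
    \<le> ennreal ((\<tau> * measure lborel (ball (0::'a) (2 * r))) ^ m)"
proof (rule emeasure_chain_le[where R="overlap r" and
      g="\<lambda>m _. ennreal ((\<tau> * measure lborel (ball (0::'a) (2 * r))) ^ m)"], rule sigma_finite_scaled_lborel)
  show "Measurable.pred (scaled_lborel \<tau> \<Otimes>\<^sub>M scaled_lborel \<tau>) (\<lambda>(x :: 'a, y). overlap r x y)"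
    unfolding overlap_iff_dist[OF assms(1)] by (simp add: case_prod_beta')
  fix m and y :: 'a
  let ?v = "\<tau> * measure lborel (ball (0::'a) (2 * r))"
  have "(\<integral>\<^sup>+w. ennreal (?v ^ m) * indicator {w. overlap r w y} w \<partial>scaled_lborel \<tau>)
      = ennreal (?v ^ m) * emeasure (scaled_lborel \<tau>) (ball y (2 * r))"
  proof -
    have "{w. overlap r w y} = ball y (2 * r)"
      by (auto simp: overlap_iff_dist[OF assms(1)] dist_commute)
    then show ?thesis by (simp add: nn_integral_cmult_indicator)
  qed
  also have "emeasure (scaled_lborel \<tau>) (ball y (2 * r)) = ennreal ?v"
  proof -
    have "emeasure lborel (ball y (2 * r)) = ennreal (measure lborel (ball (0::'a) (2 * r)))"
      using assms(1) emeasure_bounded_finite[OF bounded_ball[of y "2 * r"]]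
      by (simp add: emeasure_eq_ennreal_measure content_ball)
    then show ?thesis using assms(2) by (simp add: emeasure_scaled_lborel ennreal_mult)
  qed
  also have "ennreal (?v ^ m) * ennreal ?v = ennreal (?v ^ Suc m)"
    using assms(2) by (subst ennreal_mult[symmetric]) (auto simp: mult_ac)
  finally show "(\<integral>\<^sup>+w. ennreal (?v ^ m) * indicator {w. overlap r w y} w \<partial>scaled_lborel \<tau>) \<le> ennreal (?v ^ Suc m)"
    by simp
qed auto

text \<open>The bound is the volume of the simplex \<open>0 < u\<^sub>0 < \<dots> < u\<^sub>m\<^sub>-\<^sub>1 < y\<close>.\<close>

lemma emeasure_mark_chain_le:
  "emeasure (PiM {..<m} (\<lambda>_. uniform01))
      {u\<in>space (PiM {..<m} (\<lambda>_. uniform01)). \<forall>j<m. u j < (u(m := y)) (Suc j)}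
    \<le> ennreal (max 0 y ^ m / fact m)"
proof (rule emeasure_chain_le[where R="(<)"])
  show "sigma_finite_measure uniform01" by (rule prob_space_imp_sigma_finite[OF prob_space_uniform01])
  show "Measurable.pred (uniform01 \<Otimes>\<^sub>M uniform01) (\<lambda>(x, y). x < y)"
    by (simp add: case_prod_beta')
  fix m and y :: real
  have "(\<integral>\<^sup>+w. ennreal (max 0 w ^ m / fact m) * indicator {w. w < y} w \<partial>uniform01)
     = (\<integral>\<^sup>+w. ennreal (max 0 w ^ m / fact m) * indicator {w. w < y} w * indicator {0..1} w \<partial>lborel)"
    by (rule nn_integral_uniform01) measurable
  also have "\<dots> \<le> (\<integral>\<^sup>+w. ennreal (w ^ m / fact m) * indicator {0..max 0 y} w \<partial>lborel)"
    by (intro nn_integral_mono) (auto simp: indicator_def)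
  also have "\<dots> = ennreal (max 0 y ^ Suc m / fact (Suc m) - 0 ^ Suc m / fact (Suc m))"
  proof (rule nn_integral_FTC_Icc)
    fix x :: real
    have "DERIV (\<lambda>x. x ^ Suc m / fact (Suc m)) x :> (real (Suc m) * x ^ (Suc m - Suc 0)) / fact (Suc m)"
      by (rule DERIV_cdivide[OF DERIV_pow])
    then show "DERIV (\<lambda>x. x ^ Suc m / fact (Suc m)) x :> x ^ m / fact m"
      by (simp del: of_nat_Suc)
  qed auto
  finally show "(\<integral>\<^sup>+w. ennreal (max 0 w ^ m / fact m) * indicator {w. w < y} w \<partial>uniform01) \<le> ennreal (max 0 y ^ Suc m / fact (Suc m))"
    by simp
qed auto

lemma emeasure_full_mark_chain_le:
  "emeasure (PiM {..m} (\<lambda>_. uniform01))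
      {u\<in>space (PiM {..m} (\<lambda>_. uniform01)). \<forall>j<m. u j < u (Suc j)} \<le> ennreal (1 / fact m)"
proof -
  interpret P: product_prob_space "\<lambda>_::nat. uniform01" by (rule product_prob_space_uniform01)
  interpret V: prob_space uniform01 by (rule prob_space_uniform01)
  let ?S = "{u\<in>space (PiM {..m} (\<lambda>_. uniform01)). \<forall>j<m. u j < u (Suc j)}"
  have S: "?S = {u\<in>space (PiM {..m} (\<lambda>_. uniform01)). \<forall>j\<in>{..<m}. u j < u (Suc j)}" by auto
  have [measurable]: "?S \<in> sets (PiM {..m} (\<lambda>_. uniform01))"
  proof -
    have "{u\<in>space (PiM {..m} (\<lambda>_. uniform01)). u j < u (Suc j)} \<in> sets (PiM {..m} (\<lambda>_. uniform01))" if "j < m" for j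
      using that by (intro borel_measurable_less measurable_compose[OF measurable_component_singleton]) auto
    then show ?thesis unfolding S by (intro sets.sets_Collect_finite_All) auto
  qed
  have ins: "{..m} = insert m {..<m}" by auto
  have "emeasure (PiM {..m} (\<lambda>_. uniform01)) ?S = (\<integral>\<^sup>+u. indicator ?S u \<partial>PiM (insert m {..<m}) (\<lambda>_. uniform01))"
    unfolding ins[symmetric] by simp
  also have "\<dots> = (\<integral>\<^sup>+y. (\<integral>\<^sup>+u. indicator ?S (u(m := y)) \<partial>PiM {..<m} (\<lambda>_. uniform01)) \<partial>uniform01)"
    by (rule P.product_nn_integral_insert_rev) (auto simp flip: ins)
  also have "\<dots> \<le> (\<integral>\<^sup>+y. ennreal (max 0 y ^ m / fact m) \<partial>uniform01)"
  proof (intro nn_integral_mono)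
    fix y
    let ?A = "{u\<in>space (PiM {..<m} (\<lambda>_. uniform01)). \<forall>j<m. u j < (u(m := y)) (Suc j)}"
    have "(\<integral>\<^sup>+u. indicator ?S (u(m := y)) \<partial>PiM {..<m} (\<lambda>_. uniform01)) = (\<integral>\<^sup>+u. indicator ?A u \<partial>PiM {..<m} (\<lambda>_. uniform01))"
      by (intro nn_integral_cong) (auto simp: indicator_def space_PiM PiE_iff extensional_def)
    also have "\<dots> = emeasure (PiM {..<m} (\<lambda>_. uniform01)) ?A"
    proof (rule nn_integral_indicator)
      have "{u\<in>space (PiM {..<m} (\<lambda>_. uniform01)). u j < (u(m := y)) (Suc j)} \<in> sets (PiM {..<m} (\<lambda>_. uniform01))" if "j < m" for j
      proof (rule borel_measurable_less)
        show "(\<lambda>u. u j) \<in> borel_measurable (PiM {..<m} (\<lambda>_. uniform01))"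
          using that by (intro measurable_compose[OF measurable_component_singleton]) auto
        show "(\<lambda>u. (u(m := y)) (Suc j)) \<in> borel_measurable (PiM {..<m} (\<lambda>_. uniform01))"
        proof (cases "Suc j = m")
          case False
          then have "Suc j \<in> {..<m}" using that by auto
          then show ?thesis using False by simp
        qed simp
      qed
      then have "{u\<in>space (PiM {..<m} (\<lambda>_. uniform01)). \<forall>j\<in>{..<m}. u j < (u(m := y)) (Suc j)} \<in> sets (PiM {..<m} (\<lambda>_. uniform01))"
        by (rule sets.sets_Collect_finite_All) simp_all
      then show "?A \<in> sets (PiM {..<m} (\<lambda>_. uniform01))" by (simp only: Ball_def lessThan_iff)
    qed
    also have "\<dots> \<le> ennreal (max 0 y ^ m / fact m)" by (rule emeasure_mark_chain_le)
    finally show "(\<integral>\<^sup>+u. indicator ?S (u(m := y)) \<partial>PiM {..<m} (\<lambda>_. uniform01)) \<le> ennreal (max 0 y ^ m / fact m)" .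
  qed
  also have "\<dots> \<le> (\<integral>\<^sup>+y. ennreal (1 / fact m) \<partial>uniform01)"
  proof -
    have "(\<integral>\<^sup>+y. ennreal (max 0 y ^ m / fact m) * indicator {0..1} y \<partial>lborel) \<le> (\<integral>\<^sup>+y. ennreal (1 / fact m) * indicator {0..1::real} y \<partial>lborel)"
    proof (intro nn_integral_mono)
      fix y :: real
      show "ennreal (max 0 y ^ m / fact m) * indicator {0..1} y \<le> ennreal (1 / fact m) * indicator {0..1} y"
      proof (cases "y \<in> {0..1}")
        case True
        then have "max 0 y ^ m \<le> 1" by (intro power_le_one) auto
        then have "max 0 y ^ m / fact m \<le> 1 / fact m" by (rule divide_right_mono) simp
        then show ?thesis by (intro mult_right_mono ennreal_leI) auto
      qed simp
    qed
    then show ?thesis by (simp only: nn_integral_uniform01 borel_measurable_const) (simp add: nn_integral_uniform01)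
  qed
  also have "\<dots> = ennreal (1 / fact m)" using prob_space.emeasure_space_1[OF prob_space_uniform01] by simp
  finally show ?thesis .
qed

context
  fixes Q :: "'v measure" and Z :: "nat \<Rightarrow> 'v \<Rightarrow> 'a::euclidean_space" and U :: "nat \<Rightarrow> 'v \<Rightarrow> real" and \<tau> :: real
  assumes mp: "marked_poisson_process Q \<tau> Z U" and \<tau>: "0 < \<tau>"
begin

text \<open>The chain from \<open>packed_trunc_differ_chain\<close> has strictly increasing marks, so its points are
  pairwise distinct and form an injective tuple to which the factorial moment measure applies.\<close>

lemma origin_trunc_differ_tuple:
  assumes "origin_packed_trunc Z U k \<omega> \<noteq> origin_packed_trunc Z U (Suc k) \<omega>"
  shows "\<exists>e\<in>inj_tuples (Suc k).
    (\<forall>j<Suc k. overlap (unit_radius TYPE('a)) (tuple_locations Z (Suc k) (\<omega>, e) j)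
        (((tuple_locations Z (Suc k) (\<omega>, e))(Suc k := 0)) (Suc j))) \<and>
    (\<forall>j<Suc k. tuple_marks U (Suc k) (\<omega>, e) j < tuple_marks U (Suc k) (\<omega>, e) (Suc j))"
proof -
  let ?r = "unit_radius TYPE('a)" and ?c = "points_with_origin Z \<omega>" and ?m = "Suc k"
  obtain s where s0: "s ?m = 0"
    and s: "\<And>j. j < ?m \<Longrightarrow> s j \<in> range Suc \<and> U (s j) \<omega> < U (s (Suc j)) \<omega> \<and> overlap ?r (?c (s j)) (?c (s (Suc j)))"
    using packed_trunc_differ_chain[OF assms[unfolded origin_packed_trunc_def[OF mp \<tau>]]]
    by (auto simp: less_Suc_eq_le)
  define e where "e = (\<lambda>j\<in>{..<?m}. s j - 1)"
  have Se: "Suc (e j) = s j" if "j < ?m" for j using s[OF that] that by (auto simp: e_def)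
  have incr: "U (s i) \<omega> < U (s j) \<omega>" if "i < j" "j < ?m" for i j
    using that
  proof (induction j)
    case (Suc j)
    have "U (s j) \<omega> < U (s (Suc j)) \<omega>" using s[of j] Suc.prems by auto
    then show ?case using Suc by (cases "i = j") auto
  qed simp
  have "inj_on e {..<?m}"
  proof (rule linorder_inj_onI)
    fix i j assume "i < j" "i \<in> {..<?m}" "j \<in> {..<?m}"
    then show "e i \<noteq> e j" using incr[of i j] Se[of i] Se[of j] by auto
  qed auto
  then have e: "e \<in> inj_tuples ?m" by (auto simp: inj_tuples_def e_def)
  have loc: "tuple_locations Z ?m (\<omega>, e) j = ?c (s j)" if "j < ?m" for j
    using that by (simp add: tuple_locations_def Se[symmetric])
  have loc': "((tuple_locations Z ?m (\<omega>, e))(?m := 0)) j = ?c (s j)" if "j \<le> ?m" for j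
    using that s0 by (cases "j = ?m") (auto simp: tuple_locations_def Se[symmetric])
  have mark: "tuple_marks U ?m (\<omega>, e) j = U (s j) \<omega>" if "j \<le> ?m" for j
    using that s0 Se[of j] by (cases "j = ?m") (auto simp: tuple_marks_def tuple_index_def)
  show ?thesis
  proof (intro bexI[OF _ e] conjI allI impI)
    fix j assume j: "j < ?m"
    then have "Suc j \<le> ?m" "j \<le> ?m" by auto
    then show "overlap ?r (tuple_locations Z ?m (\<omega>, e) j) (((tuple_locations Z ?m (\<omega>, e))(?m := 0)) (Suc j))"
      "tuple_marks U ?m (\<omega>, e) j < tuple_marks U ?m (\<omega>, e) (Suc j)"
      using s[OF j] loc[OF j] loc'[of "Suc j"] mark[of j] mark[of "Suc j"] by (simp_all only:)
  qed
qed

text \<open>First moment bound: the probability of disagreement is at most the expected number of chains,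
  which factorises into a bound for the locations and one for the marks.\<close>

lemma prob_origin_trunc_differ_le:
  "measure Q {\<omega>\<in>space Q. origin_packed_trunc Z U k \<omega> \<noteq> origin_packed_trunc Z U (Suc k) \<omega>}
    \<le> (\<tau> * measure lborel (ball (0::'a) (2 * unit_radius TYPE('a)))) ^ Suc k / fact (Suc k)"
proof -
  let ?r = "unit_radius TYPE('a)" and ?m = "Suc k"
  let ?v = "\<tau> * measure lborel (ball (0::'a) (2 * ?r))"
  have r: "0 < ?r" by (rule ball_radius_pos) simp
  note facts = marked_poisson_facts[OF mp \<tau>]
  interpret prob_space Q by (rule facts)
  let ?C = "count_space (inj_tuples ?m)"
  interpret C: sigma_finite_measure ?C by (rule sigma_finite_measure_count_space_countable) simp
  let ?N1 = "PiM {..<?m} (\<lambda>_. borel :: 'a measure)" and ?N2 = "PiM {..?m} (\<lambda>_. borel :: real measure)"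
  let ?L = "PiM {..<?m} (\<lambda>_. scaled_lborel \<tau> :: 'a measure)" and ?V = "PiM {..?m} (\<lambda>_. uniform01)"
  let ?A = "{z\<in>space ?L. \<forall>j<?m. overlap ?r (z j) ((z(?m := 0)) (Suc j))}"
  let ?B = "{u\<in>space ?V. \<forall>j<?m. u j < u (Suc j)}"
  let ?T = "\<lambda>p. (tuple_locations Z ?m p, tuple_marks U ?m p)"
  interpret V: prob_space ?V by (intro prob_space_PiM prob_space_uniform01)
  have setsL: "sets ?L = sets ?N1" by (intro sets_PiM_cong) auto
  have setsV: "sets ?V = sets ?N2" by (intro sets_PiM_cong) auto
  have A: "?A \<in> sets ?N1"
  proof -
    have "{z\<in>space ?N1. overlap ?r (z j) ((z(?m := 0)) (Suc j))} \<in> sets ?N1" if "j < ?m" for j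
    proof -
      have "Measurable.pred ?N1 (\<lambda>z. overlap ?r (z j) ((z(?m := 0)) (Suc j)))"
        using that by (cases "Suc j = ?m") (auto intro!: measurable_overlap[OF r] measurable_component_singleton)
      then show ?thesis by (simp add: pred_def)
    qed
    then have "{z\<in>space ?N1. \<forall>j\<in>{..<?m}. overlap ?r (z j) ((z(?m := 0)) (Suc j))} \<in> sets ?N1"
      by (intro sets.sets_Collect_finite_All) auto
    moreover have "?A = {z\<in>space ?N1. \<forall>j\<in>{..<?m}. overlap ?r (z j) ((z(?m := 0)) (Suc j))}"
      using sets_eq_imp_space_eq[OF setsL] by auto
    ultimately show ?thesis by simp
  qed
  have B: "?B \<in> sets ?N2"
  proof -
    have "{u\<in>space ?N2. u j < u (Suc j)} \<in> sets ?N2" if "j < ?m" for j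
      using that by (intro borel_measurable_less measurable_component_singleton) auto
    then have "{u\<in>space ?N2. \<forall>j\<in>{..<?m}. u j < u (Suc j)} \<in> sets ?N2"
      by (intro sets.sets_Collect_finite_All) auto
    moreover have "?B = {u\<in>space ?N2. \<forall>j\<in>{..<?m}. u j < u (Suc j)}"
      using sets_eq_imp_space_eq[OF setsV] by auto
    ultimately show ?thesis by simp
  qed
  have T[measurable]: "?T \<in> Q \<Otimes>\<^sub>M ?C \<rightarrow>\<^sub>M ?N1 \<Otimes>\<^sub>M ?N2"
    using measurable_tuple_locations[of Z, OF facts(3)] measurable_tuple_marks[of U, OF facts(4)]
    by (rule measurable_Pair)
  have AB: "?A \<times> ?B \<in> sets (?N1 \<Otimes>\<^sub>M ?N2)" using A B by (rule pair_measureI)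
  let ?W = "?T -` (?A \<times> ?B) \<inter> space (Q \<Otimes>\<^sub>M ?C)"
  have W: "?W \<in> sets (Q \<Otimes>\<^sub>M ?C)" using T AB by (rule measurable_sets)
  let ?D = "{\<omega>\<in>space Q. origin_packed_trunc Z U k \<omega> \<noteq> origin_packed_trunc Z U (Suc k) \<omega>}"
  note [measurable] = measurable_origin_packed_trunc[OF mp \<tau>]
  have D: "?D \<in> sets Q" by measurable
  have "emeasure Q ?D = (\<integral>\<^sup>+\<omega>. indicator ?D \<omega> \<partial>Q)" using D by simp
  also have "\<dots> \<le> (\<integral>\<^sup>+\<omega>. emeasure ?C (Pair \<omega> -` ?W) \<partial>Q)"
  proof (rule nn_integral_mono)
    fix \<omega> assume \<omega>: "\<omega> \<in> space Q"
    show "indicator ?D \<omega> \<le> emeasure ?C (Pair \<omega> -` ?W)"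
    proof (cases "\<omega> \<in> ?D")
      case True
      then obtain e where e: "e \<in> inj_tuples ?m"
        "\<forall>j<?m. overlap ?r (tuple_locations Z ?m (\<omega>, e) j) (((tuple_locations Z ?m (\<omega>, e))(?m := 0)) (Suc j))"
        "\<forall>j<?m. tuple_marks U ?m (\<omega>, e) j < tuple_marks U ?m (\<omega>, e) (Suc j)"
        using origin_trunc_differ_tuple[of k \<omega>] by blast
      have sp: "(\<omega>, e) \<in> space (Q \<Otimes>\<^sub>M ?C)" using \<omega> e by (simp add: space_pair_measure)
      have "tuple_locations Z ?m (\<omega>, e) \<in> space ?L" "tuple_marks U ?m (\<omega>, e) \<in> space ?V"
        by (auto simp: tuple_locations_def tuple_marks_def space_PiM)
      then have "(\<omega>, e) \<in> ?W" using e sp by simp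
      then have "{e} \<subseteq> Pair \<omega> -` ?W" by auto
      moreover have "Pair \<omega> -` ?W \<in> sets ?C" by (rule sets_Pair1[OF W])
      ultimately have "emeasure ?C {e} \<le> emeasure ?C (Pair \<omega> -` ?W)" by (rule emeasure_mono)
      moreover have "emeasure ?C {e} = 1" using e(1) by (simp add: emeasure_count_space_finite)
      moreover have "indicator ?D \<omega> = (1 :: ennreal)" using True by (rule indicator_simps(1))
      ultimately show ?thesis by (simp only:)
    qed simp
  qed
  also have "\<dots> = emeasure (Q \<Otimes>\<^sub>M ?C) ?W" by (rule C.emeasure_pair_measure_alt[OF W, symmetric])
  also have "\<dots> = emeasure (distr (Q \<Otimes>\<^sub>M ?C) (?N1 \<Otimes>\<^sub>M ?N2) ?T) (?A \<times> ?B)"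
    by (rule emeasure_distr[OF T AB, symmetric])
  also have "\<dots> = emeasure (?L \<Otimes>\<^sub>M ?V) (?A \<times> ?B)"
    unfolding marked_poisson_process_factorial_measure[OF mp less_imp_le[OF \<tau>]] ..
  also have "\<dots> = emeasure ?L ?A * emeasure ?V ?B"
    by (rule V.emeasure_pair_measure_Times) (simp_all only: setsL setsV A B)
  also have "\<dots> \<le> ennreal (?v ^ ?m) * ennreal (1 / fact ?m)"
    by (rule mult_mono[OF emeasure_location_chain_le[OF r less_imp_le[OF \<tau>]] emeasure_full_mark_chain_le]) simp_all
  also have "\<dots> = ennreal (?v ^ ?m / fact ?m)"
    using \<tau> by (subst ennreal_mult[symmetric]) auto
  finally show ?thesis using \<tau> by (simp add: emeasure_eq_measure)
qed

end

section \<open>The limit functional\<close>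

text \<open>An essential supremum is at most \<open>c\<close> iff a section of the superlevel set is null, and the
  measure of a section is a measurable function of the base point.\<close>

lemma borel_measurable_esssup:
  fixes F :: "'v \<Rightarrow> 'c \<Rightarrow> ereal"
  assumes N: "sigma_finite_measure N" and F[measurable]: "(\<lambda>(\<omega>, a). F \<omega> a) \<in> borel_measurable (M \<Otimes>\<^sub>M N)"
  shows "(\<lambda>\<omega>. esssup N (F \<omega>)) \<in> borel_measurable M"
proof (rule borel_measurableI_le)
  fix c :: ereal
  interpret N: sigma_finite_measure N by fact
  let ?S = "{p \<in> space (M \<Otimes>\<^sub>M N). c < (\<lambda>(\<omega>, a). F \<omega> a) p}"
  have S: "?S \<in> sets (M \<Otimes>\<^sub>M N)" by measurable
  have "esssup N (F \<omega>) \<le> c \<longleftrightarrow> emeasure N (Pair \<omega> -` ?S) = 0" if \<omega>: "\<omega> \<in> space M" for \<omega>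
  proof -
    have m: "F \<omega> \<in> borel_measurable N" using \<omega> measurable_compose[OF measurable_Pair1'[OF \<omega>] F] by simp
    have eq: "Pair \<omega> -` ?S = {a\<in>space N. \<not> F \<omega> a \<le> c}"
      using \<omega> by (auto simp: space_pair_measure)
    have "esssup N (F \<omega>) \<le> c \<longleftrightarrow> (AE a in N. F \<omega> a \<le> c)"
    proof
      assume "esssup N (F \<omega>) \<le> c"
      then show "AE a in N. F \<omega> a \<le> c"
        using esssup_AE[where M=N and f="F \<omega>"] by (auto elim!: eventually_mono intro: order_trans)
    qed (rule esssup_I[OF m])
    also have "\<dots> \<longleftrightarrow> emeasure N {a\<in>space N. \<not> F \<omega> a \<le> c} = 0"
      using m by (intro AE_iff_measurable) auto
    finally show ?thesis unfolding eq .
  qed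
  then have "{\<omega>\<in>space M. esssup N (F \<omega>) \<le> c} = {\<omega>\<in>space M. emeasure N (Pair \<omega> -` ?S) = 0}" by auto
  also have "\<dots> \<in> sets M"
    using N.measurable_emeasure_Pair[OF S] by measurable
  finally show "{\<omega>\<in>space M. esssup N (F \<omega>) \<le> c} \<in> sets M" .
qed

text \<open>Packing in a random set of points, here the range of a sequence over a random index set,
  reduced to countably many conditions on the labels. The first one says that the set of points is
  finite: from some label on, no new points appear.\<close>

lemma packed_image_iff:
  fixes q :: "nat \<Rightarrow> 'a::metric_space \<times> real"
  assumes "0 \<in> I"
  shows "packed r fst snd (q ` I) (q 0) \<longleftrightarrow>
    (\<exists>N. \<forall>l. l \<in> I \<longrightarrow> (\<exists>l'\<in>{..N}. l' \<in> I \<and> q l = q l')) \<and>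
    (\<exists>K. \<forall>k\<ge>K. packed_trunc k r (fst \<circ> q) (snd \<circ> q) I 0)"
proof -
  have "finite (q ` I) \<longleftrightarrow> (\<exists>N. \<forall>l. l \<in> I \<longrightarrow> (\<exists>l'\<in>{..N}. l' \<in> I \<and> q l = q l'))"
  proof
    assume "finite (q ` I)"
    then obtain J where J: "J \<subseteq> I" "finite J" "q ` I = q ` J" using finite_subset_image[of "q ` I" q I] by auto
    then obtain N where "J \<subseteq> {..N}" using finite_nat_iff_bounded_le by auto
    have "\<exists>l'\<in>{..N}. l' \<in> I \<and> q l = q l'" if "l \<in> I" for l
    proof -
      have "q l \<in> q ` J" using that J(3) by auto
      then show ?thesis using J(1) \<open>J \<subseteq> {..N}\<close> by auto
    qed
    then show "\<exists>N. \<forall>l. l \<in> I \<longrightarrow> (\<exists>l'\<in>{..N}. l' \<in> I \<and> q l = q l')" by auto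
  next
    assume "\<exists>N. \<forall>l. l \<in> I \<longrightarrow> (\<exists>l'\<in>{..N}. l' \<in> I \<and> q l = q l')"
    then obtain N where "\<forall>l. l \<in> I \<longrightarrow> (\<exists>l'\<in>{..N}. l' \<in> I \<and> q l = q l')" by auto
    then have "q ` I \<subseteq> q ` {..N}" by auto
    then show "finite (q ` I)" by (rule finite_subset) auto
  qed
  then show ?thesis
    using assms by (subst packed_iff_trunc) (auto simp: packed_trunc_relabel)
qed

lemma sigma_finite_outer_points:
  "sigma_finite_measure (outer_points m n :: (nat \<Rightarrow> 'a::euclidean_space \<times> real) measure)"
proof -
  have 1: "sigma_finite_measure (restrict_space lborel (- cball (0::'a) (real m)) \<Otimes>\<^sub>M uniform01)"
    by (intro sigma_finite_pair_measure sigma_finite_measure_restrict_space sigma_finite_lborel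
        prob_space_imp_sigma_finite prob_space_uniform01) auto
  then interpret product_sigma_finite "\<lambda>_::nat. restrict_space lborel (- cball (0::'a) (real m)) \<Otimes>\<^sub>M uniform01"
    by (simp add: product_sigma_finite_def)
  show ?thesis unfolding outer_points_def by (rule sigma_finite) simp
qed

lemma outer_points_component:
  assumes "i < n"
  shows "(\<lambda>a. fst (a i)) \<in> borel_measurable (outer_points m n :: (nat \<Rightarrow> 'a::euclidean_space \<times> real) measure)"
    and "(\<lambda>a. snd (a i)) \<in> borel_measurable (outer_points m n :: (nat \<Rightarrow> 'a::euclidean_space \<times> real) measure)"
    and "\<And>a. a \<in> space (outer_points m n :: (nat \<Rightarrow> 'a::euclidean_space \<times> real) measure) \<Longrightarrow> fst (a i) \<notin> cball 0 (real m)"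
proof -
  let ?C = "restrict_space lborel (- cball (0::'a) (real m))"
  have c: "(\<lambda>a. a i) \<in> outer_points m n \<rightarrow>\<^sub>M ?C \<Otimes>\<^sub>M uniform01"
    unfolding outer_points_def using assms by (intro measurable_component_singleton) auto
  have "(\<lambda>x. x) \<in> ?C \<rightarrow>\<^sub>M borel" by (intro measurable_restrict_space1) simp
  then have "fst \<in> ?C \<Otimes>\<^sub>M uniform01 \<rightarrow>\<^sub>M (borel :: 'a measure)"
    by (rule measurable_compose[OF measurable_fst])
  then show "(\<lambda>a. fst (a i)) \<in> borel_measurable (outer_points m n :: (nat \<Rightarrow> 'a \<times> real) measure)"
    by (rule measurable_compose[OF c])
  have "snd \<in> ?C \<Otimes>\<^sub>M uniform01 \<rightarrow>\<^sub>M borel" by simp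
  then show "(\<lambda>a. snd (a i)) \<in> borel_measurable (outer_points m n :: (nat \<Rightarrow> 'a \<times> real) measure)"
    by (rule measurable_compose[OF c])
  show "fst (a i) \<notin> cball 0 (real m)" if "a \<in> space (outer_points m n :: (nat \<Rightarrow> 'a \<times> real) measure)" for a
    using measurable_space[OF c that] by (auto simp: space_pair_measure space_restrict_space)
qed

context
  fixes Q :: "'v measure" and Z :: "nat \<Rightarrow> 'v \<Rightarrow> 'a::euclidean_space" and U :: "nat \<Rightarrow> 'v \<Rightarrow> real" and \<tau> :: real
  assumes mp: "marked_poisson_process Q \<tau> Z U" and \<tau>: "0 < \<tau>"
begin

abbreviation completed_points :: "nat \<Rightarrow> nat \<Rightarrow> 'v \<Rightarrow> (nat \<Rightarrow> 'a \<times> real) \<Rightarrow> ('a \<times> real) set" where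
  "completed_points m n \<omega> a \<equiv>
     insert (0, U 0 \<omega>) ((marked_points Z U \<omega> \<inter> cball 0 (real m) \<times> UNIV) \<union> a ` {..<n})"

text \<open>The completed point set is listed by one sequence \<open>q\<close>: the origin at label \<open>0\<close>, the \<open>n\<close> extra
  points at labels \<open>1\<close> to \<open>n\<close>, and the process after that, of which \<open>I\<close> keeps the points in the
  window.\<close>

lemma measurable_completed_xi:
  "(\<lambda>(\<omega>, a). ereal (xi (0, U 0 \<omega>) (completed_points m n \<omega> a))) \<in> borel_measurable (Q \<Otimes>\<^sub>M outer_points m n)"
proof -
  let ?r = "unit_radius TYPE('a)" and ?N = "Q \<Otimes>\<^sub>M outer_points m n"
  have r: "0 < ?r" by (rule ball_radius_pos) simp
  note facts = marked_poisson_facts[OF mp \<tau>]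
  define q where "q p l = (if l = 0 then (0, U 0 (fst p)) else if l \<le> n then snd p (l - 1)
      else (Z (l - n - 1) (fst p), U (l - n) (fst p)))" for p :: "'v \<times> (nat \<Rightarrow> 'a \<times> real)" and l
  define I where "I p = {l. l \<le> n \<or> Z (l - n - 1) (fst p) \<in> cball 0 (real m)}" for p :: "'v \<times> (nat \<Rightarrow> 'a \<times> real)"
  have q0: "q p 0 = (0, U 0 (fst p))" for p by (simp add: q_def)
  have I0: "0 \<in> I p" for p by (simp add: I_def)
  have image: "q p ` I p = completed_points m n (fst p) (snd p)" for p
  proof (intro subset_antisym subsetI)
    fix x assume "x \<in> q p ` I p"
    then obtain l where l: "l \<in> I p" "x = q p l" by auto
    show "x \<in> completed_points m n (fst p) (snd p)"
    proof (cases "l = 0 \<or> l \<le> n")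
      case True
      then show ?thesis using l by (cases l) (auto simp: q_def)
    next
      case False
      define i where "i = l - n - 1"
      have "l - n = Suc i" unfolding i_def using False by arith
      moreover have "l - n - 1 = i" by (simp add: i_def)
      ultimately show ?thesis using l False by (auto simp: q_def I_def marked_points_def simp del: diff_diff_left)
    qed
  next
    fix x assume "x \<in> completed_points m n (fst p) (snd p)"
    then consider "x = (0, U 0 (fst p))" | i where "x = (Z i (fst p), U (Suc i) (fst p))" "Z i (fst p) \<in> cball 0 (real m)"
      | i where "i < n" "x = snd p i" by (auto simp: marked_points_def)
    then show "x \<in> q p ` I p"
    proof cases
      case 1
      then show ?thesis using I0 q0 by (metis imageI)
    next
      case (2 i)
      then have "x = q p (n + 1 + i)" "n + 1 + i \<in> I p" by (auto simp: q_def I_def)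
      then show ?thesis by blast
    next
      case (3 i)
      then have "x = q p (Suc i)" "Suc i \<in> I p" by (auto simp: q_def I_def)
      then show ?thesis by blast
    qed
  qed
  have Zm[measurable]: "(\<lambda>p. Z i (fst p)) \<in> borel_measurable ?N" and [measurable]: "(\<lambda>p. U i (fst p)) \<in> borel_measurable ?N" for i
    using measurable_compose[OF measurable_fst facts(3)] measurable_compose[OF measurable_fst facts(4)] by auto
  have fstq: "(\<lambda>p. fst (q p l)) \<in> borel_measurable ?N" for l
  proof -
    consider "l = 0" | "0 < l" "l \<le> n" | "n < l" by linarith
    then show ?thesis
    proof cases
      case 2
      then have "(\<lambda>p. fst (snd p (l - 1))) \<in> borel_measurable ?N"
        by (intro measurable_compose[OF measurable_snd outer_points_component(1)]) auto
      then show ?thesis using 2 by (simp add: q_def)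
    qed (simp_all add: q_def)
  qed
  have sndq: "(\<lambda>p. snd (q p l)) \<in> borel_measurable ?N" for l
  proof -
    consider "l = 0" | "0 < l" "l \<le> n" | "n < l" by linarith
    then show ?thesis
    proof cases
      case 2
      then have "(\<lambda>p. snd (snd p (l - 1))) \<in> borel_measurable ?N"
        by (intro measurable_compose[OF measurable_snd outer_points_component(2)]) auto
      then show ?thesis using 2 by (simp add: q_def)
    qed (simp_all add: q_def)
  qed
  have [measurable]: "Measurable.pred ?N (\<lambda>p. l \<in> I p)" for l
  proof -
    have "Measurable.pred ?N (\<lambda>p. Z i (fst p) \<in> cball 0 (real m))" for i
      by (rule pred_sets2[OF _ Zm]) simp
    then have "Measurable.pred ?N (\<lambda>p. l \<le> n \<or> Z (l - n - 1) (fst p) \<in> cball 0 (real m))"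
      by (intro pred_intros_logic) auto
    then show ?thesis by (simp add: I_def)
  qed
  have [measurable]: "Measurable.pred ?N (\<lambda>p. packed_trunc k ?r (fst \<circ> q p) (snd \<circ> q p) (I p) 0)" for k
    using fstq sndq
    by (intro measurable_packed_trunc[where J=UNIV]) (auto intro!: measurable_overlap[OF r] borel_measurable_less simp: pred_def[symmetric])
  have [measurable]: "Measurable.pred ?N (\<lambda>p. q p l = q p l')" for l l'
  proof -
    note [measurable] = fstq sndq
    have "(\<lambda>p. q p l = q p l') = (\<lambda>p. dist (fst (q p l)) (fst (q p l')) = 0 \<and> snd (q p l) = snd (q p l'))"
      by (auto simp: fun_eq_iff prod_eq_iff)
    then show ?thesis by simp
  qed
  have "packed ?r fst snd (completed_points m n (fst p) (snd p)) (0, U 0 (fst p)) \<longleftrightarrow>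
      (\<exists>N. \<forall>l. l \<in> I p \<longrightarrow> (\<exists>l'\<in>{..N}. l' \<in> I p \<and> q p l = q p l')) \<and>
      (\<exists>K. \<forall>k\<ge>K. packed_trunc k ?r (fst \<circ> q p) (snd \<circ> q p) (I p) 0)" for p
    using packed_image_iff[OF I0, of ?r "q p" p] by (simp only: image q0)
  then have [measurable]: "Measurable.pred ?N (\<lambda>p. packed ?r fst snd (completed_points m n (fst p) (snd p)) (0, U 0 (fst p)))"
    by (simp only:) measurable
  have "(\<lambda>(\<omega>, a). ereal (xi (0, U 0 \<omega>) (completed_points m n \<omega> a)))
    = (\<lambda>p. ereal (of_bool (packed ?r fst snd (completed_points m n (fst p) (snd p)) (0, U 0 (fst p)))))"
    by (auto simp: xi_def fun_eq_iff)
  then show ?thesis by simp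
qed

lemma measurable_xi_infinity:
  "(\<lambda>\<omega>. xi_infinity (U 0 \<omega>) (marked_points Z U \<omega>)) \<in> borel_measurable Q"
proof -
  have [measurable]: "(\<lambda>\<omega>. xi_bar (U 0 \<omega>) (marked_points Z U \<omega>) m) \<in> borel_measurable Q" for m
    unfolding xi_bar_def
    by (intro borel_measurable_SUP borel_measurable_esssup sigma_finite_outer_points measurable_completed_xi) auto
  show ?thesis unfolding xi_infinity_def by measurable
qed

text \<open>The extra points lie outside the window, so they are beyond the range of the truncated rule,
  which therefore gives the same answer as in the full process. Its odd and even depths bound the
  untruncated rule whatever the extra points are.\<close>

lemma completed_packed_sandwich:
  fixes \<omega> a
  assumes \<omega>: "finite {i. Z i \<omega> \<in> cball 0 (real m)}" and m: "unit_range TYPE('a) k \<le> real m"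
    and a: "\<And>i. i < n \<Longrightarrow> fst (a i) \<notin> cball 0 (real m)"
  shows "even k \<Longrightarrow> packed (unit_radius TYPE('a)) fst snd (completed_points m n \<omega> a) (0, U 0 \<omega>) \<Longrightarrow> origin_packed_trunc Z U k \<omega>"
    and "odd k \<Longrightarrow> origin_packed_trunc Z U k \<omega> \<Longrightarrow> packed (unit_radius TYPE('a)) fst snd (completed_points m n \<omega> a) (0, U 0 \<omega>)"
proof -
  let ?r = "unit_radius TYPE('a)" and ?S = "completed_points m n \<omega> a" and ?p = "(0 :: 'a, U 0 \<omega>)"
  have r: "0 < ?r" by (rule ball_radius_pos) simp
  have "marked_points Z U \<omega> \<inter> cball 0 (real m) \<times> UNIV = (\<lambda>i. (Z i \<omega>, U (Suc i) \<omega>)) ` {i. Z i \<omega> \<in> cball 0 (real m)}"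
    by (auto simp: marked_points_def)
  then have fin: "finite ?S" using \<omega> by simp
  let ?J = "marked_points Z U \<omega> \<inter> ball 0 (unit_range TYPE('a) k) \<times> UNIV"
  have "packed_trunc k ?r fst snd ?S ?p = packed_trunc k ?r fst snd ?J ?p"
  proof (rule packed_trunc_local)
    show "?J \<subseteq> ?S" using m by auto
    fix j assume "j \<in> ?S" "snd j < snd ?p" "dist (fst j) (fst ?p) < 2 * ?r * real k"
    moreover have "\<not> norm (fst (a i)) < unit_range TYPE('a) k" if "i < n" for i
      using a[OF that] m by (simp add: dist_norm)
    ultimately show "j \<in> ?J" by (auto simp: dist_norm)
  qed (use r in simp)
  also have "\<dots> = packed_trunc k ?r fst snd (marked_points Z U \<omega>) ?p"
    by (rule packed_trunc_local[symmetric]) (use r in \<open>auto simp: dist_norm\<close>)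
  also have "\<dots> = origin_packed_trunc Z U k \<omega>"
  proof -
    let ?q = "\<lambda>j. (points_with_origin Z \<omega> j, U j \<omega>)"
    have "marked_points Z U \<omega> = ?q ` range Suc" "?p = ?q 0" by (auto simp: marked_points_def image_iff)
    then have "packed_trunc k ?r fst snd (marked_points Z U \<omega>) ?p = packed_trunc k ?r fst snd (?q ` range Suc) (?q 0)"
      by (simp only:)
    also have "\<dots> = packed_trunc k ?r (fst \<circ> ?q) (snd \<circ> ?q) (range Suc) 0" by (rule packed_trunc_relabel)
    finally show ?thesis by (simp add: origin_packed_trunc_def[OF mp \<tau>] comp_def)
  qed
  finally have eq: "packed_trunc k ?r fst snd ?S ?p = origin_packed_trunc Z U k \<omega>" .
  show "even k \<Longrightarrow> packed ?r fst snd ?S ?p \<Longrightarrow> origin_packed_trunc Z U k \<omega>"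
    and "odd k \<Longrightarrow> origin_packed_trunc Z U k \<omega> \<Longrightarrow> packed ?r fst snd ?S ?p"
    using packed_trunc_sandwich[OF fin, of k ?r fst snd] eq by auto
qed

text \<open>The bounds of \<open>completed_packed_sandwich\<close> are uniform in the extra points once the window
  exceeds the range of interaction, so they survive the essential supremum, the supremum over \<open>n\<close> and
  the upper limit in \<open>m\<close>.\<close>

lemma xi_infinity_sandwich:
  assumes \<omega>: "\<omega> \<in> space Q" and fin: "\<And>m::nat. finite {i. Z i \<omega> \<in> cball 0 (real m)}"
  shows "even k \<Longrightarrow> xi_infinity (U 0 \<omega>) (marked_points Z U \<omega>) \<le> of_bool (origin_packed_trunc Z U k \<omega>)"
    and "odd k \<Longrightarrow> of_bool (origin_packed_trunc Z U k \<omega>) \<le> xi_infinity (U 0 \<omega>) (marked_points Z U \<omega>)"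
proof -
  let ?f = "\<lambda>m n a. ereal (xi (0, U 0 \<omega>) (completed_points m n \<omega> a))"
  let ?b = "\<lambda>m. xi_bar (U 0 \<omega>) (marked_points Z U \<omega>) m"
  have meas: "?f m n \<in> borel_measurable (outer_points m n)" for m n
    using measurable_compose[OF measurable_Pair1'[OF \<omega>] measurable_completed_xi[of m n]] by simp
  have upper: "?b m \<le> ereal c" if "\<And>n a. a \<in> space (outer_points m n) \<Longrightarrow> xi (0, U 0 \<omega>) (completed_points m n \<omega> a) \<le> c" for m c
    unfolding xi_bar_def
  proof (rule SUP_least)
    fix n show "esssup (outer_points m n) (?f m n) \<le> ereal c"
      using that by (intro esssup_I[OF meas] AE_I2) auto
  qed
  \<comment> \<open>For \<open>n = 0\<close> there are no extra points and the essential supremum is over a one-point space,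
    so it is attained; this gives a lower bound for the supremum.\<close>
  have lower: "ereal (xi (0, U 0 \<omega>) (completed_points m 0 \<omega> a)) \<le> ?b m" for m a
  proof -
    have "ereal (xi (0, U 0 \<omega>) (completed_points m 0 \<omega> a)) = esssup (outer_points m 0) (?f m 0)"
    proof -
      have "emeasure (outer_points m 0 :: (nat \<Rightarrow> 'a \<times> real) measure) (space (outer_points m 0)) = 1"
        by (simp add: outer_points_def PiM_empty)
      then show ?thesis
        using esssup_const[of "outer_points m 0 :: (nat \<Rightarrow> 'a \<times> real) measure" "ereal (xi (0, U 0 \<omega>) (completed_points m 0 \<omega> a))"] by simp
    qed
    also have "\<dots> \<le> ?b m" unfolding xi_bar_def by (rule SUP_upper) simp
    finally show ?thesis .
  qed
  have b01: "0 \<le> ?b m" "?b m \<le> 1" for m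
  proof -
    have "ereal 0 \<le> ereal (xi (0, U 0 \<omega>) (completed_points m 0 \<omega> (\<lambda>_. (0, 0))))" by (simp add: xi_def)
    also have "\<dots> \<le> ?b m" by (rule lower)
    finally show "0 \<le> ?b m" by (simp add: zero_ereal_def)
    show "?b m \<le> 1" using upper[of m 1] by (simp add: xi_def one_ereal_def)
  qed
  have lim01: "0 \<le> limsup ?b" "limsup ?b \<le> 1"
    using b01 by (auto intro!: le_Limsup Limsup_bounded)
  \<comment> \<open>\<open>xi_infinity\<close> converts an extended real, so finiteness must be known.\<close>
  obtain l where l: "limsup ?b = ereal l" using lim01 by (cases "limsup ?b") auto
  obtain M :: nat where M: "unit_range TYPE('a) k \<le> real M" using real_arch_simple by blast
  show "xi_infinity (U 0 \<omega>) (marked_points Z U \<omega>) \<le> of_bool (origin_packed_trunc Z U k \<omega>)" if "even k"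
  proof -
    have "\<forall>\<^sub>F m in sequentially. ?b m \<le> ereal (of_bool (origin_packed_trunc Z U k \<omega>))"
    proof (rule eventually_sequentiallyI)
      fix m assume "M \<le> m"
      then have m: "unit_range TYPE('a) k \<le> real m" using M by simp
      show "?b m \<le> ereal (of_bool (origin_packed_trunc Z U k \<omega>))"
      proof (rule upper)
        fix n a assume a: "a \<in> space (outer_points m n :: (nat \<Rightarrow> 'a \<times> real) measure)"
        show "xi (0, U 0 \<omega>) (completed_points m n \<omega> a) \<le> of_bool (origin_packed_trunc Z U k \<omega>)"
          using completed_packed_sandwich(1)[where n=n and a=a, OF fin m outer_points_component(3)[OF _ a] \<open>even k\<close>]
          by (auto simp: xi_def)
      qed
    qed
    then have "limsup ?b \<le> ereal (of_bool (origin_packed_trunc Z U k \<omega>))" by (rule Limsup_bounded)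
    then show ?thesis by (simp add: xi_infinity_def l)
  qed
  show "of_bool (origin_packed_trunc Z U k \<omega>) \<le> xi_infinity (U 0 \<omega>) (marked_points Z U \<omega>)" if "odd k"
  proof -
    have "\<forall>\<^sub>F m in sequentially. ereal (of_bool (origin_packed_trunc Z U k \<omega>)) \<le> ?b m"
    proof (rule eventually_sequentiallyI)
      fix m assume "M \<le> m"
      then have m: "unit_range TYPE('a) k \<le> real m" using M by simp
      have "of_bool (origin_packed_trunc Z U k \<omega>) \<le> xi (0, U 0 \<omega>) (completed_points m 0 \<omega> (\<lambda>_. (0, 0)))"
        using completed_packed_sandwich(2)[where n=0 and a="\<lambda>_. (0, 0)", OF fin m _ \<open>odd k\<close>]
        by (auto simp: xi_def)
      then show "ereal (of_bool (origin_packed_trunc Z U k \<omega>)) \<le> ?b m"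
        using lower[of m "\<lambda>_. (0, 0)"] by (meson ereal_less_eq(3) order_trans)
    qed
    then have "ereal (of_bool (origin_packed_trunc Z U k \<omega>)) \<le> limsup ?b" by (intro le_Limsup) auto
    then show ?thesis by (simp add: xi_infinity_def l)
  qed
qed

proposition expectation_xi_infinity:
  shows "integrable Q (\<lambda>\<omega>. xi_infinity (U 0 \<omega>) (marked_points Z U \<omega>))"
    and "even k \<Longrightarrow> (\<integral>\<omega>. xi_infinity (U 0 \<omega>) (marked_points Z U \<omega>) \<partial>Q) \<le> poisson_packed_prob TYPE('a) k \<tau>"
    and "odd k \<Longrightarrow> poisson_packed_prob TYPE('a) k \<tau> \<le> (\<integral>\<omega>. xi_infinity (U 0 \<omega>) (marked_points Z U \<omega>) \<partial>Q)"
proof -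
  interpret prob_space Q by (rule marked_poisson_facts[OF mp \<tau>])
  let ?x = "\<lambda>\<omega>. xi_infinity (U 0 \<omega>) (marked_points Z U \<omega>)"
  note [measurable] = measurable_xi_infinity measurable_origin_packed_trunc[OF mp \<tau>]
  have fin: "AE \<omega> in Q. \<forall>m::nat. finite {i. Z i \<omega> \<in> cball 0 (real m)}"
    unfolding AE_all_countable
    by (intro allI poisson_process_AE_finite[OF marked_poisson_facts(1)[OF mp \<tau>]]) auto
  have up: "AE \<omega> in Q. ?x \<omega> \<le> of_bool (origin_packed_trunc Z U k \<omega>)" if "even k" for k
    using fin AE_space by eventually_elim (rule xi_infinity_sandwich(1)[OF _ _ that], auto)
  have low: "AE \<omega> in Q. of_bool (origin_packed_trunc Z U k \<omega>) \<le> ?x \<omega>" if "odd k" for k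
    using fin AE_space by eventually_elim (rule xi_infinity_sandwich(2)[OF _ _ that], auto)
  have intt: "integrable Q (\<lambda>\<omega>. of_bool (origin_packed_trunc Z U k \<omega>) :: real)" for k
    by (rule integrable_const_bound[where B=1]) auto
  show int: "integrable Q ?x"
  proof (rule integrable_const_bound[where B=1])
    show "AE \<omega> in Q. norm (?x \<omega>) \<le> 1"
    proof -
      have "AE \<omega> in Q. ?x \<omega> \<le> of_bool (origin_packed_trunc Z U 0 \<omega>)"
        "AE \<omega> in Q. of_bool (origin_packed_trunc Z U 1 \<omega>) \<le> ?x \<omega>"
        by (rule up, simp, rule low, simp)
      then show ?thesis by eventually_elim (auto simp: of_bool_def split: if_splits)
    qed
  qed measurable
  show "(\<integral>\<omega>. ?x \<omega> \<partial>Q) \<le> poisson_packed_prob TYPE('a) k \<tau>" if "even k"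
    unfolding expectation_origin_packed_trunc[OF mp \<tau>, symmetric]
    by (intro integral_mono_AE int intt up that)
  show "poisson_packed_prob TYPE('a) k \<tau> \<le> (\<integral>\<omega>. ?x \<omega> \<partial>Q)" if "odd k"
    unfolding expectation_origin_packed_trunc[OF mp \<tau>, symmetric]
    by (intro integral_mono_AE int intt low that)
qed

text \<open>Not visible from the power series, whose terms have varying signs; it holds because the sum is
  a probability.\<close>

lemma poisson_packed_prob_bounds: "0 \<le> poisson_packed_prob TYPE('a) k \<tau>" "poisson_packed_prob TYPE('a) k \<tau> \<le> 1"
proof -
  interpret prob_space Q by (rule marked_poisson_facts[OF mp \<tau>])
  note [measurable] = measurable_origin_packed_trunc[OF mp \<tau>]
  have "(\<integral>\<omega>. of_bool (origin_packed_trunc Z U k \<omega>) \<partial>Q :: real) = prob {\<omega>\<in>space Q. origin_packed_trunc Z U k \<omega>}"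
  proof -
    have "(\<integral>\<omega>. of_bool (origin_packed_trunc Z U k \<omega>) \<partial>Q :: real) = (\<integral>\<omega>. indicator {\<omega>\<in>space Q. origin_packed_trunc Z U k \<omega>} \<omega> \<partial>Q)"
      by (intro Bochner_Integration.integral_cong) (auto simp: indicator_def)
    then show ?thesis by simp
  qed
  then show "0 \<le> poisson_packed_prob TYPE('a) k \<tau>" "poisson_packed_prob TYPE('a) k \<tau> \<le> 1"
    unfolding expectation_origin_packed_trunc[OF mp \<tau>, symmetric] by simp_all
qed

lemma poisson_packed_prob_differ:
  "\<bar>poisson_packed_prob TYPE('a) k \<tau> - poisson_packed_prob TYPE('a) (Suc k) \<tau>\<bar>
    \<le> (\<tau> * measure lborel (ball (0::'a) (2 * unit_radius TYPE('a)))) ^ Suc k / fact (Suc k)"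
proof -
  interpret prob_space Q by (rule marked_poisson_facts[OF mp \<tau>])
  note [measurable] = measurable_origin_packed_trunc[OF mp \<tau>]
  let ?D = "{\<omega>\<in>space Q. origin_packed_trunc Z U k \<omega> \<noteq> origin_packed_trunc Z U (Suc k) \<omega>}"
  have intt: "integrable Q (\<lambda>\<omega>. of_bool (origin_packed_trunc Z U k \<omega>) :: real)" for k
    by (rule integrable_const_bound[where B=1]) auto
  have "\<bar>poisson_packed_prob TYPE('a) k \<tau> - poisson_packed_prob TYPE('a) (Suc k) \<tau>\<bar>
    = \<bar>\<integral>\<omega>. of_bool (origin_packed_trunc Z U k \<omega>) - of_bool (origin_packed_trunc Z U (Suc k) \<omega>) \<partial>Q\<bar>"
    unfolding expectation_origin_packed_trunc[OF mp \<tau>, symmetric] using intt by simp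
  also have "\<dots> \<le> (\<integral>\<omega>. \<bar>of_bool (origin_packed_trunc Z U k \<omega>) - of_bool (origin_packed_trunc Z U (Suc k) \<omega>)\<bar> \<partial>Q)"
    by (rule integral_abs_bound)
  also have "\<dots> = (\<integral>\<omega>. indicator ?D \<omega> \<partial>Q)"
    by (intro Bochner_Integration.integral_cong) (auto simp: indicator_def)
  also have "\<dots> = prob ?D" by simp
  finally show ?thesis using prob_origin_trunc_differ_le[OF mp \<tau>, of k] by linarith
qed

text \<open>The limit is enclosed by consecutive depths, whose distance is a term of an exponential
  series.\<close>

proposition poisson_packed_prob_tendsto:
  "(\<lambda>k. poisson_packed_prob TYPE('a) k \<tau>) \<longlonglongrightarrow> (\<integral>\<omega>. xi_infinity (U 0 \<omega>) (marked_points Z U \<omega>) \<partial>Q)"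
proof -
  let ?p = "\<lambda>k. poisson_packed_prob TYPE('a) k \<tau>" and ?g = "\<integral>\<omega>. xi_infinity (U 0 \<omega>) (marked_points Z U \<omega>) \<partial>Q"
  let ?v = "\<tau> * measure lborel (ball (0::'a) (2 * unit_radius TYPE('a)))"
  have close: "norm (?p k - ?g) \<le> norm (?v ^ Suc k /\<^sub>R fact (Suc k))" for k
  proof -
    note e = expectation_xi_infinity(2,3)
    have "\<bar>?p k - ?g\<bar> \<le> \<bar>?p k - ?p (Suc k)\<bar>"
    proof (cases "even k")
      case True
      then show ?thesis using e(1)[of k] e(2)[of "Suc k"] by auto
    next
      case False
      then show ?thesis using e(1)[of "Suc k"] e(2)[of k] by auto
    qed
    also have "\<dots> \<le> norm (?v ^ Suc k /\<^sub>R fact (Suc k))"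
      using poisson_packed_prob_differ[of k] by (simp add: divide_inverse mult.commute del: fact_Suc)
    finally show ?thesis by simp
  qed
  have "(\<lambda>k. ?v ^ Suc k /\<^sub>R fact (Suc k)) \<longlonglongrightarrow> 0"
    by (rule LIMSEQ_Suc[OF summable_LIMSEQ_zero[OF summable_exp_generic]])
  then have "(\<lambda>k. ?p k - ?g) \<longlonglongrightarrow> 0"
    by (rule Lim_null_comparison[OF always_eventually[OF allI[OF close]] tendsto_norm_zero])
  then show ?thesis by (simp add: LIM_zero_iff)
qed

end

section \<open>Continuity of translation in the mean\<close>

lemma integrable_lborel_translate:
  fixes f :: "'a::euclidean_space \<Rightarrow> real"
  assumes "integrable lborel f"
  shows "integrable lborel (\<lambda>x. f (h + x))" and "(\<integral>x. f (h + x) \<partial>lborel) = (\<integral>x. f x \<partial>lborel)"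
proof -
  have d: "distr lborel lborel ((+) h) = (lborel :: 'a measure)"
    using lborel_distr_plus[of h] by (simp cong: distr_cong)
  have m: "(+) h \<in> lborel \<rightarrow>\<^sub>M (lborel :: 'a measure)" by simp
  show "integrable lborel (\<lambda>x. f (h + x))"
    using integrable_distr[OF m, of f] assms by (simp add: d)
  show "(\<integral>x. f (h + x) \<partial>lborel) = (\<integral>x. f x \<partial>lborel)"
    using integral_distr[OF m, of f] assms by (simp add: d)
qed

abbreviation translation_gap :: "('a::euclidean_space \<Rightarrow> real) \<Rightarrow> 'a \<Rightarrow> real" where
  "translation_gap f h \<equiv> \<integral>x. \<bar>f (h + x) - f x\<bar> \<partial>lborel"

lemma translation_gap_triangle:
  assumes f: "integrable lborel f" and g: "integrable lborel g"
  shows "translation_gap f h \<le> translation_gap g h + 2 * (\<integral>x. \<bar>f x - g x\<bar> \<partial>lborel)"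
proof -
  note tf = integrable_lborel_translate[OF f] and tg = integrable_lborel_translate[OF g]
  have d: "integrable lborel (\<lambda>x. \<bar>f x - g x\<bar>)" using f g by simp
  note td = integrable_lborel_translate[OF d]
  have "translation_gap f h \<le> (\<integral>x. \<bar>g (h + x) - g x\<bar> + (\<bar>f (h + x) - g (h + x)\<bar> + \<bar>f x - g x\<bar>) \<partial>lborel)"
    using f g tf tg d td by (intro integral_mono) auto
  also have "\<dots> = translation_gap g h + ((\<integral>x. \<bar>f (h + x) - g (h + x)\<bar> \<partial>lborel) + (\<integral>x. \<bar>f x - g x\<bar> \<partial>lborel))"
    using g tg d td(1)[of h] by (subst Bochner_Integration.integral_add; simp)+
  finally show ?thesis using td(2)[of h] by simp
qed

text \<open>The gap is stable under approximation in the mean, uniformly in the translation.\<close>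

lemma translation_gap_approx:
  assumes f: "integrable lborel f"
    and approx: "\<And>e. 0 < e \<Longrightarrow> \<exists>g. integrable lborel g \<and> (\<integral>x. \<bar>f x - g x\<bar> \<partial>lborel) \<le> e \<and>
        (\<lambda>n. translation_gap g (h n)) \<longlonglongrightarrow> 0"
  shows "(\<lambda>n. translation_gap f (h n)) \<longlonglongrightarrow> 0"
proof (rule LIMSEQ_I)
  fix e :: real assume e: "0 < e"
  obtain g where g: "integrable lborel g" "(\<integral>x. \<bar>f x - g x\<bar> \<partial>lborel) \<le> e / 4"
      "(\<lambda>n. translation_gap g (h n)) \<longlonglongrightarrow> 0"
    using approx[of "e / 4"] e by auto
  obtain N where N: "\<And>n. n \<ge> N \<Longrightarrow> norm (translation_gap g (h n) - 0) < e / 2"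
    using LIMSEQ_D[OF g(3), of "e / 2"] e by auto
  have "norm (translation_gap f (h n) - 0) < e" if "n \<ge> N" for n
  proof -
    have "0 \<le> translation_gap f (h n)" by simp
    then show ?thesis
      using N[OF that] translation_gap_triangle[OF f g(1), of "h n"] g(2) by simp
  qed
  then show "\<exists>N. \<forall>n\<ge>N. norm (translation_gap f (h n) - 0) < e" by blast
qed

text \<open>A point of an open set stays inside under small translations, so the part of \<open>V\<close> lost by
  translating vanishes by dominated convergence. Translation preserves measure, so the part gained
  has the same size as the part lost.\<close>

lemma translation_gap_open:
  fixes V :: "'a::euclidean_space set"
  assumes "open V" "emeasure lborel V < \<infinity>" and h: "h \<longlonglongrightarrow> 0"
  shows "(\<lambda>n. translation_gap (indicat_real V) (h n)) \<longlonglongrightarrow> 0"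
proof -
  have V[measurable]: "V \<in> sets borel" using assms(1) by simp
  let ?f = "indicat_real V"
  have f: "integrable lborel ?f" using assms by (intro integrable_real_indicator) auto
  note tf = integrable_lborel_translate[OF f]
  have gap: "translation_gap ?f k = 2 * (\<integral>x. max 0 (?f x - ?f (k + x)) \<partial>lborel)" for k
  proof -
    have "translation_gap ?f k = (\<integral>x. (?f (k + x) - ?f x) + 2 * max 0 (?f x - ?f (k + x)) \<partial>lborel)"
      by (intro Bochner_Integration.integral_cong) (auto simp: indicator_def)
    also have "\<dots> = (\<integral>x. ?f (k + x) - ?f x \<partial>lborel) + (\<integral>x. 2 * max 0 (?f x - ?f (k + x)) \<partial>lborel)"
      using f tf by (intro Bochner_Integration.integral_add) auto
    also have "(\<integral>x. ?f (k + x) - ?f x \<partial>lborel) = 0"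
      using f tf by (subst Bochner_Integration.integral_diff) auto
    finally show ?thesis by simp
  qed
  have "(\<lambda>n. \<integral>x. max 0 (?f x - ?f (h n + x)) \<partial>lborel) \<longlonglongrightarrow> (\<integral>x. 0 \<partial>(lborel :: 'a measure))"
  proof (rule integral_dominated_convergence[where w="?f"])
    show "AE x in lborel. (\<lambda>n. max 0 (?f x - ?f (h n + x))) \<longlonglongrightarrow> 0"
    proof (rule AE_I2)
      fix x :: 'a
      show "(\<lambda>n. max 0 (?f x - ?f (h n + x))) \<longlonglongrightarrow> 0"
      proof (cases "x \<in> V")
        case True
        have "(\<lambda>n. h n + x) \<longlonglongrightarrow> x" using tendsto_add[OF h tendsto_const[of x]] by simp
        then have "\<forall>\<^sub>F n in sequentially. h n + x \<in> V" using topological_tendstoD[OF _ assms(1) True] by blast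
        then have "\<forall>\<^sub>F n in sequentially. max 0 (?f x - ?f (h n + x)) = 0"
          by eventually_elim (auto simp: True)
        then show ?thesis by (rule tendsto_eventually)
      next
        case False
        then have "max 0 (?f x - ?f (h n + x)) = 0" for n by (auto simp: indicator_def)
        then show ?thesis by simp
      qed
    qed
  qed (use f in \<open>auto simp: indicator_def\<close>)
  then show ?thesis unfolding gap using tendsto_mult_left[of _ 0 sequentially 2] by simp
qed

text \<open>Indicators of measurable sets are approximated by those of open sets, by outer regularity;
  linearity and limits extend this to integrable functions.\<close>

proposition translation_gap_tendsto_0:
  fixes f :: "'a::euclidean_space \<Rightarrow> real"
  assumes "integrable lborel f" and h: "h \<longlonglongrightarrow> 0"
  shows "(\<lambda>n. translation_gap f (h n)) \<longlonglongrightarrow> 0"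
  using assms(1)
proof (induction rule: integrable_induct)
  case (base A c)
  then have A: "A \<in> sets borel" "emeasure lborel A < \<infinity>" by auto
  have intA: "integrable lborel (indicat_real A)" using A by (intro integrable_real_indicator) auto
  have "(\<lambda>n. translation_gap (indicat_real A) (h n)) \<longlonglongrightarrow> 0"
  proof (rule translation_gap_approx[OF intA])
    fix e :: real assume e: "0 < e"
    obtain V where V: "open V" "A \<subseteq> V" "emeasure lborel (V - A) < ennreal e"
      using outer_regular_lborel[OF A(1) e] by blast
    have mV: "V \<in> sets borel" using V by simp
    have "emeasure lborel V = emeasure lborel A + emeasure lborel (V - A)"
      using A V mV by (subst plus_emeasure) (auto simp: Un_absorb1)
    then have fin: "emeasure lborel V < \<infinity>"
      using A V(3) by (auto simp: less_top[symmetric] intro: order.strict_trans)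
    have "(\<integral>x. \<bar>indicat_real A x - indicat_real V x\<bar> \<partial>lborel) = (\<integral>x. indicat_real (V - A) x \<partial>lborel)"
      using V(2) by (intro Bochner_Integration.integral_cong) (auto simp: indicator_def)
    also have "\<dots> = measure lborel (V - A)" by simp
    also have "\<dots> \<le> e" using V(3) e by (simp add: measure_def enn2real_leI)
    finally show "\<exists>g. integrable lborel g \<and> (\<integral>x. \<bar>indicat_real A x - g x\<bar> \<partial>lborel) \<le> e \<and>
        (\<lambda>n. translation_gap g (h n)) \<longlonglongrightarrow> 0"
      using translation_gap_open[OF V(1) fin h] fin mV
      by (intro exI[of _ "indicat_real V"]) (auto intro!: integrable_real_indicator)
  qed
  then have "(\<lambda>n. \<bar>c\<bar> * translation_gap (indicat_real A) (h n)) \<longlonglongrightarrow> \<bar>c\<bar> * 0"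
    by (rule tendsto_mult_left)
  moreover have "translation_gap (\<lambda>x. indicat_real A x *\<^sub>R c) k = \<bar>c\<bar> * translation_gap (indicat_real A) k" for k
    by (subst integral_mult_right_zero[symmetric])
      (auto intro!: Bochner_Integration.integral_cong simp: abs_mult[symmetric] algebra_simps)
  ultimately show ?case by simp
next
  case (add f g)
  have le: "translation_gap (\<lambda>x. f x + g x) k \<le> translation_gap f k + translation_gap g k" for k
  proof -
    note tf = integrable_lborel_translate[OF add.hyps(1)] and tg = integrable_lborel_translate[OF add.hyps(2)]
    have "translation_gap (\<lambda>x. f x + g x) k \<le> (\<integral>x. \<bar>f (k + x) - f x\<bar> + \<bar>g (k + x) - g x\<bar> \<partial>lborel)"
      using add tf tg by (intro integral_mono) auto
    also have "\<dots> = translation_gap f k + translation_gap g k"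
      using add tf tg by (intro Bochner_Integration.integral_add) auto
    finally show ?thesis .
  qed
  have "(\<lambda>n. translation_gap f (h n) + translation_gap g (h n)) \<longlonglongrightarrow> 0"
    using tendsto_add[OF add.IH(1) add.IH(2)] by simp
  then show ?case
    by (rule tendsto_sandwich[OF _ _ tendsto_const, rotated 2]) (auto intro!: always_eventually le)
next
  case (lim f s)
  show ?case
  proof (rule translation_gap_approx[OF lim.hyps(4)])
    fix e :: real assume e: "0 < e"
    have "(\<lambda>i. \<integral>x. \<bar>f x - s i x\<bar> \<partial>lborel) \<longlonglongrightarrow> (\<integral>x. 0 \<partial>(lborel :: 'a measure))"
    proof (rule integral_dominated_convergence[where w="\<lambda>x. 3 * \<bar>f x\<bar>"])
      show "AE x in lborel. (\<lambda>i. \<bar>f x - s i x\<bar>) \<longlonglongrightarrow> 0"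
      proof (rule AE_I2)
        fix x :: 'a
        have "(\<lambda>i. s i x) \<longlonglongrightarrow> f x" using lim.hyps(2) by simp
        then have "(\<lambda>i. \<bar>f x - s i x\<bar>) \<longlonglongrightarrow> \<bar>f x - f x\<bar>" by (intro tendsto_intros)
        then show "(\<lambda>i. \<bar>f x - s i x\<bar>) \<longlonglongrightarrow> 0" by simp
      qed
      show "AE x in lborel. norm \<bar>f x - s i x\<bar> \<le> 3 * \<bar>f x\<bar>" for i
      proof (rule AE_I2)
        fix x :: 'a
        show "norm \<bar>f x - s i x\<bar> \<le> 3 * \<bar>f x\<bar>" using lim.hyps(3)[of x i] by simp
      qed
    qed (use lim in auto)
    then have "\<forall>\<^sub>F i in sequentially. (\<integral>x. \<bar>f x - s i x\<bar> \<partial>lborel) < e"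
      using e by (auto dest: order_tendstoD(2))
    then obtain i where "(\<integral>x. \<bar>f x - s i x\<bar> \<partial>lborel) < e" by (auto simp: eventually_sequentially)
    then show "\<exists>g. integrable lborel g \<and> (\<integral>x. \<bar>f x - g x\<bar> \<partial>lborel) \<le> e \<and> (\<lambda>n. translation_gap g (h n)) \<longlonglongrightarrow> 0"
      using lim.hyps(1) lim.IH by (intro exI[of _ "s i"]) auto
  qed
qed

section \<open>Local oscillation\<close>

text \<open>The mean deviation of \<open>f\<close> from \<open>f x\<close> on the scaled copy \<open>x + e S\<close>, in zoomed coordinates. For
  bounded \<open>S\<close> it tends to \<open>0\<close> with \<open>e\<close> at every Lebesgue point of \<open>f\<close>.\<close>

definition local_oscillation :: "('a::euclidean_space \<Rightarrow> real) \<Rightarrow> 'a set \<Rightarrow> real \<Rightarrow> 'a \<Rightarrow> real" where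
  "local_oscillation f S e x = (\<integral>z. indicator S z * \<bar>f (x + e *\<^sub>R z) - f x\<bar> \<partial>lborel)"

lemma local_oscillation_integral:
  fixes f :: "'a::euclidean_space \<Rightarrow> real"
  assumes f: "integrable lborel f" and S: "S \<in> sets borel" "emeasure lborel S < \<infinity>"
  shows "integrable (lborel \<Otimes>\<^sub>M lborel) (\<lambda>(x, z). indicator S z * \<bar>f (x + e *\<^sub>R z) - f x\<bar>)"
    and "integrable lborel (local_oscillation f S e)"
    and "(\<integral>x. local_oscillation f S e x \<partial>lborel) = (\<integral>z. indicator S z * translation_gap f (e *\<^sub>R z) \<partial>lborel)"
proof -
  have [measurable]: "f \<in> borel_measurable borel" using f by (simp add: borel_measurable_integrable)
  note [measurable] = S(1)
  let ?F = "\<lambda>x z. indicator S z * \<bar>f (x + e *\<^sub>R z) - f x\<bar>"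
  have gap: "integrable lborel (\<lambda>x. \<bar>f (h + x) - f x\<bar>)" for h
    using f integrable_lborel_translate[OF f] by simp
  have gap_le: "translation_gap f h \<le> 2 * (\<integral>x. \<bar>f x\<bar> \<partial>lborel)" for h
    using translation_gap_triangle[OF f, of "\<lambda>_. 0" h] by simp
  have "integrable (lborel \<Otimes>\<^sub>M lborel) (\<lambda>(z, x). ?F x z)"
  proof (rule lborel_pair.Fubini_integrable)
    have eq: "(\<integral>x. norm (case (z, x) of (z, x) \<Rightarrow> ?F x z) \<partial>lborel) = indicator S z * translation_gap f (e *\<^sub>R z)" for z
      by (simp add: abs_mult add.commute)
    have [measurable]: "(\<lambda>z. translation_gap f (e *\<^sub>R z)) \<in> borel_measurable lborel" by measurable
    show "integrable lborel (\<lambda>z. \<integral>x. norm (case (z, x) of (z, x) \<Rightarrow> ?F x z) \<partial>lborel)"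
      unfolding eq
    proof (rule integrableI_bounded_set[where A=S and B="2 * (\<integral>x. \<bar>f x\<bar> \<partial>lborel)"])
      show "AE z in lborel. z \<in> S \<longrightarrow> norm (indicator S z * translation_gap f (e *\<^sub>R z)) \<le> 2 * (\<integral>x. \<bar>f x\<bar> \<partial>lborel)"
        using gap_le by (intro AE_I2) auto
    qed (use S in auto)
    show "AE z in lborel. integrable lborel (\<lambda>x. case (z, x) of (z, x) \<Rightarrow> ?F x z)"
    proof (rule AE_I2)
      fix z :: 'a
      have "integrable lborel (\<lambda>x. \<bar>f (x + e *\<^sub>R z) - f x\<bar>)" using gap[of "e *\<^sub>R z"] by (simp add: add.commute)
      then show "integrable lborel (\<lambda>x. case (z, x) of (z, x) \<Rightarrow> ?F x z)" by simp
    qed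
  qed measurable
  then show I: "integrable (lborel \<Otimes>\<^sub>M lborel) (\<lambda>(x, z). ?F x z)"
    using lborel_pair.integrable_product_swap_iff[of "\<lambda>(x, z). ?F x z"] by (simp add: case_prod_beta')
  show "integrable lborel (local_oscillation f S e)"
    using lborel_pair.integrable_fst'[OF I] by (simp add: local_oscillation_def[abs_def])
  have "(\<integral>x. local_oscillation f S e x \<partial>lborel) = (\<integral>z. (\<integral>x. ?F x z \<partial>lborel) \<partial>lborel)"
    unfolding local_oscillation_def using lborel_pair.Fubini_integral[OF I] by simp
  then show "(\<integral>x. local_oscillation f S e x \<partial>lborel) = (\<integral>z. indicator S z * translation_gap f (e *\<^sub>R z) \<partial>lborel)"
    by (simp add: add.commute)
qed

text \<open>A substitute for the Lebesgue differentiation theorem: the oscillation tends to \<open>0\<close> in the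
  mean, being an average of translation gaps, and convergence in the mean implies convergence almost
  everywhere along a subsequence.\<close>

proposition local_oscillation_AE_subseq:
  fixes f :: "'a::euclidean_space \<Rightarrow> real"
  assumes f: "integrable lborel f" and S: "S \<in> sets borel" "emeasure lborel S < \<infinity>"
    and e: "e \<longlonglongrightarrow> 0"
  shows "\<exists>s. strict_mono s \<and> (AE x in lborel. (\<lambda>n. local_oscillation f S (e (s n)) x) \<longlonglongrightarrow> 0)"
proof (rule tendsto_L1_AE_subseq)
  show "integrable lborel (\<lambda>x. local_oscillation f S (e n) x)" for n
    by (rule local_oscillation_integral[OF f S])
  have [measurable]: "f \<in> borel_measurable borel" using f by (simp add: borel_measurable_integrable)
  note [measurable] = S(1)
  have gap_le: "translation_gap f h \<le> 2 * (\<integral>x. \<bar>f x\<bar> \<partial>lborel)" for h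
    using translation_gap_triangle[OF f, of "\<lambda>_. 0" h] by simp
  have "(\<lambda>n. \<integral>z. indicator S z * translation_gap f (e n *\<^sub>R z) \<partial>lborel) \<longlonglongrightarrow> (\<integral>z. 0 \<partial>(lborel :: 'a measure))"
  proof (rule integral_dominated_convergence[where w="\<lambda>z. 2 * (\<integral>x. \<bar>f x\<bar> \<partial>lborel) * indicator S z"])
    show "AE z in lborel. (\<lambda>n. indicator S z * translation_gap f (e n *\<^sub>R z)) \<longlonglongrightarrow> 0"
    proof (rule AE_I2)
      fix z :: 'a
      have "(\<lambda>n. e n *\<^sub>R z) \<longlonglongrightarrow> 0" using tendsto_scaleR[OF e tendsto_const[of z]] by simp
      from translation_gap_tendsto_0[OF f this]
      have "(\<lambda>n. indicator S z * translation_gap f (e n *\<^sub>R z)) \<longlonglongrightarrow> indicator S z * 0"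
        by (rule tendsto_mult_left)
      then show "(\<lambda>n. indicator S z * translation_gap f (e n *\<^sub>R z)) \<longlonglongrightarrow> 0" by simp
    qed
    show "AE z in lborel. norm (indicator S z * translation_gap f (e n *\<^sub>R z)) \<le> 2 * (\<integral>x. \<bar>f x\<bar> \<partial>lborel) * indicator S z" for n
      using gap_le by (intro AE_I2) (auto simp: indicator_def)
    show "integrable lborel (\<lambda>z. 2 * (\<integral>x. \<bar>f x\<bar> \<partial>lborel) * indicator S z)"
      using S by (intro integrable_mult_right integrable_real_indicator) auto
  qed measurable
  moreover have "norm (local_oscillation f S (e n) x) = local_oscillation f S (e n) x" for n x
    unfolding local_oscillation_def by simp
  ultimately show "(\<lambda>n. \<integral>x. norm (local_oscillation f S (e n) x) \<partial>lborel) \<longlonglongrightarrow> 0"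
    by (simp add: local_oscillation_integral[OF f S])
qed

section \<open>Product integrals over densities that are close in the mean\<close>

lemma PiM_integral_bounded_support:
  fixes F :: "(nat \<Rightarrow> 'b) \<Rightarrow> real"
  assumes M: "sigma_finite_measure M" and S: "S \<in> sets M" "emeasure M S \<le> ennreal C" and "0 \<le> C"
    and F: "F \<in> borel_measurable (PiM {..<m} (\<lambda>_. M))" "\<And>z. \<bar>F z\<bar> \<le> K"
    and supp: "\<And>z. z \<in> space (PiM {..<m} (\<lambda>_. M)) \<Longrightarrow> z \<notin> PiE {..<m} (\<lambda>_. S) \<Longrightarrow> F z = 0"
  shows "integrable (PiM {..<m} (\<lambda>_. M)) F" and "\<bar>\<integral>z. F z \<partial>PiM {..<m} (\<lambda>_. M)\<bar> \<le> K * C ^ m"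
proof -
  interpret P: product_sigma_finite "\<lambda>_::nat. M" using M by (simp add: product_sigma_finite_def)
  let ?P = "PiM {..<m} (\<lambda>_. M)" and ?S = "PiE {..<m} (\<lambda>_. S)"
  have S': "?S \<in> sets ?P" using S by (intro sets_PiM_I_finite) auto
  have K: "0 \<le> K" using F(2)[of undefined] by linarith
  have "emeasure ?P ?S = emeasure M S ^ m" using S by (subst P.emeasure_PiM) auto
  also have "\<dots> \<le> ennreal C ^ m" using S(2) by (intro power_mono) auto
  finally have e: "emeasure ?P ?S \<le> ennreal (C ^ m)" using \<open>0 \<le> C\<close> by (simp add: ennreal_power)
  then have fin: "emeasure ?P ?S < \<infinity>" by (auto simp: less_top[symmetric] top_unique)
  have me: "measure ?P ?S \<le> C ^ m" using e \<open>0 \<le> C\<close> by (simp add: measure_def enn2real_leI)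
  show int: "integrable ?P F"
    by (rule integrableI_bounded_set[OF S' F(1) fin, where B=K]) (use F(2) supp in \<open>auto intro!: AE_I2\<close>)
  have "\<bar>\<integral>z. F z \<partial>?P\<bar> \<le> (\<integral>z. \<bar>F z\<bar> \<partial>?P)" by (rule integral_abs_bound)
  also have "\<dots> \<le> (\<integral>z. K * indicator ?S z \<partial>?P)"
  proof (rule integral_mono)
    show "integrable ?P (\<lambda>z. K * indicator ?S z)"
      using S' fin by (intro integrable_mult_right integrable_real_indicator)
    show "\<bar>F z\<bar> \<le> K * indicator ?S z" if "z \<in> space ?P" for z
      using F(2)[of z] supp[OF that] by (cases "z \<in> ?S") auto
  qed (use int in simp)
  also have "\<dots> = K * measure ?P ?S" using S' fin by simp
  also have "\<dots> \<le> K * C ^ m" using me K by (rule mult_left_mono)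
  finally show "\<bar>\<integral>z. F z \<partial>?P\<bar> \<le> K * C ^ m" .
qed

lemma sigma_finite_density_lborel:
  assumes "a \<in> borel_measurable borel"
  shows "sigma_finite_measure (density lborel (\<lambda>x. ennreal (a x)))"
  using assms by (subst sigma_finite_measure.sigma_finite_iff_density_finite'[OF sigma_finite_lborel]) auto

lemma emeasure_density_lborel_eq_integral:
  assumes "d \<in> borel_measurable borel" "S \<in> sets borel" "\<And>x. 0 \<le> d x"
    and "integrable lborel (\<lambda>x. indicator S x * d x)"
  shows "emeasure (density lborel (\<lambda>x. ennreal (d x))) S = ennreal (\<integral>x. indicator S x * d x \<partial>lborel)"
proof -
  have "emeasure (density lborel (\<lambda>x. ennreal (d x))) S = (\<integral>\<^sup>+x. ennreal (d x) * indicator S x \<partial>lborel)"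
    using assms by (intro emeasure_density) auto
  also have "\<dots> = (\<integral>\<^sup>+x. ennreal (indicator S x * d x) \<partial>lborel)"
    by (intro nn_integral_cong) (auto simp: indicator_def)
  also have "\<dots> = ennreal (\<integral>x. indicator S x * d x \<partial>lborel)"
    using assms by (intro nn_integral_eq_integral) auto
  finally show ?thesis .
qed

text \<open>Coordinates are exchanged one at a time. Replacing \<open>a\<close> by \<open>b\<close> in one coordinate costs at most
  \<open>K * D\<close> there and a factor \<open>C\<close> in each of the \<open>m - 1\<close> others. In the induction step the last
  coordinate is integrated out, first against \<open>a\<close>, which leaves an instance with bound \<open>K * C\<close>, and
  then the change in that coordinate is estimated directly.\<close>

lemma PiM_density_integral_diff:
  fixes a b :: "'a::euclidean_space \<Rightarrow> real" and F :: "(nat \<Rightarrow> 'a) \<Rightarrow> real"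
  assumes [measurable]: "a \<in> borel_measurable borel" "b \<in> borel_measurable borel" "S \<in> sets borel"
    and nonneg: "\<And>z. 0 \<le> a z" "\<And>z. 0 \<le> b z"
    and a: "integrable lborel (\<lambda>z. indicator S z * a z)" "(\<integral>z. indicator S z * a z \<partial>lborel) \<le> C"
    and b: "integrable lborel (\<lambda>z. indicator S z * b z)" "(\<integral>z. indicator S z * b z \<partial>lborel) \<le> C"
    and D: "(\<integral>z. indicator S z * \<bar>a z - b z\<bar> \<partial>lborel) \<le> D"
    and F: "F \<in> borel_measurable (PiM {..<m} (\<lambda>_. borel))" "\<And>z. \<bar>F z\<bar> \<le> K"
    and supp: "\<And>z. z \<in> extensional {..<m} \<Longrightarrow> z \<notin> PiE {..<m} (\<lambda>_. S) \<Longrightarrow> F z = 0"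
  shows "\<bar>(\<integral>z. F z \<partial>PiM {..<m} (\<lambda>_. density lborel a)) - (\<integral>z. F z \<partial>PiM {..<m} (\<lambda>_. density lborel b))\<bar>
    \<le> real m * K * C ^ (m - 1) * D"
  using F supp
proof (induction m arbitrary: F K)
  case 0
  have "PiM {..<0::nat} (\<lambda>_. density lborel a) = PiM {..<0::nat} (\<lambda>_. density lborel b)" by (simp add: PiM_empty)
  then show ?case by simp
next
  case (Suc m)
  let ?A = "density lborel (\<lambda>x. ennreal (a x))" and ?B = "density lborel (\<lambda>x. ennreal (b x))"
  have sA: "sigma_finite_measure ?A" and sB: "sigma_finite_measure ?B"
    by (rule sigma_finite_density_lborel, measurable)+
  interpret PA: product_sigma_finite "\<lambda>_::nat. ?A" using sA by (simp add: product_sigma_finite_def)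
  interpret PB: product_sigma_finite "\<lambda>_::nat. ?B" using sB by (simp add: product_sigma_finite_def)
  have K: "0 \<le> K" using Suc.prems(2)[of undefined] by linarith
  have "0 \<le> (\<integral>z. indicator S z * a z \<partial>lborel)" using nonneg by simp
  then have C: "0 \<le> C" using a(2) by linarith
  have eA: "emeasure ?A S \<le> ennreal C" and eB: "emeasure ?B S \<le> ennreal C"
    using emeasure_density_lborel_eq_integral[of a S] emeasure_density_lborel_eq_integral[of b S] assms
    by (auto intro: ennreal_leI)
  have setsPA: "sets (PiM I (\<lambda>_. ?A)) = sets (PiM I (\<lambda>_. borel))" and setsPB: "sets (PiM I (\<lambda>_. ?B)) = sets (PiM I (\<lambda>_. borel))" for I :: "nat set"
    by (auto intro!: sets_PiM_cong)
  have FA: "F \<in> borel_measurable (PiM {..<Suc m} (\<lambda>_. ?A))" and FB: "F \<in> borel_measurable (PiM {..<Suc m} (\<lambda>_. ?B))"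
    using Suc.prems(1) by (simp_all cong: measurable_cong_sets add: setsPA setsPB)
  have sp: "space (PiM I (\<lambda>_. ?A)) = extensional I" "space (PiM I (\<lambda>_. ?B)) = extensional I" for I :: "nat set"
    by (auto simp: space_PiM PiE_def)
  have ins: "{..<Suc m} = insert m {..<m}" by auto
  have intA: "integrable (PiM {..<Suc m} (\<lambda>_. ?A)) F"
    using sA eA C FA Suc.prems(2,3) by (intro PiM_integral_bounded_support[where S=S and C=C and K=K]) (auto simp: sp)
  have intB: "integrable (PiM {..<Suc m} (\<lambda>_. ?B)) F"
    using sB eB C FB Suc.prems(2,3) by (intro PiM_integral_bounded_support[where S=S and C=C and K=K]) (auto simp: sp)
  define GA where "GA z = (\<integral>w. F (z(m := w)) \<partial>?A)" for z
  define GB where "GB z = (\<integral>w. F (z(m := w)) \<partial>?B)" for z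
  have step: "(\<lambda>(z, w). F (z(m := w))) \<in> borel_measurable (PiM {..<m} (\<lambda>_. borel) \<Otimes>\<^sub>M borel)"
  proof -
    have "(\<lambda>(z, w). z(m := w)) \<in> PiM {..<m} (\<lambda>_. borel :: 'a measure) \<Otimes>\<^sub>M borel \<rightarrow>\<^sub>M PiM (insert m {..<m}) (\<lambda>_. borel)"
      by (rule measurable_add_dim)
    from measurable_compose[OF this Suc.prems(1)[unfolded ins]] show ?thesis
      by (simp only: case_prod_beta')
  qed
  have mG: "(\<lambda>z. \<integral>w. F (z(m := w)) \<partial>N) \<in> borel_measurable (PiM {..<m} (\<lambda>_. borel))"
    if "sigma_finite_measure N" "sets N = sets borel" for N
  proof -
    interpret N: sigma_finite_measure N by fact
    have "(\<lambda>(z, w). F (z(m := w))) \<in> borel_measurable (PiM {..<m} (\<lambda>_. borel) \<Otimes>\<^sub>M N)"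
      using step by (simp cong: measurable_cong_sets sets_pair_measure_cong add: that(2))
    then show ?thesis by (rule N.borel_measurable_lebesgue_integral)
  qed
  have sec: "(\<lambda>w. F (z(m := w))) \<in> borel_measurable borel" if "z \<in> extensional {..<m}" for z
    using measurable_compose[OF measurable_Pair1'[of z "PiM {..<m} (\<lambda>_. borel)"] step] that
    by (simp add: space_PiM PiE_def)
  have null: "F (z(m := w)) = 0" if "z \<in> extensional {..<m}" "z \<notin> PiE {..<m} (\<lambda>_. S) \<or> w \<notin> S" for z w
  proof (rule Suc.prems(3))
    show "z(m := w) \<in> extensional {..<Suc m}" using that by (auto simp: extensional_def)
    show "z(m := w) \<notin> PiE {..<Suc m} (\<lambda>_. S)" using that by (auto simp: PiE_iff Ball_def less_Suc_eq)
  qed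
  have Gint: "integrable lborel (\<lambda>w. d w * F (z(m := w)))" and Gbd: "(\<integral>w. \<bar>d w * F (z(m := w))\<bar> \<partial>lborel) \<le> K * (\<integral>w. indicator S w * \<bar>d w\<bar> \<partial>lborel)"
    if z: "z \<in> extensional {..<m}" and d: "d \<in> borel_measurable borel" "integrable lborel (\<lambda>w. indicator S w * \<bar>d w\<bar>)" for z d
  proof -
    note [measurable] = d(1) sec[OF z]
    have le: "\<bar>d w * F (z(m := w))\<bar> \<le> K * (indicator S w * \<bar>d w\<bar>)" for w
    proof (cases "w \<in> S")
      case True
      have "\<bar>F (z(m := w))\<bar> * \<bar>d w\<bar> \<le> K * \<bar>d w\<bar>"
        by (rule mult_right_mono) (simp_all only: Suc.prems(2) abs_ge_zero)
      then show ?thesis using True by (simp only: abs_mult indicator_simps mult_1_left mult.commute[of "\<bar>d w\<bar>"])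
    next
      case False
      then show ?thesis using null[OF z, of w] by (simp only: indicator_simps) simp
    qed
    show I: "integrable lborel (\<lambda>w. d w * F (z(m := w)))"
      by (rule Bochner_Integration.integrable_bound[OF integrable_mult_right[OF d(2), of K]])
        (use le K in \<open>auto intro!: AE_I2 simp: abs_mult\<close>)
    have "(\<integral>w. \<bar>d w * F (z(m := w))\<bar> \<partial>lborel) \<le> (\<integral>w. K * (indicator S w * \<bar>d w\<bar>) \<partial>lborel)"
      using I d(2) le by (intro integral_mono) auto
    then show "(\<integral>w. \<bar>d w * F (z(m := w))\<bar> \<partial>lborel) \<le> K * (\<integral>w. indicator S w * \<bar>d w\<bar> \<partial>lborel)" by simp
  qed
  have GA: "GA z = (\<integral>w. a w * F (z(m := w)) \<partial>lborel)" and GB: "GB z = (\<integral>w. b w * F (z(m := w)) \<partial>lborel)"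
    if z: "z \<in> extensional {..<m}" for z
    unfolding GA_def GB_def using sec[OF z] nonneg by (simp_all add: integral_density)
  have abs: "\<bar>a z\<bar> = a z" "\<bar>b z\<bar> = b z" for z using nonneg by auto
  have iab: "integrable lborel (\<lambda>w. indicator S w * \<bar>a w - b w\<bar>)"
  proof (rule Bochner_Integration.integrable_bound)
    show "integrable lborel (\<lambda>w. indicator S w * a w + indicator S w * b w)" using a b by simp
    show "AE w in lborel. norm (indicator S w * \<bar>a w - b w\<bar>) \<le> norm (indicator S w * a w + indicator S w * b w)"
      using nonneg by (intro AE_I2) (auto simp: indicator_def abs_le_iff add_nonneg_nonneg intro: add_increasing)
  qed measurable
  have GA_bd: "\<bar>GA z\<bar> \<le> K * C" if z: "z \<in> extensional {..<m}" for z
  proof -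
    have "\<bar>GA z\<bar> \<le> (\<integral>w. \<bar>a w * F (z(m := w))\<bar> \<partial>lborel)" unfolding GA[OF z] by (rule integral_abs_bound)
    also have "\<dots> \<le> K * (\<integral>w. indicator S w * \<bar>a w\<bar> \<partial>lborel)" using a by (intro Gbd z) (auto simp: abs)
    also have "\<dots> \<le> K * C" using a(2) K by (intro mult_left_mono) (auto simp: abs)
    finally show ?thesis .
  qed
  have GAB: "\<bar>GA z - GB z\<bar> \<le> K * D" if z: "z \<in> extensional {..<m}" for z
  proof -
    have "GA z - GB z = (\<integral>w. (a w - b w) * F (z(m := w)) \<partial>lborel)"
      unfolding GA[OF z] GB[OF z] using Gint[OF z, of a] Gint[OF z, of b] a b
      by (subst Bochner_Integration.integral_diff[symmetric]) (auto simp: abs algebra_simps)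
    then have "\<bar>GA z - GB z\<bar> \<le> (\<integral>w. \<bar>(a w - b w) * F (z(m := w))\<bar> \<partial>lborel)"
      using integral_abs_bound[of lborel "\<lambda>w. (a w - b w) * F (z(m := w))"] by (simp only:)
    also have "\<dots> \<le> K * (\<integral>w. indicator S w * \<bar>a w - b w\<bar> \<partial>lborel)" using iab by (intro Gbd z) auto
    also have "\<dots> \<le> K * D" using D K by (intro mult_left_mono) auto
    finally show ?thesis .
  qed
  have Gnull: "GA z = 0" "GB z = 0" if "z \<in> extensional {..<m}" "z \<notin> PiE {..<m} (\<lambda>_. S)" for z
    using null[OF that(1)] that(2) by (simp_all add: GA_def GB_def)
  \<comment> \<open>The induction hypothesis needs the bound at all arguments, also outside the space of the
    product measure; restricting the argument provides it.\<close>
  define GA' where "GA' z = GA (restrict z {..<m})" for z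
  have restr: "restrict z {..<m} = z" if "z \<in> extensional {..<m}" for z using that by (rule extensional_restrict)
  have mGA: "GA \<in> borel_measurable (PiM {..<m} (\<lambda>_. borel))" and mGB: "GB \<in> borel_measurable (PiM {..<m} (\<lambda>_. borel))"
    unfolding GA_def[abs_def] GB_def[abs_def] using mG[OF sA] mG[OF sB] by auto
  have spb: "space (PiM {..<m} (\<lambda>_. borel :: 'a measure)) = extensional {..<m}" by (auto simp: space_PiM PiE_def)
  have mGA': "GA' \<in> borel_measurable (PiM {..<m} (\<lambda>_. borel))"
    using mGA by (subst measurable_cong[where g=GA]) (auto simp: GA'_def spb restr)
  have congA: "(\<integral>z. GA z \<partial>PiM {..<m} (\<lambda>_. ?A)) = (\<integral>z. GA' z \<partial>PiM {..<m} (\<lambda>_. ?A))"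
    and congB: "(\<integral>z. GA z \<partial>PiM {..<m} (\<lambda>_. ?B)) = (\<integral>z. GA' z \<partial>PiM {..<m} (\<lambda>_. ?B))"
    by (intro Bochner_Integration.integral_cong; simp add: sp GA'_def restr)+
  have one: "\<bar>(\<integral>z. GA z \<partial>PiM {..<m} (\<lambda>_. ?A)) - (\<integral>z. GA z \<partial>PiM {..<m} (\<lambda>_. ?B))\<bar> \<le> real m * (K * C) * C ^ (m - 1) * D"
    unfolding congA congB
  proof (rule Suc.IH[OF mGA'])
    show "\<bar>GA' z\<bar> \<le> K * C" for z unfolding GA'_def by (rule GA_bd) simp
    show "GA' z = 0" if "z \<in> extensional {..<m}" "z \<notin> PiE {..<m} (\<lambda>_. S)" for z
      using Gnull(1)[OF that] that(1) by (simp add: GA'_def restr)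
  qed
  define H where "H z = (GA (restrict z {..<m}) - GB (restrict z {..<m}))" for z
  have mH: "H \<in> borel_measurable (PiM {..<m} (\<lambda>_. ?B))"
  proof -
    have "(\<lambda>z. GA z - GB z) \<in> borel_measurable (PiM {..<m} (\<lambda>_. borel))" using mGA mGB by (rule borel_measurable_diff)
    then have "H \<in> borel_measurable (PiM {..<m} (\<lambda>_. borel))"
      by (subst measurable_cong[where g="\<lambda>z. GA z - GB z"]) (auto simp: H_def spb restr)
    then show ?thesis by (simp cong: measurable_cong_sets add: setsPB)
  qed
  have two: "\<bar>\<integral>z. H z \<partial>PiM {..<m} (\<lambda>_. ?B)\<bar> \<le> K * D * C ^ m"
  proof (rule PiM_integral_bounded_support(2)[OF sB _ eB C mH])
    show "\<bar>H z\<bar> \<le> K * D" for z unfolding H_def by (rule GAB) simp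
    show "H z = 0" if "z \<in> space (PiM {..<m} (\<lambda>_. ?B))" "z \<notin> PiE {..<m} (\<lambda>_. S)" for z
      using Gnull[of z] that by (simp add: H_def sp restr)
  qed simp
  have ia: "integrable (PiM {..<m} (\<lambda>_. ?B)) GA'"
  proof (rule PiM_integral_bounded_support(1)[OF sB _ eB C])
    show "GA' \<in> borel_measurable (PiM {..<m} (\<lambda>_. ?B))" using mGA' by (simp cong: measurable_cong_sets add: setsPB)
    show "\<bar>GA' z\<bar> \<le> K * C" for z unfolding GA'_def by (rule GA_bd) simp
    show "GA' z = 0" if "z \<in> space (PiM {..<m} (\<lambda>_. ?B))" "z \<notin> PiE {..<m} (\<lambda>_. S)" for z
      using Gnull[of z] that by (simp add: GA'_def sp restr)
  qed simp
  have iH: "integrable (PiM {..<m} (\<lambda>_. ?B)) H"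
  proof (rule PiM_integral_bounded_support(1)[OF sB _ eB C mH])
    show "\<bar>H z\<bar> \<le> K * D" for z unfolding H_def by (rule GAB) simp
    show "H z = 0" if "z \<in> space (PiM {..<m} (\<lambda>_. ?B))" "z \<notin> PiE {..<m} (\<lambda>_. S)" for z
      using Gnull[of z] that by (simp add: H_def sp restr)
  qed simp
  have "(\<integral>z. GB z \<partial>PiM {..<m} (\<lambda>_. ?B)) = (\<integral>z. GA' z - H z \<partial>PiM {..<m} (\<lambda>_. ?B))"
    by (intro Bochner_Integration.integral_cong) (auto simp: sp GA'_def H_def restr)
  also have "\<dots> = (\<integral>z. GA z \<partial>PiM {..<m} (\<lambda>_. ?B)) - (\<integral>z. H z \<partial>PiM {..<m} (\<lambda>_. ?B))"
    unfolding congB using ia iH by (rule Bochner_Integration.integral_diff)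
  finally have eqB: "(\<integral>z. GB z \<partial>PiM {..<m} (\<lambda>_. ?B)) = (\<integral>z. GA z \<partial>PiM {..<m} (\<lambda>_. ?B)) - (\<integral>z. H z \<partial>PiM {..<m} (\<lambda>_. ?B))" .
  have "(\<integral>z. F z \<partial>PiM {..<Suc m} (\<lambda>_. ?A)) = (\<integral>z. GA z \<partial>PiM {..<m} (\<lambda>_. ?A))"
    unfolding GA_def ins using intA unfolding ins by (intro PA.product_integral_insert) auto
  moreover have "(\<integral>z. F z \<partial>PiM {..<Suc m} (\<lambda>_. ?B)) = (\<integral>z. GB z \<partial>PiM {..<m} (\<lambda>_. ?B))"
    unfolding GB_def ins using intB unfolding ins by (intro PB.product_integral_insert) auto
  ultimately have "\<bar>(\<integral>z. F z \<partial>PiM {..<Suc m} (\<lambda>_. ?A)) - (\<integral>z. F z \<partial>PiM {..<Suc m} (\<lambda>_. ?B))\<bar>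
      \<le> real m * (K * C) * C ^ (m - 1) * D + K * D * C ^ m"
    using one two eqB by linarith
  also have "\<dots> = real (Suc m) * K * C ^ (Suc m - 1) * D"
    by (cases m) (auto simp: algebra_simps)
  finally show ?case .
qed

section \<open>Rescaled cluster weights\<close>

text \<open>The mean weight at \<open>x\<close> of a cluster of \<open>m\<close> independent points that arrive in the order of their
  labels, all before the point at \<open>x\<close>.\<close>

definition mean_cluster_weight :: "'a::euclidean_space measure \<Rightarrow> nat \<Rightarrow> real \<Rightarrow> nat \<Rightarrow> 'a \<Rightarrow> real" where
  "mean_cluster_weight \<mu> k r m x = (\<integral>y. cluster_weight k r (y(m := x)) (\<lambda>i. i) {..<m} m \<partial>PiM {..<m} (\<lambda>_. \<mu>))"

text \<open>The side of a cube of volume \<open>1 / n\<close>, which is the length scale of the packing.\<close>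

abbreviation side_length :: "'a::euclidean_space itself \<Rightarrow> nat \<Rightarrow> real" where
  "side_length _ n \<equiv> root DIM('a) (1 / real n)"

lemma side_length_pos: "0 < n \<Longrightarrow> 0 < side_length TYPE('a::euclidean_space) n"
  by (intro real_root_gt_zero) auto

lemma side_length_power: "0 < n \<Longrightarrow> side_length TYPE('a::euclidean_space) n ^ DIM('a) = 1 / real n"
  by (intro real_root_pow_pos2) auto

lemma ball_radius_scale: "ball_radius TYPE('a::euclidean_space) (1 / real n) = side_length TYPE('a) n * unit_radius TYPE('a)"
  by (simp add: ball_radius_def real_root_mult[symmetric])

lemma side_length_tendsto_0:
  assumes "filterlim N at_top sequentially"
  shows "(\<lambda>j. side_length TYPE('a::euclidean_space) (N j)) \<longlonglongrightarrow> 0"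
proof -
  have "(\<lambda>j. 1 / real (N j)) \<longlonglongrightarrow> 0"
    using filterlim_compose[OF lim_1_over_n assms] by simp
  from tendsto_real_root[OF this, of "DIM('a)"] show ?thesis by simp
qed

context
  fixes f :: "'a::euclidean_space \<Rightarrow> real"
  assumes f_meas [measurable]: "f \<in> borel_measurable borel"
    and f_nonneg: "\<And>x. 0 \<le> f x"
    and f_prob: "(\<integral>\<^sup>+x. ennreal (f x) \<partial>lborel) = 1"
begin

abbreviation center_law :: "'a measure" where
  "center_law \<equiv> density lborel (\<lambda>x. ennreal (f x))"

lemma prob_space_center_law: "prob_space center_law"
  by (rule prob_spaceI) (simp add: emeasure_density f_prob)

lemma integrable_f: "integrable lborel f"
  using f_nonneg f_prob by (intro integrableI_nonneg) auto

text \<open>The law of one centre seen from \<open>x\<close> in units of the side length.\<close>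

abbreviation zoomed_law :: "nat \<Rightarrow> 'a \<Rightarrow> 'a measure" where
  "zoomed_law n x \<equiv> density lborel (\<lambda>z. ennreal (f (x + side_length TYPE('a) n *\<^sub>R z) / real n))"

text \<open>The factor \<open>1 / n\<close> in the density is the Jacobian \<open>e^d\<close> of the inverse zoom \<open>z \<mapsto> x + e z\<close>.\<close>

lemma distr_center_law_zoom:
  assumes n: "0 < n"
  shows "distr center_law (zoomed_law n x) (\<lambda>y. (y - x) /\<^sub>R side_length TYPE('a) n) = zoomed_law n x"
proof (rule measure_eqI)
  let ?e = "side_length TYPE('a) n"
  have e: "0 < ?e" by (rule side_length_pos[OF n])
  fix B assume "B \<in> sets (distr center_law (zoomed_law n x) (\<lambda>y. (y - x) /\<^sub>R ?e))"
  then have B[measurable]: "B \<in> sets borel" by simp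
  let ?g = "\<lambda>y. ennreal (f y) * indicator B ((y - x) /\<^sub>R ?e)"
  have "emeasure (distr center_law (zoomed_law n x) (\<lambda>y. (y - x) /\<^sub>R ?e)) B
      = emeasure center_law ((\<lambda>y. (y - x) /\<^sub>R ?e) -` B)"
    by (subst emeasure_distr) auto
  also have "\<dots> = (\<integral>\<^sup>+y. ?g y \<partial>lborel)"
  proof -
    have "(\<lambda>y. (y - x) /\<^sub>R ?e) -` B \<in> sets lborel"
      using measurable_sets[of "\<lambda>y. (y - x) /\<^sub>R ?e" borel borel B] by simp
    then show ?thesis
      by (subst emeasure_density) (auto intro!: nn_integral_cong simp: indicator_def)
  qed
  also have "\<dots> = (\<integral>\<^sup>+y. ?g y \<partial>density (distr lborel borel (\<lambda>z. x + ?e *\<^sub>R z)) (\<lambda>_. ennreal (\<bar>?e\<bar> ^ DIM('a))))"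
    using e by (subst lborel_affine[of ?e x]) auto
  also have "\<dots> = (\<integral>\<^sup>+z. ennreal (\<bar>?e\<bar> ^ DIM('a)) * ?g (x + ?e *\<^sub>R z) \<partial>lborel)"
    by (subst nn_integral_density, simp, simp, subst nn_integral_distr) auto
  also have "\<dots> = (\<integral>\<^sup>+z. ennreal (f (x + ?e *\<^sub>R z) / real n) * indicator B z \<partial>lborel)"
  proof (rule nn_integral_cong)
    fix z :: 'a
    have "(x + ?e *\<^sub>R z - x) /\<^sub>R ?e = z" using e by simp
    then have "?g (x + ?e *\<^sub>R z) = ennreal (f (x + ?e *\<^sub>R z)) * indicator B z" by (simp only:)
    moreover have "ennreal (\<bar>?e\<bar> ^ DIM('a)) = ennreal (1 / real n)"
      using side_length_power[OF n, where 'a='a] e by (simp only: abs_of_pos)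
    ultimately show "ennreal (\<bar>?e\<bar> ^ DIM('a)) * ?g (x + ?e *\<^sub>R z) = ennreal (f (x + ?e *\<^sub>R z) / real n) * indicator B z"
      using f_nonneg by (simp only: mult.assoc[symmetric] ennreal_mult[symmetric] zero_le_divide_1_iff of_nat_0_le_iff) simp
  qed
  also have "\<dots> = emeasure (zoomed_law n x) B"
    by (subst emeasure_density) auto
  finally show "emeasure (distr center_law (zoomed_law n x) (\<lambda>y. (y - x) /\<^sub>R ?e)) B = emeasure (zoomed_law n x) B" .
qed simp

lemma prob_space_zoomed_law: "0 < n \<Longrightarrow> prob_space (zoomed_law n x)"
  using prob_space.prob_space_distr[OF prob_space_center_law, of "\<lambda>y. (y - x) /\<^sub>R side_length TYPE('a) n" "zoomed_law n x"]
  by (simp add: distr_center_law_zoom)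

lemma mean_cluster_weight_zoom:
  assumes n: "0 < n"
  shows "mean_cluster_weight center_law k (ball_radius TYPE('a) (1 / real n)) m x
    = (\<integral>z. cluster_weight k (unit_radius TYPE('a)) (z(m := 0)) (\<lambda>i. i) {..<m} m \<partial>PiM {..<m} (\<lambda>_. zoomed_law n x))"
proof -
  let ?e = "side_length TYPE('a) n" and ?r = "unit_radius TYPE('a)"
  let ?T = "\<lambda>y. (y - x) /\<^sub>R ?e"
  have e: "0 < ?e" by (rule side_length_pos[OF n])
  have r: "0 < ?r" by (rule ball_radius_pos) simp
  have T[measurable]: "?T \<in> center_law \<rightarrow>\<^sub>M zoomed_law n x" by simp
  have d: "distr (PiM {..<m} (\<lambda>_. center_law)) (PiM {..<m} (\<lambda>_. zoomed_law n x)) (compose {..<m} ?T)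
      = PiM {..<m} (\<lambda>_. zoomed_law n x)"
    using n by (subst distr_PiM_finite_prob_space')
      (auto intro: prob_space_center_law prob_space_zoomed_law simp: distr_center_law_zoom)
  have Tm: "compose {..<m} ?T \<in> PiM {..<m} (\<lambda>_. center_law) \<rightarrow>\<^sub>M PiM {..<m} (\<lambda>_. zoomed_law n x)"
    unfolding compose_def
  proof (rule measurable_restrict)
    fix i assume "i \<in> {..<m}"
    then have "(\<lambda>y. y i) \<in> PiM {..<m} (\<lambda>_. center_law) \<rightarrow>\<^sub>M center_law" by (rule measurable_component_singleton)
    then show "(\<lambda>y. ?T (y i)) \<in> PiM {..<m} (\<lambda>_. center_law) \<rightarrow>\<^sub>M zoomed_law n x" by (rule measurable_compose[OF _ T])
  qed
  have m: "(\<lambda>z. cluster_weight k ?r (z(m := 0)) (\<lambda>i. i) {..<m} m) \<in> borel_measurable (PiM {..<m} (\<lambda>_. zoomed_law n x))"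
  proof -
    have "(\<lambda>z. cluster_weight k ?r (z(m := 0)) (\<lambda>i. i) {..<m} m) \<in> borel_measurable (PiM {..<m} (\<lambda>_. borel :: 'a measure))"
      by (rule measurable_cluster_weight[OF r]) (auto intro!: measurable_component_singleton)
    moreover have "sets (PiM {..<m} (\<lambda>_. zoomed_law n x)) = sets (PiM {..<m} (\<lambda>_. borel))"
      by (intro sets_PiM_cong) auto
    ultimately show ?thesis using measurable_cong_sets[of "PiM {..<m} (\<lambda>_. zoomed_law n x)" _ borel borel] by blast
  qed
  have eq: "cluster_weight k (ball_radius TYPE('a) (1 / real n)) (y(m := x)) (\<lambda>i. i) {..<m} m
      = cluster_weight k ?r ((compose {..<m} ?T y)(m := 0)) (\<lambda>i. i) {..<m} m" for y
  proof -
    have "cluster_weight k (ball_radius TYPE('a) (1 / real n)) (y(m := x)) (\<lambda>i. i) {..<m} m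
      = cluster_weight k (?e * ?r) (\<lambda>i. x + ?e *\<^sub>R ((compose {..<m} ?T y)(m := 0)) i) (\<lambda>i. i) {..<m} m"
      unfolding ball_radius_scale using e by (intro cluster_weight_cong) (auto simp: compose_def)
    then show ?thesis by (simp only: cluster_weight_scale[OF r e])
  qed
  have "mean_cluster_weight center_law k (ball_radius TYPE('a) (1 / real n)) m x
     = (\<integral>z. cluster_weight k ?r (z(m := 0)) (\<lambda>i. i) {..<m} m
        \<partial>distr (PiM {..<m} (\<lambda>_. center_law)) (PiM {..<m} (\<lambda>_. zoomed_law n x)) (compose {..<m} ?T))"
    unfolding mean_cluster_weight_def eq by (rule integral_distr[OF Tm m, symmetric])
  then show ?thesis unfolding d .
qed

lemma cluster_weight_far:
  fixes m :: nat
  assumes "unit_range TYPE('a) k \<le> R" "z \<notin> PiE {..<m} (\<lambda>_. ball (0::'a) R)" "z \<in> extensional {..<m}"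
  shows "cluster_weight k (unit_radius TYPE('a)) (z(m := 0)) (\<lambda>i. i) {..<m} m = 0"
proof -
  have r: "0 < unit_radius TYPE('a)" by (rule ball_radius_pos) simp
  obtain j where "j < m" "z j \<notin> ball 0 R" using assms(2,3) by (auto simp: PiE_iff)
  then show ?thesis using assms(1) r
    by (intro cluster_weight_eq_0[of _ _ j]) (auto simp: dist_norm)
qed

text \<open>After zooming in at \<open>x\<close> the sample has density \<open>f (x + e z) / n\<close>, which is compared with the
  constant \<open>f x / n\<close> on the range of interaction. The constant density gives the cluster integral
  exactly, and the error is governed by the local oscillation.\<close>

lemma mean_cluster_weight_estimate:
  fixes x :: 'a and n k m :: nat
  assumes n: "0 < n" and R: "unit_range TYPE('a) k \<le> R"
  defines "S \<equiv> ball (0::'a) R"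
  defines "D \<equiv> local_oscillation f S (side_length TYPE('a) n) x"
  defines "C \<equiv> f x * measure lborel S + D"
  shows "\<bar>real n ^ m * mean_cluster_weight center_law k (ball_radius TYPE('a) (1 / real n)) m x\<bar> \<le> (2 * C) ^ m"
    and "\<bar>real n ^ m * mean_cluster_weight center_law k (ball_radius TYPE('a) (1 / real n)) m x - f x ^ m * cluster_integral TYPE('a) k m\<bar>
      \<le> real m * 2 ^ m * C ^ (m - 1) * D"
proof -
  let ?e = "side_length TYPE('a) n" and ?r = "unit_radius TYPE('a)"
  let ?a = "\<lambda>z. f (x + ?e *\<^sub>R z) / real n" and ?b = "\<lambda>z::'a. f x / real n"
  let ?F = "\<lambda>z. cluster_weight k ?r (z(m := 0::'a)) (\<lambda>i. i) {..<m} m"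
  have r: "0 < ?r" by (rule ball_radius_pos) simp
  have S[measurable]: "S \<in> sets borel" by (simp add: S_def)
  have Sfin: "emeasure lborel S < \<infinity>" unfolding S_def by (rule emeasure_bounded_finite[OF bounded_ball])
  have nr: "0 < real n" using n by simp
  have pa: "prob_space (zoomed_law n x)" by (rule prob_space_zoomed_law[OF n])
  have "(\<integral>\<^sup>+z. ennreal (?a z) \<partial>lborel) = 1"
    using prob_space.emeasure_space_1[OF pa] by (simp add: emeasure_density)
  then have ia: "integrable lborel ?a" using f_nonneg by (intro integrableI_nonneg) auto
  have iSa: "integrable lborel (\<lambda>z. indicator S z * ?a z)"
    using integrable_real_mult_indicator[OF _ ia, of S] by (simp add: mult.commute)
  have iS: "integrable lborel (indicat_real S)" using Sfin by (intro integrable_real_indicator) auto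
  have iSb: "integrable lborel (\<lambda>z. indicator S z * ?b z)" using iS by simp
  have iD: "integrable lborel (\<lambda>z. indicator S z * \<bar>f (x + ?e *\<^sub>R z) - f x\<bar>)"
  proof -
    have "integrable lborel (\<lambda>z. \<bar>indicator S z * ?a z - indicator S z * ?b z\<bar>)" using iSa iSb by simp
    then have "integrable lborel (\<lambda>z. real n * \<bar>indicator S z * ?a z - indicator S z * ?b z\<bar>)" by simp
    moreover have "real n * \<bar>indicator S z * ?a z - indicator S z * ?b z\<bar> = indicator S z * \<bar>f (x + ?e *\<^sub>R z) - f x\<bar>" for z
    proof -
      have "indicator S z * ?a z - indicator S z * ?b z = (f (x + ?e *\<^sub>R z) - f x) / real n * indicator S z"
        by (simp add: algebra_simps diff_divide_distrib)
      then show ?thesis using nr by (simp add: abs_mult)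
    qed
    ultimately show ?thesis by (simp only:)
  qed
  have D0: "0 \<le> D" by (simp add: D_def local_oscillation_def)
  have C0: "0 \<le> C" using D0 f_nonneg[of x] by (simp add: C_def)
  have Db: "(\<integral>z. indicator S z * \<bar>?a z - ?b z\<bar> \<partial>lborel) = D / real n"
  proof -
    have "indicator S z * \<bar>?a z - ?b z\<bar> = indicator S z * \<bar>f (x + ?e *\<^sub>R z) - f x\<bar> / real n" for z
      using nr by (simp add: diff_divide_distrib[symmetric])
    then show ?thesis by (simp add: D_def local_oscillation_def)
  qed
  have Cb: "(\<integral>z. indicator S z * ?b z \<partial>lborel) \<le> C / real n"
    using nr D0 Sfin by (simp add: C_def divide_right_mono mult.commute)
  have Ca: "(\<integral>z. indicator S z * ?a z \<partial>lborel) \<le> C / real n"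
  proof -
    have "(\<integral>z. indicator S z * ?a z \<partial>lborel) \<le> (\<integral>z. (indicator S z * \<bar>f (x + ?e *\<^sub>R z) - f x\<bar> + indicator S z * f x) / real n \<partial>lborel)"
    proof (rule integral_mono[OF iSa])
      show "integrable lborel (\<lambda>z. (indicator S z * \<bar>f (x + ?e *\<^sub>R z) - f x\<bar> + indicator S z * f x) / real n)"
        using iD iS by simp
      show "indicator S z * ?a z \<le> (indicator S z * \<bar>f (x + ?e *\<^sub>R z) - f x\<bar> + indicator S z * f x) / real n" for z
        using nr by (auto simp: indicator_def intro!: divide_right_mono)
    qed
    also have "\<dots> = C / real n"
      using iD iS Sfin by (simp add: C_def D_def local_oscillation_def mult.commute add.commute)
    finally show ?thesis .
  qed
  have mF: "?F \<in> borel_measurable (PiM {..<m} (\<lambda>_. borel))"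
    by (rule measurable_cluster_weight[OF r]) (auto intro!: measurable_component_singleton)
  have bF: "\<bar>?F z\<bar> \<le> 2 ^ m" for z
    using abs_cluster_weight_le[of "{..<m}" k ?r "z(m := 0)" "\<lambda>i. i" m] by simp
  have sF: "?F z = 0" if "z \<in> extensional {..<m}" "z \<notin> PiE {..<m} (\<lambda>_. S)" for z
    using that R by (intro cluster_weight_far[where R=R]) (auto simp: S_def)
  have am: "?a \<in> borel_measurable borel" by measurable
  have diff: "\<bar>(\<integral>z. ?F z \<partial>PiM {..<m} (\<lambda>_. zoomed_law n x)) - (\<integral>z. ?F z \<partial>PiM {..<m} (\<lambda>_. scaled_lborel (f x / real n)))\<bar>
    \<le> real m * 2 ^ m * (C / real n) ^ (m - 1) * (D / real n)"
    by (rule PiM_density_integral_diff[OF am _ S _ _ iSa Ca iSb Cb _ mF bF sF])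
      (use f_nonneg Db in auto)
  have scaled: "(\<integral>z. ?F z \<partial>PiM {..<m} (\<lambda>_. scaled_lborel (f x / real n))) = (f x / real n) ^ m * cluster_integral TYPE('a) k m"
    using f_nonneg mF by (subst integral_PiM_scaled_lborel) (auto simp: cluster_integral_def)
  let ?M = "mean_cluster_weight center_law k (ball_radius TYPE('a) (1 / real n)) m x"
  have M: "?M = (\<integral>z. ?F z \<partial>PiM {..<m} (\<lambda>_. zoomed_law n x))" by (rule mean_cluster_weight_zoom[OF n])
  have "real n ^ m * ?M - f x ^ m * cluster_integral TYPE('a) k m = real n ^ m * (?M - (f x / real n) ^ m * cluster_integral TYPE('a) k m)"
    using nr by (simp add: right_diff_distrib power_divide)
  then have "\<bar>real n ^ m * ?M - f x ^ m * cluster_integral TYPE('a) k m\<bar> = real n ^ m * \<bar>?M - (f x / real n) ^ m * cluster_integral TYPE('a) k m\<bar>"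
    using nr by (simp add: abs_mult)
  also have "\<dots> \<le> real n ^ m * (real m * 2 ^ m * (C / real n) ^ (m - 1) * (D / real n))"
    using diff unfolding scaled M by (intro mult_left_mono) auto
  also have "\<dots> = real m * 2 ^ m * C ^ (m - 1) * D"
    using nr by (cases m) (auto simp: power_divide)
  finally show "\<bar>real n ^ m * ?M - f x ^ m * cluster_integral TYPE('a) k m\<bar> \<le> real m * 2 ^ m * C ^ (m - 1) * D" .
  have "emeasure (zoomed_law n x) S \<le> ennreal (C / real n)"
    using emeasure_density_lborel_eq_integral[OF am S _ iSa] Ca f_nonneg by (simp add: ennreal_leI)
  then have "\<bar>?M\<bar> \<le> 2 ^ m * (C / real n) ^ m"
    unfolding M using C0 nr bF sF mF prob_space_imp_sigma_finite[OF pa]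
    by (intro PiM_integral_bounded_support(2)[where S=S])
      (auto simp: space_PiM PiE_def cong: measurable_cong_sets sets_PiM_cong)
  then have "real n ^ m * \<bar>?M\<bar> \<le> real n ^ m * (2 ^ m * (C / real n) ^ m)"
    by (intro mult_left_mono) auto
  also have "\<dots> = (2 * C) ^ m" using nr by (simp add: power_divide power_mult_distrib)
  finally show "\<bar>real n ^ m * ?M\<bar> \<le> (2 * C) ^ m" using nr by (simp add: abs_mult)
qed

proposition mean_cluster_weight_limit:
  assumes N: "\<And>j. 0 < N j" and R: "unit_range TYPE('a) k \<le> R"
    and osc: "(\<lambda>j. local_oscillation f (ball 0 R) (side_length TYPE('a) (N j)) x) \<longlonglongrightarrow> 0"
  shows "(\<lambda>j. real (N j) ^ m * mean_cluster_weight center_law k (ball_radius TYPE('a) (1 / real (N j))) m x)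
      \<longlonglongrightarrow> f x ^ m * cluster_integral TYPE('a) k m"
    and "\<exists>C\<ge>0. \<forall>j m. \<bar>real (N j) ^ m * mean_cluster_weight center_law k (ball_radius TYPE('a) (1 / real (N j))) m x\<bar> \<le> C ^ m"
proof -
  let ?S = "ball (0::'a) R"
  let ?D = "\<lambda>j. local_oscillation f ?S (side_length TYPE('a) (N j)) x"
  let ?M = "\<lambda>j m. real (N j) ^ m * mean_cluster_weight center_law k (ball_radius TYPE('a) (1 / real (N j))) m x"
  note est = mean_cluster_weight_estimate[OF N R]
  have D0: "0 \<le> ?D j" for j by (simp add: local_oscillation_def)
  have "(\<lambda>j. real m * 2 ^ m * (f x * measure lborel ?S + ?D j) ^ (m - 1) * ?D j) \<longlonglongrightarrow> real m * 2 ^ m * (f x * measure lborel ?S + 0) ^ (m - 1) * 0"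
    by (intro tendsto_intros osc)
  then have lim0: "(\<lambda>j. real m * 2 ^ m * (f x * measure lborel ?S + ?D j) ^ (m - 1) * ?D j) \<longlonglongrightarrow> 0" by simp
  have "(\<lambda>j. ?M j m - f x ^ m * cluster_integral TYPE('a) k m) \<longlonglongrightarrow> 0"
    by (rule Lim_null_comparison[OF _ lim0]) (use est(2) in \<open>auto intro!: always_eventually\<close>)
  then show "(\<lambda>j. ?M j m) \<longlonglongrightarrow> f x ^ m * cluster_integral TYPE('a) k m" by (simp add: LIM_zero_iff)
  obtain B where B: "\<And>j. ?D j \<le> B"
  proof -
    have "Bseq ?D" using osc by (intro convergent_imp_Bseq) (auto simp: convergent_def)
    then obtain B where "\<And>j. norm (?D j) \<le> B" by (auto simp: Bseq_def)
    then have "?D j \<le> B" for j using abs_le_D1[of "?D j" B] by simp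
    then show thesis by (rule that)
  qed
  let ?C = "2 * (f x * measure lborel ?S + B)"
  have B0: "0 \<le> B" using B[of 0] D0[of 0] by linarith
  show "\<exists>C\<ge>0. \<forall>j m. \<bar>?M j m\<bar> \<le> C ^ m"
  proof (intro exI[of _ ?C] conjI allI)
    show "0 \<le> ?C" using B0 f_nonneg[of x] by simp
    fix j m
    have "\<bar>?M j m\<bar> \<le> (2 * (f x * measure lborel ?S + ?D j)) ^ m" by (rule est(1))
    also have "\<dots> \<le> ?C ^ m" using B[of j] D0[of j] f_nonneg[of x] by (intro power_mono) auto
    finally show "\<bar>?M j m\<bar> \<le> ?C ^ m" .
  qed
qed

end

section \<open>Sums over clusters of indices\<close>

text \<open>A site together with a cluster of earlier labels is the same thing as a nonempty set, whose
  maximum is the site.\<close>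

lemma sum_nonempty_subsets_Max:
  fixes J :: "nat set" and F :: "nat set \<Rightarrow> nat \<Rightarrow> real"
  assumes "finite J"
  shows "(\<Sum>i\<in>J. \<Sum>T\<in>Pow {l\<in>J. l < i}. F (insert i T) (card T)) = (\<Sum>W\<in>Pow J - {{}}. F W (card W - 1))"
proof -
  have "(\<Sum>i\<in>J. \<Sum>T\<in>Pow {l\<in>J. l < i}. F (insert i T) (card T))
    = (\<Sum>(i, T)\<in>(SIGMA i : J. Pow {l\<in>J. l < i}). F (insert i T) (card T))"
    using assms by (intro sum.Sigma) auto
  also have "\<dots> = (\<Sum>W\<in>Pow J - {{}}. F W (card W - 1))"
  proof (rule sum.reindex_bij_witness[where i="\<lambda>W. (Max W, W - {Max W})" and j="\<lambda>(i, T). insert i T"])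
    fix p assume p: "p \<in> (SIGMA i : J. Pow {l\<in>J. l < i})"
    obtain i T where pe: "p = (i, T)" by (cases p)
    have iT: "i \<in> J" "T \<subseteq> {l\<in>J. l < i}" using p pe by auto
    have finT: "finite T" using iT assms by (auto intro: finite_subset)
    have "Max (insert i T) = i" using iT finT by (intro Max_eqI) auto
    moreover have "i \<notin> T" using iT by auto
    ultimately show "(\<lambda>W. (Max W, W - {Max W})) ((\<lambda>(i, T). insert i T) p) = p" using pe by auto
    show "(\<lambda>(i, T). insert i T) p \<in> Pow J - {{}}" using iT pe by auto
    show "F ((\<lambda>(i, T). insert i T) p) (card ((\<lambda>(i, T). insert i T) p) - 1) = (case p of (i, T) \<Rightarrow> F (insert i T) (card T))"
      using \<open>i \<notin> T\<close> finT pe by simp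
  next
    fix W assume W: "W \<in> Pow J - {{}}"
    then have finW: "finite W" "W \<noteq> {}" using assms finite_subset by auto
    then have M: "Max W \<in> W" by (rule Max_in)
    show "(\<lambda>(i, T). insert i T) (Max W, W - {Max W}) = W" using M by auto
    have "l < Max W" if "l \<in> W - {Max W}" for l using Max_ge[OF finW(1), of l] that by auto
    then show "(Max W, W - {Max W}) \<in> (SIGMA i : J. Pow {l\<in>J. l < i})" using M W by auto
  qed
  finally show ?thesis .
qed

lemma sum_nonempty_subsets_card:
  fixes h :: "nat \<Rightarrow> real"
  assumes "finite A" "card A \<le> n"
  shows "(\<Sum>W\<in>Pow A - {{}}. h (card W - 1)) = (\<Sum>m<n. real (card A choose Suc m) * h m)"
proof -
  have "(\<Sum>W\<in>Pow A - {{}}. h (card W - 1))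
     = (\<Sum>m<n. \<Sum>W\<in>{W\<in>Pow A - {{}}. card W - 1 = m}. h (card W - 1))"
  proof (rule sum.group[symmetric])
    show "(\<lambda>W. card W - 1) ` (Pow A - {{}}) \<subseteq> {..<n}"
    proof
      fix k assume "k \<in> (\<lambda>W. card W - 1) ` (Pow A - {{}})"
      then obtain W where W: "W \<subseteq> A" "W \<noteq> {}" "k = card W - 1" by auto
      then have "finite W" using assms finite_subset by auto
      then have "0 < card W" "card W \<le> card A" using W assms by (auto simp: card_gt_0_iff intro: card_mono)
      then show "k \<in> {..<n}" using W assms by auto
    qed
  qed (use assms in auto)
  also have "\<dots> = (\<Sum>m<n. real (card A choose Suc m) * h m)"
  proof (rule sum.cong)
    fix m
    have eq: "{W\<in>Pow A - {{}}. card W - 1 = m} = {W. W \<subseteq> A \<and> card W = Suc m}"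
    proof (intro set_eqI iffI)
      fix W assume "W \<in> {W\<in>Pow A - {{}}. card W - 1 = m}"
      then have W: "W \<subseteq> A" "W \<noteq> {}" "card W - 1 = m" by auto
      then have "0 < card W" using assms finite_subset by (auto simp: card_gt_0_iff)
      then show "W \<in> {W. W \<subseteq> A \<and> card W = Suc m}" using W by auto
    qed auto
    have "(\<Sum>W\<in>{W\<in>Pow A - {{}}. card W - 1 = m}. h (card W - 1)) = (\<Sum>W\<in>{W. W \<subseteq> A \<and> card W = Suc m}. h m)"
      unfolding eq by (intro sum.cong) auto
    also have "\<dots> = real (card A choose Suc m) * h m" using assms by (simp add: n_subsets)
    finally show "(\<Sum>W\<in>{W\<in>Pow A - {{}}. card W - 1 = m}. h (card W - 1)) = real (card A choose Suc m) * h m" .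
  qed simp
  finally show ?thesis .
qed

text \<open>Pairs of disjoint nonempty sets of labels of sizes \<open>m + 1\<close> and \<open>m' + 1\<close> are counted by choosing
  the first set and then the second one in its complement.\<close>

lemma sum_disjoint_clusters:
  fixes J :: "nat set" and a b :: "nat \<Rightarrow> real"
  assumes J: "finite J" and n: "card J = n"
  shows "(\<Sum>i\<in>J. \<Sum>j\<in>J. \<Sum>T\<in>Pow {l\<in>J. l < i}. \<Sum>T'\<in>Pow {l\<in>J. l < j}.
      if insert i T \<inter> insert j T' = {} then a (card T) * b (card T') else 0)
    = (\<Sum>m<n. \<Sum>m'<n. real (n choose Suc m) * real ((n - Suc m) choose Suc m') * (a m * b m'))"
proof -
  have "(\<Sum>i\<in>J. \<Sum>j\<in>J. \<Sum>T\<in>Pow {l\<in>J. l < i}. \<Sum>T'\<in>Pow {l\<in>J. l < j}.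
      if insert i T \<inter> insert j T' = {} then a (card T) * b (card T') else 0)
    = (\<Sum>i\<in>J. \<Sum>T\<in>Pow {l\<in>J. l < i}. \<Sum>j\<in>J. \<Sum>T'\<in>Pow {l\<in>J. l < j}.
      if insert i T \<inter> insert j T' = {} then a (card T) * b (card T') else 0)"
    by (intro sum.cong refl sum.swap)
  also have "\<dots> = (\<Sum>W\<in>Pow J - {{}}. \<Sum>j\<in>J. \<Sum>T'\<in>Pow {l\<in>J. l < j}.
      if W \<inter> insert j T' = {} then a (card W - 1) * b (card T') else 0)"
    using sum_nonempty_subsets_Max[OF J, of "\<lambda>W m. \<Sum>j\<in>J. \<Sum>T'\<in>Pow {l\<in>J. l < j}.
      if W \<inter> insert j T' = {} then a m * b (card T') else 0"] by simp
  also have "\<dots> = (\<Sum>W\<in>Pow J - {{}}. \<Sum>W'\<in>Pow J - {{}}. if W \<inter> W' = {} then a (card W - 1) * b (card W' - 1) else 0)"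
  proof (rule sum.cong)
    fix W
    show "(\<Sum>j\<in>J. \<Sum>T'\<in>Pow {l\<in>J. l < j}. if W \<inter> insert j T' = {} then a (card W - 1) * b (card T') else 0)
      = (\<Sum>W'\<in>Pow J - {{}}. if W \<inter> W' = {} then a (card W - 1) * b (card W' - 1) else 0)"
      using sum_nonempty_subsets_Max[OF J, of "\<lambda>W' m. if W \<inter> W' = {} then a (card W - 1) * b m else 0"] by simp
  qed simp
  also have "\<dots> = (\<Sum>W\<in>Pow J - {{}}. a (card W - 1) * (\<Sum>m'<n. real ((n - Suc (card W - 1)) choose Suc m') * b m'))"
  proof (rule sum.cong)
    fix W assume W: "W \<in> Pow J - {{}}"
    have "finite W" using W J finite_subset by auto
    then have cW: "card (J - W) = n - Suc (card W - 1)"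
      using W n by (auto simp: card_Diff_subset card_gt_0_iff)
    have "(\<Sum>W'\<in>Pow J - {{}}. if W \<inter> W' = {} then a (card W - 1) * b (card W' - 1) else 0)
      = (\<Sum>W'\<in>Pow (J - W) - {{}}. a (card W - 1) * b (card W' - 1))"
      using J by (intro sum.mono_neutral_cong_right) auto
    also have "\<dots> = a (card W - 1) * (\<Sum>W'\<in>Pow (J - W) - {{}}. b (card W' - 1))"
      by (simp add: sum_distrib_left)
    also have "(\<Sum>W'\<in>Pow (J - W) - {{}}. b (card W' - 1)) = (\<Sum>m'<n. real (card (J - W) choose Suc m') * b m')"
      using J by (intro sum_nonempty_subsets_card) (auto simp: n[symmetric] intro: card_mono)
    finally show "(\<Sum>W'\<in>Pow J - {{}}. if W \<inter> W' = {} then a (card W - 1) * b (card W' - 1) else 0)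
      = a (card W - 1) * (\<Sum>m'<n. real ((n - Suc (card W - 1)) choose Suc m') * b m')" unfolding cW .
  qed simp
  also have "\<dots> = (\<Sum>m<n. real (card J choose Suc m) * (a m * (\<Sum>m'<n. real ((n - Suc m) choose Suc m') * b m')))"
    using J n by (intro sum_nonempty_subsets_card) auto
  finally show ?thesis by (simp add: n sum_distrib_left mult_ac)
qed

lemma binomial_ratio_le: "real (n choose k) / real n ^ k \<le> 1 / fact k"
proof (cases "n = 0")
  case True
  then show ?thesis by (cases k) auto
next
  case False
  have "real ((n choose k) * fact k) \<le> real (n ^ k)" using binomial_fact_pow[of n k] of_nat_le_iff by blast
  then show ?thesis using False by (simp add: field_simps)
qed

lemma double_tannery:
  fixes q a b :: "nat \<Rightarrow> nat \<Rightarrow> real" and p :: "nat \<Rightarrow> nat \<Rightarrow> nat \<Rightarrow> real"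
  assumes a: "\<And>m. (\<lambda>j. a j m) \<longlonglongrightarrow> \<alpha> m" "\<And>j m. \<bar>a j m\<bar> \<le> A m"
    and b: "\<And>m. (\<lambda>j. b j m) \<longlonglongrightarrow> \<beta> m" "\<And>j m. \<bar>b j m\<bar> \<le> B m"
    and p: "\<And>m m'. (\<lambda>j. p j m m') \<longlonglongrightarrow> 1" "\<And>j m m'. 0 \<le> p j m m' \<and> p j m m' \<le> 1"
    and A: "summable A" and B: "summable B"
  shows "(\<lambda>j. \<Sum>m. \<Sum>m'. p j m m' * (a j m * b j m')) \<longlonglongrightarrow> (\<Sum>m. \<alpha> m) * (\<Sum>m'. \<beta> m')"
proof -
  have A0: "0 \<le> A m" for m
    using a(2)[of undefined m] abs_ge_zero order_trans by blast
  have term_le: "\<bar>p j m m' * (a j m * b j m')\<bar> \<le> A m * B m'" for j m m'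
  proof -
    have "\<bar>p j m m' * (a j m * b j m')\<bar> = p j m m' * (\<bar>a j m\<bar> * \<bar>b j m'\<bar>)"
      using p(2)[of j m m'] by (simp add: abs_mult)
    also have "\<dots> \<le> 1 * (A m * B m')"
      using p(2)[of j m m'] a(2)[of j m] b(2)[of j m'] A0[of m] by (intro mult_mono) auto
    finally show ?thesis by simp
  qed
  have inner_lim: "(\<lambda>j. \<Sum>m'. p j m m' * (a j m * b j m')) \<longlonglongrightarrow> (\<Sum>m'. \<alpha> m * \<beta> m')" for m
  proof -
    have "(\<lambda>j. p j m m' * (a j m * b j m')) \<longlonglongrightarrow> 1 * (\<alpha> m * \<beta> m')" for m'
      by (intro tendsto_intros a b p)
    then show ?thesis
      using tannerys_theorem[where a="\<lambda>m' j. p j m m' * (a j m * b j m')" and b="\<lambda>m'. \<alpha> m * \<beta> m'" and M="\<lambda>m'. A m * B m'" and F=sequentially]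
        term_le B by (auto intro!: always_eventually summable_mult)
  qed
  have inner_le: "\<bar>\<Sum>m'. p j m m' * (a j m * b j m')\<bar> \<le> A m * (\<Sum>m'. B m')" for j m
  proof -
    have s: "summable (\<lambda>m'. \<bar>p j m m' * (a j m * b j m')\<bar>)"
      by (rule summable_comparison_test_ev[OF _ summable_mult[OF B, of "A m"]])
        (use term_le in \<open>auto intro!: always_eventually\<close>)
    have "\<bar>\<Sum>m'. p j m m' * (a j m * b j m')\<bar> \<le> (\<Sum>m'. \<bar>p j m m' * (a j m * b j m')\<bar>)"
      using s by (rule summable_rabs)
    also have "\<dots> \<le> (\<Sum>m'. A m * B m')"
      using term_le s summable_mult[OF B] by (intro suminf_le) auto
    finally show ?thesis using B by (simp add: suminf_mult)
  qed
  have "(\<lambda>j. \<Sum>m. \<Sum>m'. p j m m' * (a j m * b j m')) \<longlonglongrightarrow> (\<Sum>m. \<Sum>m'. \<alpha> m * \<beta> m')"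
    using tannerys_theorem[where a="\<lambda>m j. \<Sum>m'. p j m m' * (a j m * b j m')" and b="\<lambda>m. \<Sum>m'. \<alpha> m * \<beta> m'"
        and M="\<lambda>m. A m * (\<Sum>m'. B m')" and F=sequentially]
      inner_lim inner_le A by (auto intro!: always_eventually summable_mult2)
  moreover have "(\<Sum>m. \<Sum>m'. \<alpha> m * \<beta> m') = (\<Sum>m. \<alpha> m) * (\<Sum>m'. \<beta> m')"
  proof -
    have lim_le: "\<bar>\<alpha> m\<bar> \<le> A m" "\<bar>\<beta> m\<bar> \<le> B m" for m
      using LIMSEQ_le_const2[OF tendsto_rabs[OF a(1)[of m]]] LIMSEQ_le_const2[OF tendsto_rabs[OF b(1)[of m]]] a(2) b(2)
      by blast+
    have "summable \<alpha>" "summable \<beta>"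
      using summable_comparison_test_ev[OF _ A, of \<alpha>] summable_comparison_test_ev[OF _ B, of \<beta>] lim_le
      by (auto intro!: always_eventually)
    then show ?thesis by (simp add: suminf_mult suminf_mult2)
  qed
  ultimately show ?thesis by simp
qed

text \<open>Both binomials together are asymptotic to \<open>n^(m + m' + 2) / ((m+1)! (m'+1)!)\<close>; two of the powers
  of \<open>n\<close> cancel against the normalisation and the others rescale \<open>a\<close> and \<open>b\<close>. The factorials make
  the geometric bounds summable.\<close>

lemma disjoint_cluster_sum_limit:
  fixes N :: "nat \<Rightarrow> nat" and a b :: "nat \<Rightarrow> nat \<Rightarrow> real"
  assumes N: "filterlim N at_top sequentially" "\<And>j. 0 < N j"
    and a: "\<And>m. (\<lambda>j. real (N j) ^ m * a j m) \<longlonglongrightarrow> \<alpha> m" "\<And>j m. \<bar>real (N j) ^ m * a j m\<bar> \<le> A ^ m"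
    and b: "\<And>m. (\<lambda>j. real (N j) ^ m * b j m) \<longlonglongrightarrow> \<beta> m" "\<And>j m. \<bar>real (N j) ^ m * b j m\<bar> \<le> B ^ m"
    and A: "0 \<le> A" and B: "0 \<le> B"
  shows "(\<lambda>j. (\<Sum>m<N j. \<Sum>m'<N j. real (N j choose Suc m) * real ((N j - Suc m) choose Suc m') * (a j m * b j m')) / (real (N j))\<^sup>2)
    \<longlonglongrightarrow> (\<Sum>m. \<alpha> m / fact (Suc m)) * (\<Sum>m. \<beta> m / fact (Suc m))"
proof -
  \<comment> \<open>The ratio of the actual count to its asymptotic value; it lies in \<open>[0, 1]\<close> and tends to \<open>1\<close>.\<close>
  define p where "p j m m' = (real (N j choose Suc m) / real (N j) ^ Suc m * fact (Suc m)) *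
      (real ((N j - Suc m) choose Suc m') / real (N j) ^ Suc m' * fact (Suc m'))" for j m m'
  let ?a = "\<lambda>j m. real (N j) ^ m * a j m / fact (Suc m)" and ?b = "\<lambda>j m. real (N j) ^ m * b j m / fact (Suc m)"
  have ratio: "0 \<le> real (n choose k) / real n' ^ k * fact k \<and> real (n choose k) / real n' ^ k * fact k \<le> 1" if "n \<le> n'" "0 < n'" for n n' k
  proof -
    have "real (n choose k) / real n' ^ k \<le> real (n' choose k) / real n' ^ k"
      using that by (intro divide_right_mono) (auto intro: binomial_right_mono)
    also have "\<dots> \<le> 1 / fact k" by (rule binomial_ratio_le)
    finally show ?thesis by (simp add: field_simps)
  qed
  have p_le: "0 \<le> p j m m' \<and> p j m m' \<le> 1" for j m m'
    unfolding p_def using ratio[of "N j" "N j" "Suc m"] ratio[of "N j - Suc m" "N j" "Suc m'"] N(2)[of j]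
    by (metis diff_le_self mult_le_one mult_nonneg_nonneg order_refl)
  have lim1: "(\<lambda>j. real (L j choose k) / real (L j) ^ k * fact k) \<longlonglongrightarrow> 1" if "filterlim L at_top sequentially" for L :: "nat \<Rightarrow> nat" and k
  proof -
    have "(\<lambda>n. \<Prod>i<k. 1 - real i * (1 / real n)) \<longlonglongrightarrow> (\<Prod>i<k. 1 - real i * 0)"
      by (intro tendsto_intros lim_1_over_n)
    moreover have "\<forall>\<^sub>F n in sequentially. (\<Prod>i<k. 1 - real i * (1 / real n)) = real (n choose k) / real n ^ k * fact k"
      using eventually_gt_at_top[of "0::nat"]
    proof eventually_elim
      case (elim n)
      have "real (n choose k) * fact k = ffact_real (real n) k"
        by (cases "n < k") (auto simp: ffact_real_nat binomial_eq_0 binomial_fact)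
      then have "real (n choose k) / real n ^ k * fact k = (\<Prod>i<k. real n - real i) / (\<Prod>i<k. real n)"
        by (simp add: ffact_real_def)
      also have "\<dots> = (\<Prod>i<k. (real n - real i) / real n)" by (rule prod_dividef[symmetric])
      also have "\<dots> = (\<Prod>i<k. 1 - real i * (1 / real n))"
        using elim by (intro prod.cong) (auto simp: diff_divide_distrib)
      finally show ?case by simp
    qed
    ultimately have "(\<lambda>n. real (n choose k) / real n ^ k * fact k) \<longlonglongrightarrow> (\<Prod>i<k. 1 - real i * 0)"
      by (rule Lim_transform_eventually)
    then have "(\<lambda>n. real (n choose k) / real n ^ k * fact k) \<longlonglongrightarrow> 1"
      by simp
    from filterlim_compose[OF this that] show ?thesis .
  qed
  have p_lim: "(\<lambda>j. p j m m') \<longlonglongrightarrow> 1" for m m'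
  proof -
    have shift: "filterlim (\<lambda>j. N j - Suc m) at_top sequentially"
      using filterlim_compose[OF filterlim_minus_const_nat_at_top N(1)] .
    have frac: "(\<lambda>j. real (N j - Suc m) / real (N j)) \<longlonglongrightarrow> 1"
    proof -
      have "(\<lambda>n. 1 - real (Suc m) * (1 / real n)) \<longlonglongrightarrow> 1 - real (Suc m) * 0"
        by (intro tendsto_intros lim_1_over_n)
      moreover have "\<forall>\<^sub>F n in sequentially. 1 - real (Suc m) * (1 / real n) = real (n - Suc m) / real n"
        using eventually_gt_at_top[of "Suc m"]
        by eventually_elim (simp add: of_nat_diff field_simps)
      ultimately have "(\<lambda>n. real (n - Suc m) / real n) \<longlonglongrightarrow> 1 - real (Suc m) * 0"
        by (rule Lim_transform_eventually)
      then have "(\<lambda>n. real (n - Suc m) / real n) \<longlonglongrightarrow> 1" by simp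
      from filterlim_compose[OF this N(1)] show ?thesis .
    qed
    have "(\<lambda>j. (real ((N j - Suc m) choose Suc m') / real (N j - Suc m) ^ Suc m' * fact (Suc m')) * (real (N j - Suc m) / real (N j)) ^ Suc m') \<longlonglongrightarrow> 1 * 1 ^ Suc m'"
      by (intro tendsto_mult lim1[OF shift] tendsto_power frac)
    moreover have "\<forall>\<^sub>F j in sequentially. (real ((N j - Suc m) choose Suc m') / real (N j - Suc m) ^ Suc m' * fact (Suc m')) * (real (N j - Suc m) / real (N j)) ^ Suc m'
        = real ((N j - Suc m) choose Suc m') / real (N j) ^ Suc m' * fact (Suc m')"
    proof -
      have "\<forall>\<^sub>F j in sequentially. 0 < N j - Suc m"
        using shift eventually_gt_at_top[of "0::nat"] unfolding filterlim_iff by blast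
      then show ?thesis by eventually_elim (simp add: power_divide)
    qed
    ultimately have "(\<lambda>j. real ((N j - Suc m) choose Suc m') / real (N j) ^ Suc m' * fact (Suc m')) \<longlonglongrightarrow> 1 * 1 ^ Suc m'"
      by (rule Lim_transform_eventually)
    then have "(\<lambda>j. real ((N j - Suc m) choose Suc m') / real (N j) ^ Suc m' * fact (Suc m')) \<longlonglongrightarrow> 1" by simp
    from tendsto_mult[OF lim1[OF N(1), of "Suc m"] this] show ?thesis by (simp add: p_def)
  qed
  have "(\<lambda>j. \<Sum>m. \<Sum>m'. p j m m' * (?a j m * ?b j m')) \<longlonglongrightarrow> (\<Sum>m. \<alpha> m / fact (Suc m)) * (\<Sum>m. \<beta> m / fact (Suc m))"
  proof (rule double_tannery[where A="\<lambda>m. A ^ m /\<^sub>R fact m" and B="\<lambda>m. B ^ m /\<^sub>R fact m"])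
    have le: "\<bar>c / fact (Suc m)\<bar> \<le> d /\<^sub>R fact m" if "\<bar>c\<bar> \<le> d" for c d :: real and m
    proof -
      have "\<bar>c\<bar> / fact (Suc m) \<le> d / fact m"
        using that by (intro frac_le) (auto intro: fact_mono)
      then show ?thesis by (simp add: abs_mult divide_inverse mult.commute del: fact_Suc)
    qed
    show "\<bar>?a j m\<bar> \<le> A ^ m /\<^sub>R fact m" for j m by (rule le[OF a(2)])
    show "\<bar>?b j m\<bar> \<le> B ^ m /\<^sub>R fact m" for j m by (rule le[OF b(2)])
    show "summable (\<lambda>m. A ^ m /\<^sub>R fact m)" "summable (\<lambda>m. B ^ m /\<^sub>R fact m)"
      by (rule summable_exp_generic)+
  qed (auto intro!: tendsto_divide a b p_lim p_le)
  moreover have "(\<Sum>m. \<Sum>m'. p j m m' * (?a j m * ?b j m'))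
    = (\<Sum>m<N j. \<Sum>m'<N j. real (N j choose Suc m) * real ((N j - Suc m) choose Suc m') * (a j m * b j m')) / (real (N j))\<^sup>2" for j
  proof -
    have in0: "p j m m' = 0" if "N j \<le> m' \<or> N j \<le> m" for m m'
      using that by (auto simp: p_def binomial_eq_0)
    have "(\<Sum>m'. p j m m' * (?a j m * ?b j m')) = (\<Sum>m'<N j. p j m m' * (?a j m * ?b j m'))" for m
      by (rule suminf_finite) (use in0 in auto)
    moreover have "(\<Sum>m. \<Sum>m'<N j. p j m m' * (?a j m * ?b j m')) = (\<Sum>m<N j. \<Sum>m'<N j. p j m m' * (?a j m * ?b j m'))"
      by (rule suminf_finite) (use in0 in auto)
    moreover have "p j m m' * (?a j m * ?b j m') = real (N j choose Suc m) * real ((N j - Suc m) choose Suc m') * (a j m * b j m') / (real (N j))\<^sup>2" for m m'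
      using N(2)[of j] by (simp add: p_def power2_eq_square field_simps del: fact_Suc)
    ultimately show ?thesis by (simp add: sum_divide_distrib)
  qed
  ultimately show ?thesis by simp
qed

section \<open>Two points of an independent sample\<close>

lemma distr_PiM_two_coordinates:
  fixes J :: "'i set"
  assumes \<mu>: "prob_space \<mu>" and J: "finite J" "i \<in> J" "j \<in> J" "i \<noteq> j"
  defines "T \<equiv> \<lambda>(p, c). c(i := fst p, j := snd p)"
  shows "T \<in> (\<mu> \<Otimes>\<^sub>M \<mu>) \<Otimes>\<^sub>M PiM (J - {i, j}) (\<lambda>_. \<mu>) \<rightarrow>\<^sub>M PiM J (\<lambda>_. \<mu>)"
    and "distr ((\<mu> \<Otimes>\<^sub>M \<mu>) \<Otimes>\<^sub>M PiM (J - {i, j}) (\<lambda>_. \<mu>)) (PiM J (\<lambda>_. \<mu>)) T = PiM J (\<lambda>_. \<mu>)"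
proof -
  let ?K = "J - {i, j}" let ?M = "(\<mu> \<Otimes>\<^sub>M \<mu>) \<Otimes>\<^sub>M PiM ?K (\<lambda>_. \<mu>)"
  interpret mu: prob_space \<mu> by fact
  interpret P: product_prob_space "\<lambda>_::'i. \<mu>" by (intro product_prob_spaceI \<mu>)
  interpret K: prob_space "PiM ?K (\<lambda>_. \<mu>)" by (rule prob_space_PiM) (rule \<mu>)
  have Je: "J = insert j (insert i ?K)" using J by auto
  show meas: "T \<in> ?M \<rightarrow>\<^sub>M PiM J (\<lambda>_. \<mu>)"
  proof (rule measurable_PiM_single')
    show "(\<lambda>p. T p l) \<in> ?M \<rightarrow>\<^sub>M \<mu>" if l: "l \<in> J" for l
    proof -
      consider "l = j" | "l = i" | "l \<in> ?K" using l by auto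
      then show ?thesis
      proof cases
        case 3
        then have "(\<lambda>p. T p l) = (\<lambda>p. snd p l)" by (auto simp: T_def split: prod.splits)
        then show ?thesis using measurable_compose[OF measurable_snd measurable_component_singleton[OF 3]] by simp
      qed (use J in \<open>auto simp: T_def case_prod_beta'\<close>)
    qed
    show "T \<in> space ?M \<rightarrow> PiE J (\<lambda>_. space \<mu>)"
    proof
      fix q assume "q \<in> space ?M"
      then show "T q \<in> PiE J (\<lambda>_. space \<mu>)"
        using J by (auto simp: T_def space_pair_measure space_PiM PiE_iff extensional_def split: prod.splits)
    qed
  qed
  show "distr ?M (PiM J (\<lambda>_. \<mu>)) T = PiM J (\<lambda>_. \<mu>)"
  proof (rule P.PiM_eqI)
    fix A assume "\<And>l. l \<in> J \<Longrightarrow> A l \<in> sets \<mu>"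
    then have A: "l \<in> J \<Longrightarrow> A l \<in> sets \<mu>" for l by auto
    have sub: "A l \<subseteq> space \<mu>" if "l \<in> J" for l using A[OF that] by (rule sets.sets_into_space)
    have vim: "T -` PiE J A \<inter> space ?M = (A i \<times> A j) \<times> PiE ?K A"
    proof (intro set_eqI iffI)
      fix q assume q: "q \<in> T -` PiE J A \<inter> space ?M"
      obtain x y c where qe: "q = ((x, y), c)" by (metis surj_pair)
      have T: "c(i := x, j := y) \<in> PiE J A" using q by (simp add: qe T_def)
      have "x \<in> A i" using PiE_mem[OF T J(2)] J(4) by simp
      moreover have "y \<in> A j" using PiE_mem[OF T J(3)] by simp
      moreover have "c l \<in> A l" if "l \<in> ?K" for l using PiE_mem[OF T, of l] that by auto
      moreover have "c \<in> extensional ?K" using q by (auto simp: qe space_pair_measure space_PiM PiE_iff)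
      ultimately show "q \<in> (A i \<times> A j) \<times> PiE ?K A" by (auto simp: qe PiE_iff)
    next
      fix q assume q: "q \<in> (A i \<times> A j) \<times> PiE ?K A"
      obtain x y c where qe: "q = ((x, y), c)" by (metis surj_pair)
      have "c(i := x, j := y) \<in> PiE J A"
        using q J by (auto simp: qe PiE_iff extensional_def)
      moreover have "q \<in> space ?M"
        using q J sub by (auto simp: qe space_pair_measure space_PiM PiE_iff)
      ultimately show "q \<in> T -` PiE J A \<inter> space ?M" by (simp add: qe T_def)
    qed
    have AK: "PiE ?K A \<in> sets (PiM ?K (\<lambda>_. \<mu>))" using A J by (intro sets_PiM_I_finite) auto
    have "emeasure (distr ?M (PiM J (\<lambda>_. \<mu>)) T) (PiE J A) = emeasure ?M ((A i \<times> A j) \<times> PiE ?K A)"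
      using A J by (subst emeasure_distr[OF meas]) (auto simp: vim intro!: sets_PiM_I_finite)
    also have "\<dots> = emeasure (\<mu> \<Otimes>\<^sub>M \<mu>) (A i \<times> A j) * emeasure (PiM ?K (\<lambda>_. \<mu>)) (PiE ?K A)"
      using A J AK by (intro K.emeasure_pair_measure_Times) auto
    also have "\<dots> = emeasure \<mu> (A i) * emeasure \<mu> (A j) * (\<Prod>l\<in>?K. emeasure \<mu> (A l))"
    proof -
      have "emeasure (PiM ?K (\<lambda>_. \<mu>)) (PiE ?K A) = (\<Prod>l\<in>?K. emeasure \<mu> (A l))"
        by (rule P.emeasure_PiM) (use A J in auto)
      moreover have "emeasure (\<mu> \<Otimes>\<^sub>M \<mu>) (A i \<times> A j) = emeasure \<mu> (A i) * emeasure \<mu> (A j)"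
        by (rule mu.emeasure_pair_measure_Times[OF A[OF J(2)] A[OF J(3)]])
      ultimately show ?thesis by (simp only:)
    qed
    also have "\<dots> = (\<Prod>l\<in>J. emeasure \<mu> (A l))"
      using J by (subst (2) Je) (simp add: mult_ac)
    finally show "emeasure (distr ?M (PiM J (\<lambda>_. \<mu>)) T) (PiE J A) = (\<Prod>l\<in>J. emeasure \<mu> (A l))" .
  qed (use J in auto)
qed

text \<open>Conditioning an independent sample on two of its points.\<close>

lemma integral_PiM_two_coordinates:
  fixes F :: "('i \<Rightarrow> 'b) \<Rightarrow> real"
  assumes \<mu>: "prob_space \<mu>" and J: "finite J" "i \<in> J" "j \<in> J" "i \<noteq> j"
    and F: "F \<in> borel_measurable (PiM J (\<lambda>_. \<mu>))" "\<And>c. \<bar>F c\<bar> \<le> B"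
  shows "integrable (\<mu> \<Otimes>\<^sub>M \<mu>) (\<lambda>p. \<integral>c. F (c(i := fst p, j := snd p)) \<partial>PiM (J - {i, j}) (\<lambda>_. \<mu>))"
    and "(\<integral>c. F c \<partial>PiM J (\<lambda>_. \<mu>)) = (\<integral>p. (\<integral>c. F (c(i := fst p, j := snd p)) \<partial>PiM (J - {i, j}) (\<lambda>_. \<mu>)) \<partial>(\<mu> \<Otimes>\<^sub>M \<mu>))"
proof -
  let ?K = "J - {i, j}" let ?M = "(\<mu> \<Otimes>\<^sub>M \<mu>) \<Otimes>\<^sub>M PiM ?K (\<lambda>_. \<mu>)"
  let ?T = "\<lambda>(p, c). c(i := fst p, j := snd p)"
  interpret mu: prob_space \<mu> by fact
  interpret mm: pair_prob_space \<mu> \<mu> ..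
  interpret K: prob_space "PiM ?K (\<lambda>_. \<mu>)" by (rule prob_space_PiM) (rule \<mu>)
  interpret MK: pair_prob_space "\<mu> \<Otimes>\<^sub>M \<mu>" "PiM ?K (\<lambda>_. \<mu>)" ..
  note T = distr_PiM_two_coordinates[OF \<mu> J]
  have FT: "(\<lambda>q. F (?T q)) \<in> borel_measurable ?M" using T(1) F(1) by (rule measurable_compose)
  have int: "integrable ?M (\<lambda>q. F (?T q))"
    by (rule MK.integrable_const_bound[where B=B]) (use F(2) FT in auto)
  show "integrable (\<mu> \<Otimes>\<^sub>M \<mu>) (\<lambda>p. \<integral>c. F (c(i := fst p, j := snd p)) \<partial>PiM ?K (\<lambda>_. \<mu>))"
    using MK.integrable_fst'[OF int] by (simp only: prod.case)
  have "(\<integral>c. F c \<partial>PiM J (\<lambda>_. \<mu>)) = (\<integral>c. F c \<partial>distr ?M (PiM J (\<lambda>_. \<mu>)) ?T)" unfolding T(2) ..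
  also have "\<dots> = (\<integral>q. F (?T q) \<partial>?M)" by (rule integral_distr[OF T(1) F(1)])
  also have "\<dots> = (\<integral>p. (\<integral>c. F (c(i := fst p, j := snd p)) \<partial>PiM ?K (\<lambda>_. \<mu>)) \<partial>(\<mu> \<Otimes>\<^sub>M \<mu>))"
    using MK.integral_fst'[OF int] by (simp only: prod.case)
  finally show "(\<integral>c. F c \<partial>PiM J (\<lambda>_. \<mu>)) = (\<integral>p. (\<integral>c. F (c(i := fst p, j := snd p)) \<partial>PiM ?K (\<lambda>_. \<mu>)) \<partial>(\<mu> \<Otimes>\<^sub>M \<mu>))" .
qed

lemma integral_PiM_disjoint_blocks:
  fixes \<phi> \<psi> :: "('i \<Rightarrow> 'b) \<Rightarrow> real"
  assumes \<mu>: "prob_space \<mu>" and K: "finite K" "A \<union> B \<subseteq> K" "A \<inter> B = {}"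
    and \<phi>: "\<phi> \<in> borel_measurable (PiM A (\<lambda>_. \<mu>))" "\<And>z. \<bar>\<phi> z\<bar> \<le> b"
    and \<psi>: "\<psi> \<in> borel_measurable (PiM B (\<lambda>_. \<mu>))" "\<And>z. \<bar>\<psi> z\<bar> \<le> b'"
  shows "(\<integral>c. \<phi> (restrict c A) * \<psi> (restrict c B) \<partial>PiM K (\<lambda>_. \<mu>))
    = (\<integral>z. \<phi> z \<partial>PiM A (\<lambda>_. \<mu>)) * (\<integral>z. \<psi> z \<partial>PiM B (\<lambda>_. \<mu>))"
proof -
  interpret mu: prob_space \<mu> by fact
  interpret P: product_prob_space "\<lambda>_::'i. \<mu>" by (intro product_prob_spaceI \<mu>)
  interpret AB: prob_space "PiM (A \<union> B) (\<lambda>_. \<mu>)" by (rule prob_space_PiM) (rule \<mu>)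
  have fin: "finite A" "finite B" using K finite_subset by auto
  let ?G = "\<lambda>c. \<phi> (restrict c A) * \<psi> (restrict c B)"
  have rA: "(\<lambda>c. restrict c A) \<in> PiM (A \<union> B) (\<lambda>_. \<mu>) \<rightarrow>\<^sub>M PiM A (\<lambda>_. \<mu>)"
    and rB: "(\<lambda>c. restrict c B) \<in> PiM (A \<union> B) (\<lambda>_. \<mu>) \<rightarrow>\<^sub>M PiM B (\<lambda>_. \<mu>)"
    by (intro measurable_restrict_subset; auto)+
  have G: "?G \<in> borel_measurable (PiM (A \<union> B) (\<lambda>_. \<mu>))"
    using measurable_compose[OF rA \<phi>(1)] measurable_compose[OF rB \<psi>(1)] by (rule borel_measurable_times)
  have rK: "(\<lambda>c. \<lambda>l\<in>A \<union> B. c l) \<in> PiM K (\<lambda>_. \<mu>) \<rightarrow>\<^sub>M PiM (A \<union> B) (\<lambda>_. \<mu>)"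
    using K(2) by (intro measurable_restrict measurable_component_singleton) auto
  have d: "distr (PiM K (\<lambda>_. \<mu>)) (PiM (A \<union> B) (\<lambda>_. \<mu>)) (\<lambda>c. \<lambda>l\<in>A \<union> B. c l) = PiM (A \<union> B) (\<lambda>_. \<mu>)"
    using distr_PiM_reindex[of K "\<lambda>_. \<mu>" "\<lambda>l. l" "A \<union> B"] \<mu> K(2) by auto
  have "(\<integral>c. ?G c \<partial>PiM K (\<lambda>_. \<mu>)) = (\<integral>c. ?G (\<lambda>l\<in>A \<union> B. c l) \<partial>PiM K (\<lambda>_. \<mu>))"
    by (intro Bochner_Integration.integral_cong refl arg_cong2[where f="(*)"] arg_cong[where f=\<phi>] arg_cong[where f=\<psi>]) auto
  also have "\<dots> = (\<integral>c. ?G c \<partial>distr (PiM K (\<lambda>_. \<mu>)) (PiM (A \<union> B) (\<lambda>_. \<mu>)) (\<lambda>c. \<lambda>l\<in>A \<union> B. c l))"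
    by (rule integral_distr[OF rK G, symmetric])
  also have "\<dots> = (\<integral>c. ?G c \<partial>PiM (A \<union> B) (\<lambda>_. \<mu>))" unfolding d ..
  also have "\<dots> = (\<integral>x. (\<integral>y. ?G (merge A B (x, y)) \<partial>PiM B (\<lambda>_. \<mu>)) \<partial>PiM A (\<lambda>_. \<mu>))"
  proof (rule P.product_integral_fold[OF K(3) fin])
    show "integrable (PiM (A \<union> B) (\<lambda>_. \<mu>)) ?G"
    proof (rule AB.integrable_const_bound[where B="b * b'"])
      show "AE c in PiM (A \<union> B) (\<lambda>_. \<mu>). norm (?G c) \<le> b * b'"
        using \<phi>(2) \<psi>(2) by (intro AE_I2) (auto simp: abs_mult intro!: mult_mono order_trans[OF abs_ge_zero])
    qed (rule G)
  qed
  also have "\<dots> = (\<integral>x. (\<integral>y. \<phi> x * \<psi> y \<partial>PiM B (\<lambda>_. \<mu>)) \<partial>PiM A (\<lambda>_. \<mu>))"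
  proof (intro Bochner_Integration.integral_cong refl)
    fix x y assume "x \<in> space (PiM A (\<lambda>_. \<mu>))" "y \<in> space (PiM B (\<lambda>_. \<mu>))"
    then have "restrict (merge A B (x, y)) A = x" "restrict (merge A B (x, y)) B = y"
      using K(3) by (auto simp: space_PiM PiE_iff extensional_restrict)
    then show "?G (merge A B (x, y)) = \<phi> x * \<psi> y" by simp
  qed
  also have "\<dots> = (\<integral>z. \<phi> z \<partial>PiM A (\<lambda>_. \<mu>)) * (\<integral>z. \<psi> z \<partial>PiM B (\<lambda>_. \<mu>))" by simp
  finally show ?thesis .
qed

text \<open>Only the order of the labels matters and the points are exchangeable, so the mean weight
  depends on \<open>T\<close> through its size.\<close>

lemma cluster_weight_mean_block:
  fixes \<mu> :: "'a::euclidean_space measure" and T :: "nat set"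
  assumes \<mu>: "prob_space \<mu>" "sets \<mu> = sets borel" and r: "0 < r"
    and T: "finite T" "\<And>l. l \<in> T \<Longrightarrow> l < i"
  shows "(\<lambda>z. cluster_weight k r (z(i := x)) (\<lambda>l. l) T i) \<in> borel_measurable (PiM T (\<lambda>_. \<mu>))"
    and "(\<integral>z. cluster_weight k r (z(i := x)) (\<lambda>l. l) T i \<partial>PiM T (\<lambda>_. \<mu>)) = mean_cluster_weight \<mu> k r (card T) x"
proof -
  have meas: "(\<lambda>z. cluster_weight k r (z(i := x)) (\<lambda>l. l) T i) \<in> borel_measurable (PiM T (\<lambda>_. \<mu>))" if "finite T" "\<And>l. l \<in> T \<Longrightarrow> l < i" for T :: "nat set" and i
  proof -
    have "(\<lambda>z. cluster_weight k r (z(i := x)) (\<lambda>l. l) T i) \<in> borel_measurable (PiM T (\<lambda>_. borel :: 'a measure))"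
    proof (rule measurable_cluster_weight[OF r])
      fix j assume j: "j \<in> insert i T"
      show "(\<lambda>z. (z(i := x)) j) \<in> borel_measurable (PiM T (\<lambda>_. borel :: 'a measure))"
      proof (cases "j = i")
        case False
        then have "j \<in> T" using j by simp
        then show ?thesis using False by (simp add: measurable_component_singleton)
      qed simp
    qed simp
    moreover have "sets (PiM T (\<lambda>_. \<mu>)) = sets (PiM T (\<lambda>_. borel))" using \<mu>(2) by (intro sets_PiM_cong) auto
    ultimately show ?thesis using measurable_cong_sets[of "PiM T (\<lambda>_. \<mu>)" _ borel borel] by blast
  qed
  show "(\<lambda>z. cluster_weight k r (z(i := x)) (\<lambda>l. l) T i) \<in> borel_measurable (PiM T (\<lambda>_. \<mu>))" by (rule meas[OF T])
  let ?m = "card T"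
  obtain e where e: "bij_betw e {..<?m} T" "strict_mono_on {..<?m} e"
    by (rule ex_bij_betw_strict_mono_card[OF T(1)])
  have eT: "e l \<in> T" if "l < ?m" for l
    by (rule bij_betw_apply[OF e(1)]) (use that in simp)
  define e' where "e' = e(?m := i)"
  have im: "e' ` {..<?m} = T"
  proof -
    have "e' ` {..<?m} = e ` {..<?m}" by (intro image_cong) (auto simp: e'_def)
    also have "\<dots> = T" by (rule bij_betw_imp_surj_on[OF e(1)])
    finally show ?thesis .
  qed
  have inj: "inj_on e {..<?m}" using e(1) by (rule bij_betw_imp_inj_on)
  then have inj': "inj_on e' {..<?m}" by (simp add: e'_def inj_on_def)
  have ord: "e' a < e' b \<longleftrightarrow> a < b" if "a \<in> insert ?m {..<?m}" "b \<in> insert ?m {..<?m}" for a b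
  proof -
    have "e a < e b \<longleftrightarrow> a < b" if "a < ?m" "b < ?m" for a b
      using strict_mono_on_less[OF e(2), of a b] that by simp
    moreover have "e a < i" if "a < ?m" for a using T(2) eT[OF that] by auto
    ultimately show ?thesis using that
      by (cases "a = ?m"; cases "b = ?m") (auto simp: e'_def dest: less_asym)
  qed
  let ?w = "\<lambda>z. cluster_weight k r (z(?m := x)) (\<lambda>l. l) {..<?m} ?m"
  have eq: "cluster_weight k r (z(i := x)) (\<lambda>l. l) T i = ?w (\<lambda>l\<in>{..<?m}. z (e l))" for z
  proof -
    have "cluster_weight k r (z(i := x)) (\<lambda>l. l) T i = cluster_weight k r (z(i := x)) (\<lambda>l. l) (e' ` {..<?m}) (e' ?m)"
      unfolding im by (simp add: e'_def)
    also have "\<dots> = cluster_weight k r (z(i := x) \<circ> e') ((\<lambda>l. l) \<circ> e') {..<?m} ?m"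
      by (rule cluster_weight_relabel[OF inj'])
    also have "\<dots> = ?w (\<lambda>l\<in>{..<?m}. z (e l))"
    proof (rule cluster_weight_cong)
      fix a assume a: "a \<in> insert ?m {..<?m}"
      have "e l \<noteq> i" if "l < ?m" for l using T(2)[OF eT[OF that]] by simp
      then show "(z(i := x) \<circ> e') a = ((\<lambda>l\<in>{..<?m}. z (e l))(?m := x)) a" using a by (auto simp: e'_def)
    qed (use ord in simp)
    finally show ?thesis .
  qed
  have re: "(\<lambda>z. \<lambda>l\<in>{..<?m}. z (e l)) \<in> PiM T (\<lambda>_. \<mu>) \<rightarrow>\<^sub>M PiM {..<?m} (\<lambda>_. \<mu>)"
    using eT by (intro measurable_restrict measurable_component_singleton) auto
  have d: "distr (PiM T (\<lambda>_. \<mu>)) (PiM {..<?m} (\<lambda>_. \<mu>)) (\<lambda>z. \<lambda>l\<in>{..<?m}. z (e l)) = PiM {..<?m} (\<lambda>_. \<mu>)"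
    using distr_PiM_reindex[of T "\<lambda>_. \<mu>" e "{..<?m}"] \<mu>(1) inj eT by auto
  have "mean_cluster_weight \<mu> k r ?m x = (\<integral>z. ?w z \<partial>distr (PiM T (\<lambda>_. \<mu>)) (PiM {..<?m} (\<lambda>_. \<mu>)) (\<lambda>z. \<lambda>l\<in>{..<?m}. z (e l)))"
    unfolding d mean_cluster_weight_def ..
  also have "\<dots> = (\<integral>z. ?w (\<lambda>l\<in>{..<?m}. z (e l)) \<partial>PiM T (\<lambda>_. \<mu>))"
    by (rule integral_distr[OF re meas]) auto
  finally show "(\<integral>z. cluster_weight k r (z(i := x)) (\<lambda>l. l) T i \<partial>PiM T (\<lambda>_. \<mu>)) = mean_cluster_weight \<mu> k r ?m x"
    unfolding eq by simp
qed

section \<open>Second moments of truncated packing counts\<close>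

text \<open>Both indicators are expanded into cluster weights. If two clusters share a point or one contains
  the other site, then some point would have to be in range of both \<open>x\<close> and \<open>y\<close>, which are too far
  apart, so the product of weights vanishes. Disjoint clusters use disjoint sets of independent
  points, so the mean of the product factorises.\<close>

lemma packed_trunc_pair_expansion:
  fixes \<mu> :: "'a::euclidean_space measure" and J :: "nat set"
  assumes \<mu>: "prob_space \<mu>" "sets \<mu> = sets borel" and r: "0 < r"
    and J: "finite J" "i \<in> J" "j \<in> J" "i \<noteq> j"
    and far: "2 * r * (real k + real k') \<le> dist x y"
  shows "(\<integral>c. of_bool (packed_trunc k r (c(i := x, j := y)) (\<lambda>l. l) J i)
        * of_bool (packed_trunc k' r (c(i := x, j := y)) (\<lambda>l. l) J j) \<partial>PiM (J - {i, j}) (\<lambda>_. \<mu>))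
    = (\<Sum>T\<in>Pow {l\<in>J. l < i}. \<Sum>T'\<in>Pow {l\<in>J. l < j}. if insert i T \<inter> insert j T' = {}
        then mean_cluster_weight \<mu> k r (card T) x * mean_cluster_weight \<mu> k' r (card T') y else 0)"
proof -
  let ?K = "J - {i, j}" and ?c = "\<lambda>c. c(i := x, j := y)"
  let ?w = "\<lambda>c T. cluster_weight k r (?c c) (\<lambda>l. l) T i" and ?w' = "\<lambda>c T'. cluster_weight k' r (?c c) (\<lambda>l. l) T' j"
  interpret K: prob_space "PiM ?K (\<lambda>_. \<mu>)" by (rule prob_space_PiM) (rule \<mu>)
  have fin: "finite T" if "T \<in> Pow {l\<in>J. l < i'}" for T i' using that J(1) finite_subset[of T J] by auto
  have expand: "of_bool (packed_trunc k r c (\<lambda>l. l) J i') = (\<Sum>T\<in>Pow {l\<in>J. l < i'}. cluster_weight k r c (\<lambda>l. l) T i')"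
    for k c i'
  proof -
    have "packed_trunc k r c (\<lambda>l. l) J i' = packed_trunc k r c (\<lambda>l. l) {l\<in>J. l < i'} i'"
      using r by (intro packed_trunc_local) auto
    then show ?thesis using J(1) by (simp add: sum_cluster_weight)
  qed
  have near: "(0 \<le> real k * r \<and> 0 \<le> real k' * r)" using r by simp
  have prod_zero: "?w c T * ?w' c T' = 0"
    if T: "T \<in> Pow {l\<in>J. l < i}" and T': "T' \<in> Pow {l\<in>J. l < j}" and meet: "insert i T \<inter> insert j T' \<noteq> {}" for c T T'
  proof -
    have wz: "?w c T = 0" if "l \<in> T" "2 * r * real k \<le> dist (?c c l) x" for l
      using r fin[OF T] that J(4) by (intro cluster_weight_eq_0[of r T l]) (auto simp: not_less)
    have wz': "?w' c T' = 0" if "l \<in> T'" "2 * r * real k' \<le> dist (?c c l) y" for l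
      using r fin[OF T'] that J(4) by (intro cluster_weight_eq_0[of r T' l]) (auto simp: not_less)
    have fk: "2 * r * real k \<le> dist x y" "2 * r * real k' \<le> dist x y"
      using far near by (auto simp: algebra_simps)
    consider "i \<in> T'" | "j \<in> T" | l where "l \<in> T" "l \<in> T'" "l \<noteq> i" "l \<noteq> j"
      using meet J(4) T T' by blast
    then show ?thesis
    proof cases
      case 1
      then show ?thesis using wz'[of i] fk J(4) by simp
    next
      case 2
      then show ?thesis using wz[of j] fk by (simp add: dist_commute)
    next
      case (3 l)
      have "dist x y \<le> dist (?c c l) x + dist (?c c l) y"
        using dist_triangle3[of x y "?c c l"] by (simp add: dist_commute)
      then have "2 * r * real k \<le> dist (?c c l) x \<or> 2 * r * real k' \<le> dist (?c c l) y"
        using far by (auto simp: algebra_simps)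
      then show ?thesis using wz[OF 3(1)] wz'[OF 3(2)] by auto
    qed
  qed
  have term_int: "integrable (PiM ?K (\<lambda>_. \<mu>)) (\<lambda>c. ?w c T * ?w' c T') \<and>
      (\<integral>c. ?w c T * ?w' c T' \<partial>PiM ?K (\<lambda>_. \<mu>)) = (if insert i T \<inter> insert j T' = {}
        then mean_cluster_weight \<mu> k r (card T) x * mean_cluster_weight \<mu> k' r (card T') y else 0)"
    if T: "T \<in> Pow {l\<in>J. l < i}" and T': "T' \<in> Pow {l\<in>J. l < j}" for T T'
  proof (cases "insert i T \<inter> insert j T' = {}")
    case False
    then have "?w c T * ?w' c T' = 0" for c using prod_zero[OF T T'] by blast
    then have zero: "(\<lambda>c. ?w c T * ?w' c T') = (\<lambda>_. 0)" by (simp only:)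
    show ?thesis unfolding zero if_not_P[OF False] by simp
  next
    case True
    let ?\<phi> = "\<lambda>z. cluster_weight k r (z(i := x)) (\<lambda>l. l) T i" and ?\<psi> = "\<lambda>z. cluster_weight k' r (z(j := y)) (\<lambda>l. l) T' j"
    have \<phi>: "?\<phi> \<in> borel_measurable (PiM T (\<lambda>_. \<mu>))" "(\<integral>z. ?\<phi> z \<partial>PiM T (\<lambda>_. \<mu>)) = mean_cluster_weight \<mu> k r (card T) x"
      using cluster_weight_mean_block[OF \<mu> r fin[OF T], of i k x] T by auto
    have \<psi>: "?\<psi> \<in> borel_measurable (PiM T' (\<lambda>_. \<mu>))" "(\<integral>z. ?\<psi> z \<partial>PiM T' (\<lambda>_. \<mu>)) = mean_cluster_weight \<mu> k' r (card T') y"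
      using cluster_weight_mean_block[OF \<mu> r fin[OF T'], of j k' y] T' by auto
    have w: "?w c T = ?\<phi> (restrict c T)" for c
      using True J(4) by (intro cluster_weight_cong) auto
    have w': "?w' c T' = ?\<psi> (restrict c T')" for c
      using True J(4) by (intro cluster_weight_cong) auto
    have sub: "T \<union> T' \<subseteq> ?K" "T \<inter> T' = {}" using True T T' by auto
    have b: "\<bar>?\<phi> z\<bar> \<le> 2 ^ card T" "\<bar>?\<psi> z\<bar> \<le> 2 ^ card T'" for z
      using fin[OF T] fin[OF T'] by (auto intro: abs_cluster_weight_le)
    have "(\<integral>c. ?w c T * ?w' c T' \<partial>PiM ?K (\<lambda>_. \<mu>)) = (\<integral>c. ?\<phi> (restrict c T) * ?\<psi> (restrict c T') \<partial>PiM ?K (\<lambda>_. \<mu>))"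
      by (simp only: w w')
    also have "\<dots> = mean_cluster_weight \<mu> k r (card T) x * mean_cluster_weight \<mu> k' r (card T') y"
      using J(1) by (subst integral_PiM_disjoint_blocks[OF \<mu>(1) _ sub \<phi>(1) b(1) \<psi>(1) b(2)]) (simp_all only: \<phi>(2) \<psi>(2) finite_Diff)
    finally have val: "(\<integral>c. ?w c T * ?w' c T' \<partial>PiM ?K (\<lambda>_. \<mu>)) = mean_cluster_weight \<mu> k r (card T) x * mean_cluster_weight \<mu> k' r (card T') y" .
    have rT: "(\<lambda>c. restrict c T) \<in> PiM ?K (\<lambda>_. \<mu>) \<rightarrow>\<^sub>M PiM T (\<lambda>_. \<mu>)" and rT': "(\<lambda>c. restrict c T') \<in> PiM ?K (\<lambda>_. \<mu>) \<rightarrow>\<^sub>M PiM T' (\<lambda>_. \<mu>)"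
      using sub by (auto intro!: measurable_restrict_subset)
    have "(\<lambda>c. ?\<phi> (restrict c T) * ?\<psi> (restrict c T')) \<in> borel_measurable (PiM ?K (\<lambda>_. \<mu>))"
      using measurable_compose[OF rT \<phi>(1)] measurable_compose[OF rT' \<psi>(1)] by (rule borel_measurable_times)
    then have "integrable (PiM ?K (\<lambda>_. \<mu>)) (\<lambda>c. ?\<phi> (restrict c T) * ?\<psi> (restrict c T'))"
    proof (rule K.integrable_const_bound[where B="2 ^ card T * 2 ^ card T'", rotated])
      show "AE c in PiM ?K (\<lambda>_. \<mu>). norm (?\<phi> (restrict c T) * ?\<psi> (restrict c T')) \<le> 2 ^ card T * 2 ^ card T'"
        unfolding real_norm_def abs_mult by (intro AE_I2 mult_mono b) simp_all
    qed
    then have "integrable (PiM ?K (\<lambda>_. \<mu>)) (\<lambda>c. ?w c T * ?w' c T')" by (simp only: w w')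
    then show ?thesis using val unfolding if_P[OF True] by (rule conjI)
  qed
  have "(\<integral>c. of_bool (packed_trunc k r (?c c) (\<lambda>l. l) J i) * of_bool (packed_trunc k' r (?c c) (\<lambda>l. l) J j) \<partial>PiM ?K (\<lambda>_. \<mu>))
    = (\<integral>c. (\<Sum>T\<in>Pow {l\<in>J. l < i}. \<Sum>T'\<in>Pow {l\<in>J. l < j}. ?w c T * ?w' c T') \<partial>PiM ?K (\<lambda>_. \<mu>))"
    unfolding expand sum_product ..
  also have "\<dots> = (\<Sum>T\<in>Pow {l\<in>J. l < i}. \<integral>c. (\<Sum>T'\<in>Pow {l\<in>J. l < j}. ?w c T * ?w' c T') \<partial>PiM ?K (\<lambda>_. \<mu>))"
    using term_int by (intro Bochner_Integration.integral_sum Bochner_Integration.integrable_sum) blast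
  also have "\<dots> = (\<Sum>T\<in>Pow {l\<in>J. l < i}. \<Sum>T'\<in>Pow {l\<in>J. l < j}. \<integral>c. ?w c T * ?w' c T' \<partial>PiM ?K (\<lambda>_. \<mu>))"
    using term_int by (intro sum.cong refl Bochner_Integration.integral_sum) blast
  also have "\<dots> = (\<Sum>T\<in>Pow {l\<in>J. l < i}. \<Sum>T'\<in>Pow {l\<in>J. l < j}. if insert i T \<inter> insert j T' = {}
        then mean_cluster_weight \<mu> k r (card T) x * mean_cluster_weight \<mu> k' r (card T') y else 0)"
    using term_int by (intro sum.cong refl) blast
  finally show ?thesis .
qed

definition trunc_count :: "nat \<Rightarrow> nat \<Rightarrow> (nat \<Rightarrow> 'a::euclidean_space) \<Rightarrow> real" where
  "trunc_count k n c = (\<Sum>i\<in>{1..n}. of_bool (packed_trunc k (ball_radius TYPE('a) (1 / real n)) c (\<lambda>i. i) {1..n} i))"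

lemma measurable_trunc_indicator:
  fixes X :: "nat \<Rightarrow> 'w \<Rightarrow> 'a::euclidean_space"
  assumes r: "0 < r" and X: "\<And>i. i \<in> J \<Longrightarrow> X i \<in> borel_measurable M" and i: "i \<in> J"
  shows "(\<lambda>\<omega>. of_bool (packed_trunc k r (\<lambda>i. X i \<omega>) (\<lambda>i. i) J i) :: real) \<in> borel_measurable M"
proof -
  have "Measurable.pred M (\<lambda>\<omega>. packed_trunc k r (\<lambda>i. X i \<omega>) (\<lambda>i. i) J i)"
    by (rule measurable_packed_trunc[where J=J]) (use X i in \<open>auto intro!: measurable_overlap[OF r]\<close>)
  then show ?thesis by measurable
qed

lemma trunc_count_bounds: "0 \<le> trunc_count k n c" "trunc_count k n c \<le> real n"
proof -
  show "0 \<le> trunc_count k n c" unfolding trunc_count_def by (intro sum_nonneg) auto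
  have "trunc_count k n c \<le> (\<Sum>i\<in>{1..n}. 1)" unfolding trunc_count_def by (intro sum_mono) auto
  then show "trunc_count k n c \<le> real n" by simp
qed

text \<open>Summed over all ordered pairs of distinct labels, the probability that the first ball is packed
  at depth \<open>k\<close> and the second at depth \<open>k'\<close>, given that their centres are the components of \<open>p\<close>.\<close>

definition pair_kernel :: "'a::euclidean_space measure \<Rightarrow> nat \<Rightarrow> nat \<Rightarrow> nat \<Rightarrow> 'a \<times> 'a \<Rightarrow> real" where
  "pair_kernel \<mu> k k' n p = (\<Sum>i\<in>{1..n}. \<Sum>j\<in>{1..n} - {i}.
     \<integral>c. of_bool (packed_trunc k (ball_radius TYPE('a) (1 / real n)) (c(i := fst p, j := snd p)) (\<lambda>l. l) {1..n} i)
       * of_bool (packed_trunc k' (ball_radius TYPE('a) (1 / real n)) (c(i := fst p, j := snd p)) (\<lambda>l. l) {1..n} j)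
       \<partial>PiM ({1..n} - {i, j}) (\<lambda>_. \<mu>))"

lemma pair_kernel_far:
  fixes \<mu> :: "'a::euclidean_space measure"
  assumes \<mu>: "prob_space \<mu>" "sets \<mu> = sets borel" and n: "0 < n"
    and far: "2 * ball_radius TYPE('a) (1 / real n) * (real k + real k') \<le> dist x y"
  shows "pair_kernel \<mu> k k' n (x, y) = (\<Sum>m<n. \<Sum>m'<n. real (n choose Suc m) * real ((n - Suc m) choose Suc m') *
      (mean_cluster_weight \<mu> k (ball_radius TYPE('a) (1 / real n)) m x * mean_cluster_weight \<mu> k' (ball_radius TYPE('a) (1 / real n)) m' y))"
proof -
  let ?r = "ball_radius TYPE('a) (1 / real n)" and ?J = "{1..n}"
  have r: "0 < ?r" using n by (intro ball_radius_pos) simp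
  let ?s = "\<lambda>i j. \<Sum>T\<in>Pow {l\<in>?J. l < i}. \<Sum>T'\<in>Pow {l\<in>?J. l < j}. if insert i T \<inter> insert j T' = {}
        then mean_cluster_weight \<mu> k ?r (card T) x * mean_cluster_weight \<mu> k' ?r (card T') y else 0"
  have "pair_kernel \<mu> k k' n (x, y) = (\<Sum>i\<in>?J. \<Sum>j\<in>?J - {i}. ?s i j)"
    unfolding pair_kernel_def fst_conv snd_conv
    by (intro sum.cong refl packed_trunc_pair_expansion[OF \<mu> r _ _ _ _ far]) auto
  also have "\<dots> = (\<Sum>i\<in>?J. \<Sum>j\<in>?J. ?s i j)"
    by (intro sum.cong refl sum.mono_neutral_left) auto
  also have "\<dots> = (\<Sum>m<n. \<Sum>m'<n. real (n choose Suc m) * real ((n - Suc m) choose Suc m') *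
      (mean_cluster_weight \<mu> k ?r m x * mean_cluster_weight \<mu> k' ?r m' y))"
    by (rule sum_disjoint_clusters) auto
  finally show ?thesis .
qed

text \<open>The second moment is the mean of the pair kernel plus the contribution of the diagonal, which
  has only \<open>n\<close> terms and is negligible against \<open>n^2\<close>.\<close>

lemma trunc_count_second_moment:
  fixes \<mu> :: "'a::euclidean_space measure"
  assumes \<mu>: "prob_space \<mu>" "sets \<mu> = sets borel" and n: "0 < n"
  shows "integrable (\<mu> \<Otimes>\<^sub>M \<mu>) (pair_kernel \<mu> k k' n)"
    and "\<And>p. 0 \<le> pair_kernel \<mu> k k' n p \<and> pair_kernel \<mu> k k' n p \<le> (real n)\<^sup>2"
    and "0 \<le> (\<integral>c. trunc_count k n c * trunc_count k' n c \<partial>PiM {1..n} (\<lambda>_. \<mu>)) - (\<integral>p. pair_kernel \<mu> k k' n p \<partial>(\<mu> \<Otimes>\<^sub>M \<mu>))"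
    and "(\<integral>c. trunc_count k n c * trunc_count k' n c \<partial>PiM {1..n} (\<lambda>_. \<mu>)) - (\<integral>p. pair_kernel \<mu> k k' n p \<partial>(\<mu> \<Otimes>\<^sub>M \<mu>)) \<le> real n"
proof -
  let ?r = "ball_radius TYPE('a) (1 / real n)" and ?J = "{1..n}" and ?P = "PiM {1..n} (\<lambda>_. \<mu>)"
  have r: "0 < ?r" using n by (intro ball_radius_pos) simp
  interpret P: prob_space ?P by (rule prob_space_PiM) (rule \<mu>)
  let ?b = "\<lambda>k c i. of_bool (packed_trunc k ?r c (\<lambda>l. l) ?J i) :: real"
  let ?F = "\<lambda>i j c. ?b k c i * ?b k' c j"
  have sets: "sets (PiM I (\<lambda>_. \<mu>)) = sets (PiM I (\<lambda>_. borel))" for I :: "nat set"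
    using \<mu>(2) by (intro sets_PiM_cong) auto
  have mb: "(\<lambda>c. ?b k c i) \<in> borel_measurable ?P" if "i \<in> ?J" for k i
  proof -
    have "(\<lambda>c. ?b k c i) \<in> borel_measurable (PiM ?J (\<lambda>_. borel :: 'a measure))"
      using that by (intro measurable_trunc_indicator[OF r]) (auto intro!: measurable_component_singleton)
    then show ?thesis using measurable_cong_sets[OF sets[of ?J] refl, of borel] by blast
  qed
  have mF: "?F i j \<in> borel_measurable ?P" if "i \<in> ?J" "j \<in> ?J" for i j
    using mb[OF that(1)] mb[OF that(2)] by (rule borel_measurable_times)
  have bF: "\<bar>?F i j c\<bar> \<le> 1" for i j c by simp
  have iF: "integrable ?P (?F i j)" if "i \<in> ?J" "j \<in> ?J" for i j
    by (rule P.integrable_const_bound[where B=1]) (use bF mF[OF that] in auto)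
  let ?H = "\<lambda>i j p. \<integral>c. ?F i j (c(i := fst p, j := snd p)) \<partial>PiM (?J - {i, j}) (\<lambda>_. \<mu>)"
  have H: "integrable (\<mu> \<Otimes>\<^sub>M \<mu>) (?H i j)" "(\<integral>c. ?F i j c \<partial>?P) = (\<integral>p. ?H i j p \<partial>(\<mu> \<Otimes>\<^sub>M \<mu>))"
    if "i \<in> ?J" "j \<in> ?J" "i \<noteq> j" for i j
    using integral_PiM_two_coordinates[OF \<mu>(1) _ that mF[OF that(1,2)] bF] by auto
  have pk: "pair_kernel \<mu> k k' n = (\<lambda>p. \<Sum>i\<in>?J. \<Sum>j\<in>?J - {i}. ?H i j p)"
    by (simp add: pair_kernel_def[abs_def])
  show "integrable (\<mu> \<Otimes>\<^sub>M \<mu>) (pair_kernel \<mu> k k' n)"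
    unfolding pk using H(1) by (intro Bochner_Integration.integrable_sum) auto
  have H01: "0 \<le> ?H i j p \<and> ?H i j p \<le> 1" for i j p
  proof
    interpret K: prob_space "PiM (?J - {i, j}) (\<lambda>_. \<mu>)" by (rule prob_space_PiM) (rule \<mu>)
    show "0 \<le> ?H i j p" by (intro Bochner_Integration.integral_nonneg) simp
    show "?H i j p \<le> 1"
    proof (cases "integrable (PiM (?J - {i, j}) (\<lambda>_. \<mu>)) (\<lambda>c. ?F i j (c(i := fst p, j := snd p)))")
      case True
      then have "?H i j p \<le> (\<integral>c. 1 \<partial>PiM (?J - {i, j}) (\<lambda>_. \<mu>))"
        by (rule integral_mono[OF _ K.integrable_const]) simp
      then show ?thesis unfolding lebesgue_integral_const K.prob_space by simp
    qed (simp add: not_integrable_integral_eq)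
  qed
  show "0 \<le> pair_kernel \<mu> k k' n p \<and> pair_kernel \<mu> k k' n p \<le> (real n)\<^sup>2" for p
  proof
    show "0 \<le> pair_kernel \<mu> k k' n p" unfolding pk using H01 by (intro sum_nonneg) blast
    have "pair_kernel \<mu> k k' n p \<le> (\<Sum>i\<in>?J. \<Sum>j\<in>?J - {i}. 1)"
      unfolding pk using H01 by (intro sum_mono) blast
    also have "\<dots> \<le> (\<Sum>i\<in>?J. \<Sum>j\<in>?J. (1::real))" by (intro sum_mono sum_mono2) auto
    finally show "pair_kernel \<mu> k k' n p \<le> (real n)\<^sup>2" by (simp add: power2_eq_square)
  qed
  have "(\<integral>c. trunc_count k n c * trunc_count k' n c \<partial>?P) = (\<integral>c. (\<Sum>i\<in>?J. \<Sum>j\<in>?J. ?F i j c) \<partial>?P)"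
    unfolding trunc_count_def sum_product ..
  also have "\<dots> = (\<Sum>i\<in>?J. \<integral>c. (\<Sum>j\<in>?J. ?F i j c) \<partial>?P)"
    using iF by (intro Bochner_Integration.integral_sum Bochner_Integration.integrable_sum) blast
  also have "\<dots> = (\<Sum>i\<in>?J. \<Sum>j\<in>?J. \<integral>c. ?F i j c \<partial>?P)"
    using iF by (intro sum.cong refl Bochner_Integration.integral_sum) blast
  also have "\<dots> = (\<Sum>i\<in>?J. (\<integral>c. ?F i i c \<partial>?P) + (\<Sum>j\<in>?J - {i}. \<integral>c. ?F i j c \<partial>?P))"
    by (intro sum.cong refl sum.remove) auto
  also have "\<dots> = (\<Sum>i\<in>?J. \<integral>c. ?F i i c \<partial>?P) + (\<Sum>i\<in>?J. \<Sum>j\<in>?J - {i}. \<integral>c. ?F i j c \<partial>?P)"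
    by (rule sum.distrib)
  also have "(\<Sum>i\<in>?J. \<Sum>j\<in>?J - {i}. \<integral>c. ?F i j c \<partial>?P) = (\<Sum>i\<in>?J. \<Sum>j\<in>?J - {i}. \<integral>p. ?H i j p \<partial>(\<mu> \<Otimes>\<^sub>M \<mu>))"
    using H(2) by (intro sum.cong refl) auto
  also have "\<dots> = (\<Sum>i\<in>?J. \<integral>p. (\<Sum>j\<in>?J - {i}. ?H i j p) \<partial>(\<mu> \<Otimes>\<^sub>M \<mu>))"
    using H(1) by (intro sum.cong refl Bochner_Integration.integral_sum[symmetric]) auto
  also have "\<dots> = (\<integral>p. pair_kernel \<mu> k k' n p \<partial>(\<mu> \<Otimes>\<^sub>M \<mu>))"
    unfolding pk using H(1) by (intro Bochner_Integration.integral_sum[symmetric] Bochner_Integration.integrable_sum) auto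
  finally have eq: "(\<integral>c. trunc_count k n c * trunc_count k' n c \<partial>?P) - (\<integral>p. pair_kernel \<mu> k k' n p \<partial>(\<mu> \<Otimes>\<^sub>M \<mu>)) = (\<Sum>i\<in>?J. \<integral>c. ?F i i c \<partial>?P)"
    by simp
  have d: "0 \<le> (\<integral>c. ?F i i c \<partial>?P) \<and> (\<integral>c. ?F i i c \<partial>?P) \<le> 1" if "i \<in> ?J" for i
  proof
    show "0 \<le> (\<integral>c. ?F i i c \<partial>?P)" by (intro Bochner_Integration.integral_nonneg) simp
    have "(\<integral>c. ?F i i c \<partial>?P) \<le> (\<integral>c. 1 \<partial>?P)" by (rule integral_mono[OF iF[OF that that] P.integrable_const]) simp
    then show "(\<integral>c. ?F i i c \<partial>?P) \<le> 1" unfolding lebesgue_integral_const P.prob_space by simp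
  qed
  show "0 \<le> (\<integral>c. trunc_count k n c * trunc_count k' n c \<partial>?P) - (\<integral>p. pair_kernel \<mu> k k' n p \<partial>(\<mu> \<Otimes>\<^sub>M \<mu>))"
    unfolding eq using d by (intro sum_nonneg) blast
  have "(\<Sum>i\<in>?J. \<integral>c. ?F i i c \<partial>?P) \<le> (\<Sum>i\<in>?J. 1)" using d by (intro sum_mono) blast
  then show "(\<integral>c. trunc_count k n c * trunc_count k' n c \<partial>?P) - (\<integral>p. pair_kernel \<mu> k k' n p \<partial>(\<mu> \<Otimes>\<^sub>M \<mu>)) \<le> real n"
    unfolding eq by simp
qed

section \<open>The limit of the truncated packing counts\<close>

text \<open>Needed because the oscillation of the density is controlled only along subsequences.\<close>

lemma tendsto_subseq_principle:
  fixes X :: "nat \<Rightarrow> real"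
  assumes "\<And>s :: nat \<Rightarrow> nat. strict_mono s \<Longrightarrow> \<exists>t :: nat \<Rightarrow> nat. strict_mono t \<and> (\<lambda>n. X (s (t n))) \<longlonglongrightarrow> L"
  shows "X \<longlonglongrightarrow> L"
proof (rule ccontr)
  assume "\<not> X \<longlonglongrightarrow> L"
  then obtain e where e: "0 < e" "\<And>N. \<exists>n\<ge>N. e \<le> norm (X n - L)"
    by (auto simp: LIMSEQ_iff not_less)
  then have inf: "infinite {n. e \<le> norm (X n - L)}" by (auto simp: infinite_nat_iff_unbounded_le)
  obtain s :: "nat \<Rightarrow> nat" where s: "strict_mono s" "\<forall>n. s n \<in> {n. e \<le> norm (X n - L)}"
    using infinite_enumerate[OF inf] by blast
  obtain t :: "nat \<Rightarrow> nat" where t: "strict_mono t" "(\<lambda>n. X (s (t n))) \<longlonglongrightarrow> L" using assms[OF s(1)] by auto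
  obtain n where "norm (X (s (t n)) - L) < e" using LIMSEQ_D[OF t(2) e(1)] by auto
  then show False using s(2)[rule_format, of "t n"] by simp
qed

lemma AE_pair_fst:
  assumes "prob_space M" "AE x in M. P x"
  shows "AE p in M \<Otimes>\<^sub>M M. P (fst p)"
proof -
  interpret M: prob_space M by fact
  obtain N where N: "N \<in> null_sets M" "{x\<in>space M. \<not> P x} \<subseteq> N"
    using assms(2) by (auto simp: eventually_ae_filter)
  have "emeasure (M \<Otimes>\<^sub>M M) (N \<times> space M) = 0"
    using N by (subst M.emeasure_pair_measure_Times) auto
  then have "N \<times> space M \<in> null_sets (M \<Otimes>\<^sub>M M)" using N by (auto intro!: null_setsI)
  then show ?thesis by (rule AE_I') (use N in \<open>auto simp: space_pair_measure\<close>)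
qed

lemma AE_pair_snd:
  assumes "prob_space M" "AE x in M. P x"
  shows "AE p in M \<Otimes>\<^sub>M M. P (snd p)"
proof -
  interpret M: prob_space M by fact
  obtain N where N: "N \<in> null_sets M" "{x\<in>space M. \<not> P x} \<subseteq> N"
    using assms(2) by (auto simp: eventually_ae_filter)
  have "emeasure (M \<Otimes>\<^sub>M M) (space M \<times> N) = 0"
    using N by (subst M.emeasure_pair_measure_Times) auto
  then have "space M \<times> N \<in> null_sets (M \<Otimes>\<^sub>M M)" using N by (auto intro!: null_setsI)
  then show ?thesis by (rule AE_I') (use N in \<open>auto simp: space_pair_measure\<close>)
qed

lemma measurable_poisson_packed_prob [measurable]:
  "poisson_packed_prob T k \<in> borel_measurable borel"
  unfolding poisson_packed_prob_def[abs_def] by measurable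

context
  fixes f :: "'a::euclidean_space \<Rightarrow> real"
  assumes f_meas [measurable]: "f \<in> borel_measurable borel"
    and f_nonneg: "\<And>x. 0 \<le> f x"
    and f_prob: "(\<integral>\<^sup>+x. ennreal (f x) \<partial>lborel) = 1"
    and bounds: "\<And>k \<tau>. 0 < \<tau> \<Longrightarrow> 0 \<le> poisson_packed_prob TYPE('a) k \<tau> \<and> poisson_packed_prob TYPE('a) k \<tau> \<le> 1"
begin

abbreviation law :: "'a measure" where
  "law \<equiv> center_law f"

text \<open>The limiting fraction of balls packed at depth \<open>k\<close>.\<close>

definition trunc_limit :: "nat \<Rightarrow> real" where
  "trunc_limit k = (\<integral>x. poisson_packed_prob TYPE('a) k (f x) \<partial>law)"

lemma prob_law: "prob_space law"
  by (rule prob_space_center_law[OF f_meas f_nonneg f_prob])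

lemma AE_law_pos: "AE x in law. 0 < f x"
  using f_nonneg by (subst AE_density) (auto simp: less_le)

lemma AE_law: "AE x in lborel. P x \<Longrightarrow> AE x in law. P x"
  by (subst AE_density) (auto elim: eventually_mono)

lemma AE_law_distinct: "AE p in law \<Otimes>\<^sub>M law. fst p \<noteq> snd p"
proof -
  interpret L: prob_space law by (rule prob_law)
  let ?D = "{p\<in>space (law \<Otimes>\<^sub>M law). fst p = snd p}"
  have "?D = {p\<in>space (law \<Otimes>\<^sub>M law). dist (fst p) (snd p) = 0}" by auto
  also have "\<dots> \<in> sets (law \<Otimes>\<^sub>M law)" by measurable
  finally have D: "?D \<in> sets (law \<Otimes>\<^sub>M law)" .
  have "emeasure law {x} = 0" for x :: 'a
  proof -
    have "{x} \<in> null_sets lborel" by (intro null_setsI) auto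
    then have "AE y in lborel. y \<notin> {x}" by (rule AE_not_in)
    then have "AE y in law. y \<notin> {x}" by (rule AE_law)
    then show ?thesis by (subst (asm) AE_iff_measurable[of "{x}"]) auto
  qed
  then have "emeasure (law \<Otimes>\<^sub>M law) ?D = 0"
    by (subst L.emeasure_pair_measure_alt[OF D])
      (simp add: space_pair_measure vimage_def Int_def cong: nn_integral_cong)
  then show ?thesis using D by (subst AE_iff_measurable[OF D]) auto
qed

lemma trunc_limit_product:
  "integrable (law \<Otimes>\<^sub>M law) (\<lambda>p. poisson_packed_prob TYPE('a) k (f (fst p)) * poisson_packed_prob TYPE('a) k' (f (snd p)))"
  "(\<integral>p. poisson_packed_prob TYPE('a) k (f (fst p)) * poisson_packed_prob TYPE('a) k' (f (snd p)) \<partial>(law \<Otimes>\<^sub>M law))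
    = trunc_limit k * trunc_limit k'"
proof -
  interpret L: prob_space law by (rule prob_law)
  interpret LL: pair_prob_space law law ..
  let ?g = "\<lambda>k x. poisson_packed_prob TYPE('a) k (f x)"
  have m: "(\<lambda>p. ?g k (fst p) * ?g k' (snd p)) \<in> borel_measurable (law \<Otimes>\<^sub>M law)" by measurable
  have "AE p in law \<Otimes>\<^sub>M law. norm (?g k (fst p) * ?g k' (snd p)) \<le> 1"
    using AE_pair_fst[OF prob_law AE_law_pos] AE_pair_snd[OF prob_law AE_law_pos]
  proof eventually_elim
    case (elim p)
    then show ?case using bounds[OF elim(1), of k] bounds[OF elim(2), of k'] by (auto simp: abs_mult intro!: mult_le_one)
  qed
  then show I: "integrable (law \<Otimes>\<^sub>M law) (\<lambda>p. ?g k (fst p) * ?g k' (snd p))"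
    using m by (intro LL.integrable_const_bound) auto
  have "(\<integral>p. ?g k (fst p) * ?g k' (snd p) \<partial>(law \<Otimes>\<^sub>M law)) = (\<integral>x. (\<integral>y. ?g k x * ?g k' y \<partial>law) \<partial>law)"
    using LL.integral_fst'[OF I] by simp
  then show "(\<integral>p. ?g k (fst p) * ?g k' (snd p) \<partial>(law \<Otimes>\<^sub>M law)) = trunc_limit k * trunc_limit k'"
    by (simp add: trunc_limit_def)
qed

text \<open>For distinct \<open>x\<close> and \<open>y\<close> the range of interaction is eventually smaller than their
  distance, so \<open>pair_kernel_far\<close> applies.\<close>

lemma pair_kernel_limit:
  assumes N: "filterlim N at_top sequentially" "\<And>j. 0 < N j"
    and R: "unit_range TYPE('a) k \<le> R" "unit_range TYPE('a) k' \<le> R"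
    and osc: "(\<lambda>j. local_oscillation f (ball 0 R) (side_length TYPE('a) (N j)) x) \<longlonglongrightarrow> 0"
      "(\<lambda>j. local_oscillation f (ball 0 R) (side_length TYPE('a) (N j)) y) \<longlonglongrightarrow> 0"
    and "x \<noteq> y"
  shows "(\<lambda>j. pair_kernel law k k' (N j) (x, y) / (real (N j))\<^sup>2) \<longlonglongrightarrow>
    poisson_packed_prob TYPE('a) k (f x) * poisson_packed_prob TYPE('a) k' (f y)"
proof -
  note lim = mean_cluster_weight_limit[OF f_meas f_nonneg f_prob N(2)]
  let ?r = "\<lambda>j. ball_radius TYPE('a) (1 / real (N j))"
  obtain A where A: "0 \<le> A" "\<And>j m. \<bar>real (N j) ^ m * mean_cluster_weight law k (?r j) m x\<bar> \<le> A ^ m"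
    using lim(2)[OF R(1) osc(1)] by blast
  obtain B where B: "0 \<le> B" "\<And>j m. \<bar>real (N j) ^ m * mean_cluster_weight law k' (?r j) m y\<bar> \<le> B ^ m"
    using lim(2)[OF R(2) osc(2)] by blast
  have sums: "(\<lambda>j. (\<Sum>m<N j. \<Sum>m'<N j. real (N j choose Suc m) * real ((N j - Suc m) choose Suc m') *
      (mean_cluster_weight law k (?r j) m x * mean_cluster_weight law k' (?r j) m' y)) / (real (N j))\<^sup>2)
    \<longlonglongrightarrow> (\<Sum>m. f x ^ m * cluster_integral TYPE('a) k m / fact (Suc m)) * (\<Sum>m. f y ^ m * cluster_integral TYPE('a) k' m / fact (Suc m))"
    by (rule disjoint_cluster_sum_limit[OF N lim(1)[OF R(1) osc(1)] A(2) lim(1)[OF R(2) osc(2)] B(2) A(1) B(1)])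
  have "(\<lambda>j. 2 * ?r j * (real k + real k')) \<longlonglongrightarrow> 2 * (0 * unit_radius TYPE('a)) * (real k + real k')"
    unfolding ball_radius_scale by (intro tendsto_intros side_length_tendsto_0 N)
  then have "\<forall>\<^sub>F j in sequentially. 2 * ?r j * (real k + real k') < dist x y"
    using \<open>x \<noteq> y\<close> by (intro order_tendstoD(2)) auto
  then have "\<forall>\<^sub>F j in sequentially. (\<Sum>m<N j. \<Sum>m'<N j. real (N j choose Suc m) * real ((N j - Suc m) choose Suc m') *
      (mean_cluster_weight law k (?r j) m x * mean_cluster_weight law k' (?r j) m' y)) / (real (N j))\<^sup>2
      = pair_kernel law k k' (N j) (x, y) / (real (N j))\<^sup>2"
  proof eventually_elim
    case (elim j)
    show ?case
      by (subst pair_kernel_far[OF prob_law _ N(2)]) (use elim in auto)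
  qed
  from Lim_transform_eventually[OF sums this] show ?thesis
    by (simp only: poisson_packed_prob_def)
qed

text \<open>The normalised pair kernel is bounded by \<open>1\<close> and converges for almost every pair of centres along
  a subsequence, so its mean converges to a product integral.\<close>

proposition trunc_count_product_limit:
  "(\<lambda>n. (\<integral>c. trunc_count k n c * trunc_count k' n c \<partial>PiM {1..n} (\<lambda>_. law)) / (real n)\<^sup>2)
    \<longlonglongrightarrow> trunc_limit k * trunc_limit k'"
proof (rule tendsto_subseq_principle)
  fix s :: "nat \<Rightarrow> nat" assume s: "strict_mono s"
  interpret L: prob_space law by (rule prob_law)
  interpret LL: pair_prob_space law law ..
  let ?X = "\<lambda>n. (\<integral>c. trunc_count k n c * trunc_count k' n c \<partial>PiM {1..n} (\<lambda>_. law)) / (real n)\<^sup>2"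
  define R where "R = max (unit_range TYPE('a) k) (unit_range TYPE('a) k')"
  have R: "unit_range TYPE('a) k \<le> R" "unit_range TYPE('a) k' \<le> R" by (auto simp: R_def)
  \<comment> \<open>The shift excludes sample size \<open>0\<close>, where the radius degenerates.\<close>
  have sSuc: "strict_mono (\<lambda>j. s (Suc j))" using s by (auto simp: strict_mono_def)
  have "(\<lambda>j. side_length TYPE('a) (s (Suc j))) \<longlonglongrightarrow> 0"
    by (rule side_length_tendsto_0[OF filterlim_subseq[OF sSuc]])
  then obtain t :: "nat \<Rightarrow> nat" where t: "strict_mono t"
    "AE x in lborel. (\<lambda>j. local_oscillation f (ball 0 R) (side_length TYPE('a) (s (Suc (t j)))) x) \<longlonglongrightarrow> 0"
    using local_oscillation_AE_subseq[OF integrable_f[OF f_meas f_nonneg f_prob], of "ball 0 R"]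
      emeasure_bounded_finite[OF bounded_ball[of "0::'a" R]] by auto
  define N where "N j = s (Suc (t j))" for j
  have Nmono: "strict_mono N" using s t(1) by (auto simp: N_def strict_mono_def)
  have N: "filterlim N at_top sequentially" by (rule filterlim_subseq[OF Nmono])
  have N0: "0 < N j" for j
    using s strict_mono_less[OF s, of 0 "Suc (t j)"] by (auto simp: N_def)
  let ?L = "\<lambda>p. poisson_packed_prob TYPE('a) k (f (fst p)) * poisson_packed_prob TYPE('a) k' (f (snd p))"
  have sets: "sets law = sets borel" by simp
  note sm = trunc_count_second_moment[OF prob_law sets N0, where k=k and k'=k']
  have "(\<lambda>j. \<integral>p. pair_kernel law k k' (N j) p / (real (N j))\<^sup>2 \<partial>(law \<Otimes>\<^sub>M law)) \<longlonglongrightarrow> (\<integral>p. ?L p \<partial>(law \<Otimes>\<^sub>M law))"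
  proof (rule integral_dominated_convergence[where w="\<lambda>_. 1"])
    show "?L \<in> borel_measurable (law \<Otimes>\<^sub>M law)" by measurable
    show "(\<lambda>p. pair_kernel law k k' (N j) p / (real (N j))\<^sup>2) \<in> borel_measurable (law \<Otimes>\<^sub>M law)" for j
      using borel_measurable_integrable[OF sm(1)] by (rule borel_measurable_divide) simp
    show "integrable (law \<Otimes>\<^sub>M law) (\<lambda>_. 1 :: real)" by (rule LL.integrable_const)
    show "AE p in law \<Otimes>\<^sub>M law. norm (pair_kernel law k k' (N j) p / (real (N j))\<^sup>2) \<le> 1" for j
    proof (rule AE_I2)
      fix p show "norm (pair_kernel law k k' (N j) p / (real (N j))\<^sup>2) \<le> 1"
        using sm(2)[of j p] N0[of j] by (simp add: abs_of_nonneg)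
    qed
    show "AE p in law \<Otimes>\<^sub>M law. (\<lambda>j. pair_kernel law k k' (N j) p / (real (N j))\<^sup>2) \<longlonglongrightarrow> ?L p"
      using AE_pair_fst[OF prob_law AE_law[OF t(2)]] AE_pair_snd[OF prob_law AE_law[OF t(2)]] AE_law_distinct
    proof eventually_elim
      case (elim p)
      have "(\<lambda>j. pair_kernel law k k' (N j) (fst p, snd p) / (real (N j))\<^sup>2) \<longlonglongrightarrow> ?L p"
        by (rule pair_kernel_limit[OF N N0 R]) (use elim in \<open>simp_all add: N_def\<close>)
      then show ?case by simp
    qed
  qed
  then have lim: "(\<lambda>j. (\<integral>p. pair_kernel law k k' (N j) p \<partial>(law \<Otimes>\<^sub>M law)) / (real (N j))\<^sup>2) \<longlonglongrightarrow> trunc_limit k * trunc_limit k'"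
    by (simp add: trunc_limit_product)
  have diff: "(\<lambda>j. ?X (N j) - (\<integral>p. pair_kernel law k k' (N j) p \<partial>(law \<Otimes>\<^sub>M law)) / (real (N j))\<^sup>2) \<longlonglongrightarrow> 0"
  proof (rule Lim_null_comparison)
    show "\<forall>\<^sub>F j in sequentially. norm (?X (N j) - (\<integral>p. pair_kernel law k k' (N j) p \<partial>(law \<Otimes>\<^sub>M law)) / (real (N j))\<^sup>2) \<le> 1 / real (N j)"
    proof (rule always_eventually, rule allI)
      fix j
      let ?d = "(\<integral>c. trunc_count k (N j) c * trunc_count k' (N j) c \<partial>PiM {1..N j} (\<lambda>_. law)) - (\<integral>p. pair_kernel law k k' (N j) p \<partial>(law \<Otimes>\<^sub>M law))"
      have "norm (?X (N j) - (\<integral>p. pair_kernel law k k' (N j) p \<partial>(law \<Otimes>\<^sub>M law)) / (real (N j))\<^sup>2) = ?d / (real (N j))\<^sup>2"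
        using sm(3)[of j] by (simp add: diff_divide_distrib[symmetric])
      also have "\<dots> \<le> real (N j) / (real (N j))\<^sup>2" using sm(4)[of j] by (rule divide_right_mono) simp
      also have "\<dots> = 1 / real (N j)" using N0[of j] by (simp add: power2_eq_square)
      finally show "norm (?X (N j) - (\<integral>p. pair_kernel law k k' (N j) p \<partial>(law \<Otimes>\<^sub>M law)) / (real (N j))\<^sup>2) \<le> 1 / real (N j)" .
    qed
    show "(\<lambda>j. 1 / real (N j)) \<longlonglongrightarrow> 0" using filterlim_compose[OF lim_1_over_n N] by simp
  qed
  have "(\<lambda>j. ?X (N j)) \<longlonglongrightarrow> trunc_limit k * trunc_limit k'"
    using tendsto_add[OF diff lim] by simp
  moreover have "strict_mono (\<lambda>j. Suc (t j))" using t(1) by (auto simp: strict_mono_def)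
  ultimately show "\<exists>t. strict_mono t \<and> (\<lambda>n. ?X (s (t n))) \<longlonglongrightarrow> trunc_limit k * trunc_limit k'"
    unfolding N_def by blast
qed

end

section \<open>Convergence in mean square\<close>

lemma packed_trunc_less:
  fixes c :: "nat \<Rightarrow> 'a::metric_space"
  assumes "i \<in> {1..n}"
  shows "packed_trunc (Suc n) r c (\<lambda>i. i) {1..n} i \<longleftrightarrow> packed r c (\<lambda>i. i) {1..n} i"
proof (rule packed_trunc_eventually)
  have "card {j\<in>{1..n}. j < i} \<le> card {1..n}" by (intro card_mono) auto
  then show "card {j\<in>{1..n}. j < i} < Suc n" by simp
qed (use assms in auto)

text \<open>At depth \<open>n + 1\<close> the truncation is exact for \<open>n\<close> balls; this gives measurability of the number of
  packed balls.\<close>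

lemma num_packed_eq_trunc_count:
  "real (num_packed n c) = trunc_count (Suc n) n c"
proof -
  have "real (num_packed n c) = (\<Sum>i\<in>{1..n}. of_bool (packed (ball_radius TYPE('a) (1 / real n)) c (\<lambda>i. i) {1..n} i))"
    unfolding num_packed_def by (simp add: of_bool_def sum.If_cases Int_def)
  also have "\<dots> = trunc_count (Suc n) n c"
    unfolding trunc_count_def by (rule sum.cong[OF refl]) (simp only: packed_trunc_less)
  finally show ?thesis .
qed

lemma num_packed_trunc_count:
  "even k \<Longrightarrow> real (num_packed n c) \<le> trunc_count k n c"
  "odd k \<Longrightarrow> trunc_count k n c \<le> real (num_packed n c)"
proof -
  have eq: "real (num_packed n c) = (\<Sum>i\<in>{1..n}. of_bool (packed (ball_radius TYPE('a) (1 / real n)) c (\<lambda>i. i) {1..n} i))"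
    unfolding num_packed_def by (simp add: of_bool_def sum.If_cases Int_def)
  note sw = packed_trunc_sandwich[of "{1..n}" k "ball_radius TYPE('a) (1 / real n)" c "\<lambda>i. i"]
  show "even k \<Longrightarrow> real (num_packed n c) \<le> trunc_count k n c"
    unfolding eq trunc_count_def using sw by (intro sum_mono) (auto simp: of_bool_def)
  show "odd k \<Longrightarrow> trunc_count k n c \<le> real (num_packed n c)"
    unfolding eq trunc_count_def using sw by (intro sum_mono) (auto simp: of_bool_def)
qed

lemma trunc_count_0: "trunc_count 0 n c = real n"
  by (simp add: trunc_count_def)

lemma trunc_count_restrict: "trunc_count k n (restrict c {1..n}) = trunc_count k n c"
  unfolding trunc_count_def
  by (intro sum.cong refl arg_cong[where f=of_bool] packed_trunc_cong) auto

lemma measurable_trunc_count: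
  fixes X :: "nat \<Rightarrow> 'w \<Rightarrow> 'a::euclidean_space"
  assumes "\<And>i. i \<in> {1..n} \<Longrightarrow> X i \<in> borel_measurable M"
  shows "(\<lambda>\<omega>. trunc_count k n (\<lambda>i. X i \<omega>)) \<in> borel_measurable M"
proof (cases "n = 0")
  case False
  then have "0 < ball_radius TYPE('a) (1 / real n)" by (intro ball_radius_pos) simp
  then show ?thesis unfolding trunc_count_def
    using assms by (intro borel_measurable_sum measurable_trunc_indicator) auto
qed (simp add: trunc_count_def)

lemma integral_trunc_count_sample:
  fixes X :: "nat \<Rightarrow> 'w \<Rightarrow> 'a::euclidean_space"
  assumes "prob_space M" "0 < n" and indep: "prob_space.indep_vars M (\<lambda>_. borel) X {1..n}"
    and dist: "\<And>i. i \<in> {1..n} \<Longrightarrow> distributed M lborel (X i) (\<lambda>x. ennreal (f x))"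
  shows "(\<integral>\<omega>. trunc_count k n (\<lambda>i. X i \<omega>) * trunc_count k' n (\<lambda>i. X i \<omega>) \<partial>M)
    = (\<integral>z. trunc_count k n z * trunc_count k' n z \<partial>PiM {1..n} (\<lambda>_. density lborel (\<lambda>x. ennreal (f x))))"
proof -
  interpret prob_space M by fact
  let ?law = "density lborel (\<lambda>x. ennreal (f x))"
  have X: "X i \<in> borel_measurable M" if "i \<in> {1..n}" for i
    using distributed_measurable[OF dist[OF that]] by simp
  have Xr: "(\<lambda>\<omega>. \<lambda>i\<in>{1..n}. X i \<omega>) \<in> M \<rightarrow>\<^sub>M PiM {1..n} (\<lambda>_. borel)"
    by (intro measurable_restrict X)
  have "distr M (PiM {1..n} (\<lambda>_. borel)) (\<lambda>\<omega>. \<lambda>i\<in>{1..n}. X i \<omega>) = PiM {1..n} (\<lambda>i. distr M borel (X i))"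
    using indep_vars_iff_distr_eq_PiM'[where I="{1..n}" and X=X and M'="\<lambda>_. borel"] indep X \<open>0 < n\<close> by auto
  also have "\<dots> = PiM {1..n} (\<lambda>_. ?law)"
  proof (rule PiM_cong)
    fix i assume "i \<in> {1..n}"
    then show "distr M borel (X i) = ?law"
      using distributed_distr_eq_density[OF dist] by (simp cong: distr_cong)
  qed simp
  finally have d: "distr M (PiM {1..n} (\<lambda>_. borel)) (\<lambda>\<omega>. \<lambda>i\<in>{1..n}. X i \<omega>) = PiM {1..n} (\<lambda>_. ?law)" .
  have m: "(\<lambda>z. trunc_count k n z * trunc_count k' n z) \<in> borel_measurable (PiM {1..n} (\<lambda>_. borel :: 'a measure))"
    by (intro borel_measurable_times measurable_trunc_count[where X="\<lambda>i z. z i"] measurable_component_singleton)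
  show ?thesis
    unfolding d[symmetric] using integral_distr[OF Xr m] by (simp only: trunc_count_restrict)
qed

text \<open>Between an even and an odd bound the squared error is at most the sum of the squared errors of
  the bounds, and each of these splits into a random part, small for large \<open>n\<close>, and the deviation
  of \<open>c k\<close> from \<open>C\<close>, small for large \<open>k\<close>.\<close>

lemma L2_limit_sandwich:
  fixes S :: "nat \<Rightarrow> nat \<Rightarrow> 'w \<Rightarrow> real"
  assumes "prob_space M"
    and S_int: "\<And>k n. integrable M (\<lambda>\<omega>. (S k n \<omega> - c k)\<^sup>2)" and Y_int: "\<And>n. integrable M (\<lambda>\<omega>. (Y n \<omega> - C)\<^sup>2)"
    and S_L2: "\<And>k. (\<lambda>n. \<integral>\<omega>. (S k n \<omega> - c k)\<^sup>2 \<partial>M) \<longlonglongrightarrow> 0" and c_lim: "c \<longlonglongrightarrow> C"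
    and between: "\<And>k n \<omega>. even k \<Longrightarrow> Y n \<omega> \<le> S k n \<omega>" "\<And>k n \<omega>. odd k \<Longrightarrow> S k n \<omega> \<le> Y n \<omega>"
  shows "(\<lambda>n. \<integral>\<omega>. (Y n \<omega> - C)\<^sup>2 \<partial>M) \<longlonglongrightarrow> 0"
proof (rule LIMSEQ_I)
  interpret prob_space M by fact
  fix e :: real assume e: "0 < e"
  have "(\<lambda>k. 2 * (c (2 * k) - C)\<^sup>2 + 2 * (c (Suc (2 * k)) - C)\<^sup>2) \<longlonglongrightarrow> 2 * (C - C)\<^sup>2 + 2 * (C - C)\<^sup>2"
    by (intro tendsto_intros LIMSEQ_subseq_LIMSEQ[OF c_lim, unfolded comp_def]) (auto simp: strict_mono_def)
  then have "\<forall>\<^sub>F k in sequentially. 2 * (c (2 * k) - C)\<^sup>2 + 2 * (c (Suc (2 * k)) - C)\<^sup>2 < e / 2"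
    using e by (intro order_tendstoD(2)) auto
  then obtain k where k: "2 * (c (2 * k) - C)\<^sup>2 + 2 * (c (Suc (2 * k)) - C)\<^sup>2 < e / 2"
    by (auto simp: eventually_sequentially)
  have "(\<lambda>n. 2 * (\<integral>\<omega>. (S (2 * k) n \<omega> - c (2 * k))\<^sup>2 \<partial>M) + 2 * (\<integral>\<omega>. (S (Suc (2 * k)) n \<omega> - c (Suc (2 * k)))\<^sup>2 \<partial>M)) \<longlonglongrightarrow> 2 * 0 + 2 * 0"
    by (intro tendsto_intros S_L2)
  then have "\<forall>\<^sub>F n in sequentially. 2 * (\<integral>\<omega>. (S (2 * k) n \<omega> - c (2 * k))\<^sup>2 \<partial>M) + 2 * (\<integral>\<omega>. (S (Suc (2 * k)) n \<omega> - c (Suc (2 * k)))\<^sup>2 \<partial>M) < e / 2"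
    using e by (intro order_tendstoD(2)) auto
  then obtain N where N: "\<And>n. n \<ge> N \<Longrightarrow> 2 * (\<integral>\<omega>. (S (2 * k) n \<omega> - c (2 * k))\<^sup>2 \<partial>M) + 2 * (\<integral>\<omega>. (S (Suc (2 * k)) n \<omega> - c (Suc (2 * k)))\<^sup>2 \<partial>M) < e / 2"
    by (auto simp: eventually_sequentially)
  have "norm ((\<integral>\<omega>. (Y n \<omega> - C)\<^sup>2 \<partial>M) - 0) < e" if "n \<ge> N" for n
  proof -
    let ?B = "\<lambda>\<omega>. (2 * (S (2 * k) n \<omega> - c (2 * k))\<^sup>2 + 2 * (S (Suc (2 * k)) n \<omega> - c (Suc (2 * k)))\<^sup>2)
       + (2 * (c (2 * k) - C)\<^sup>2 + 2 * (c (Suc (2 * k)) - C)\<^sup>2)"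
    have "(Y n \<omega> - C)\<^sup>2 \<le> ?B \<omega>" for \<omega>
    proof -
      have sq: "(a + b)\<^sup>2 \<le> 2 * a\<^sup>2 + 2 * b\<^sup>2" for a b :: real
        using sum_squares_ge_zero[of "a - b" 0] by (simp add: power2_eq_square algebra_simps)
      show ?thesis
      proof (cases "C \<le> Y n \<omega>")
        case True
        have "(Y n \<omega> - C)\<^sup>2 \<le> ((S (2 * k) n \<omega> - c (2 * k)) + (c (2 * k) - C))\<^sup>2"
          using True between(1)[of "2 * k" n \<omega>] by (intro power_mono) auto
        also have "\<dots> \<le> 2 * (S (2 * k) n \<omega> - c (2 * k))\<^sup>2 + 2 * (c (2 * k) - C)\<^sup>2" by (rule sq)
        also have "\<dots> \<le> ?B \<omega>" by simp
        finally show ?thesis .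
      next
        case False
        have "(Y n \<omega> - C)\<^sup>2 = (C - Y n \<omega>)\<^sup>2" by (rule power2_commute)
        also have "\<dots> \<le> (- (S (Suc (2 * k)) n \<omega> - c (Suc (2 * k))) + - (c (Suc (2 * k)) - C))\<^sup>2"
          using False between(2)[of "Suc (2 * k)" n \<omega>] by (intro power_mono) auto
        also have "\<dots> \<le> 2 * (- (S (Suc (2 * k)) n \<omega> - c (Suc (2 * k))))\<^sup>2 + 2 * (- (c (Suc (2 * k)) - C))\<^sup>2" by (rule sq)
        also have "\<dots> \<le> ?B \<omega>" unfolding power2_minus by simp
        finally show ?thesis .
      qed
    qed
    then have "(\<integral>\<omega>. (Y n \<omega> - C)\<^sup>2 \<partial>M) \<le> (\<integral>\<omega>. ?B \<omega> \<partial>M)"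
      using Y_int S_int by (intro integral_mono) auto
    also have "\<dots> = (2 * (\<integral>\<omega>. (S (2 * k) n \<omega> - c (2 * k))\<^sup>2 \<partial>M) + 2 * (\<integral>\<omega>. (S (Suc (2 * k)) n \<omega> - c (Suc (2 * k)))\<^sup>2 \<partial>M))
       + (2 * (c (2 * k) - C)\<^sup>2 + 2 * (c (Suc (2 * k)) - C)\<^sup>2)"
      using S_int by (simp add: prob_space)
    also have "\<dots> < e" using N[OF that] k by linarith
    finally show ?thesis by simp
  qed
  then show "\<exists>N. \<forall>n\<ge>N. norm ((\<integral>\<omega>. (Y n \<omega> - C)\<^sup>2 \<partial>M) - 0) < e" by blast
qed

theorem theorem2p8:
  fixes f :: "'a::euclidean_space \<Rightarrow> real"
    and M :: "'w measure"
    and X :: "nat \<Rightarrow> nat \<Rightarrow> 'w \<Rightarrow> 'a"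
    and Q :: "real \<Rightarrow> 'v measure"
    and Z :: "real \<Rightarrow> nat \<Rightarrow> 'v \<Rightarrow> 'a"
    and U :: "real \<Rightarrow> nat \<Rightarrow> 'v \<Rightarrow> real"
  assumes "f \<in> borel_measurable borel"
    and "\<And>x. 0 \<le> f x"
    and "(\<integral>\<^sup>+x. ennreal (f x) \<partial>lborel) = 1"
    and "prob_space M"
    and "\<And>n. prob_space.indep_vars M (\<lambda>_. borel) (X n) {1..n}"
    and "\<And>n i. i \<in> {1..n} \<Longrightarrow> distributed M lborel (X n i) (\<lambda>x. ennreal (f x))"
    and "\<And>\<tau>. 0 < \<tau> \<Longrightarrow> marked_poisson_process (Q \<tau>) \<tau> (Z \<tau>) (U \<tau>)"
  shows "tendsto_L2 M
    (\<lambda>n \<omega>. real (num_packed n (\<lambda>i. X n i \<omega>)) / real n)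
    (\<lambda>_. \<integral>x. (\<integral>\<omega>. xi_infinity (U (f x) 0 \<omega>) (marked_points (Z (f x)) (U (f x)) \<omega>) \<partial>Q (f x)) * f x \<partial>lborel)"
proof -
  interpret prob_space M by fact
  note [measurable] = assms(1)
  have X_meas: "X n i \<in> borel_measurable M" if "i \<in> {1..n}" for n i
    using distributed_measurable[OF assms(6)[OF that]] by simp
  have bounds: "0 \<le> poisson_packed_prob TYPE('a) k \<tau> \<and> poisson_packed_prob TYPE('a) k \<tau> \<le> 1" if "0 < \<tau>" for k \<tau>
    using poisson_packed_prob_bounds[OF assms(7)[OF that] that] by blast
  define law where "law = density lborel (\<lambda>x. ennreal (f x))"
  define c where "c k = trunc_limit f k" for k
  let ?g = "\<lambda>\<tau>. \<integral>\<omega>. xi_infinity (U \<tau> 0 \<omega>) (marked_points (Z \<tau>) (U \<tau>) \<omega>) \<partial>Q \<tau>"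
  define C where "C = (\<integral>x. ?g (f x) * f x \<partial>lborel)"
  have intf: "integrable lborel f" by (rule integrable_f[OF assms(1-3)])
  let ?p = "\<lambda>k x. poisson_packed_prob TYPE('a) k (f x) * f x"

  have g_lim: "(\<lambda>k. ?p k x) \<longlonglongrightarrow> ?g (f x) * f x" for x
  proof (cases "f x = 0")
    case False
    then have pos: "0 < f x" using assms(2)[of x] by simp
    show ?thesis by (rule tendsto_mult_right[OF poisson_packed_prob_tendsto[OF assms(7)[OF pos] pos]])
  qed simp
  \<comment> \<open>Measurability in \<open>x\<close> is inherited from the truncated probabilities: the processes for
    different intensities live on unrelated probability spaces.\<close>
  have g_meas: "(\<lambda>x. ?g (f x) * f x) \<in> borel_measurable lborel"
    by (rule borel_measurable_LIMSEQ_real[OF g_lim]) measurable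
  have c_eq: "c k = (\<integral>x. ?p k x \<partial>lborel)" for k
  proof -
    have "c k = (\<integral>x. poisson_packed_prob TYPE('a) k (f x) \<partial>law)"
      unfolding c_def law_def by (rule trunc_limit_def[OF assms(1-3)]) (rule bounds)
    then show ?thesis
      unfolding law_def using assms(2) by (simp add: integral_density mult.commute)
  qed
  have p_le: "norm (?p k x) \<le> f x" for k x
    using bounds[of "f x" k] assms(2)[of x] by (cases "f x = 0") (auto simp: abs_mult mult_left_le_one_le)
  have c_lim: "c \<longlonglongrightarrow> C"
    unfolding c_eq[abs_def] C_def
    by (rule integral_dominated_convergence[where w=f]) (use intf g_meas g_lim p_le in auto)

  have transfer: "(\<integral>\<omega>. trunc_count k n (\<lambda>i. X n i \<omega>) * trunc_count k' n (\<lambda>i. X n i \<omega>) \<partial>M)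
      = (\<integral>z. trunc_count k n z * trunc_count k' n z \<partial>PiM {1..n} (\<lambda>_. law))" if "0 < n" for k k' n
    unfolding law_def by (rule integral_trunc_count_sample[OF assms(4) that assms(5)]) (rule assms(6))
  define S where "S k n \<omega> = trunc_count k n (\<lambda>i. X n i \<omega>) / real n" for k n \<omega>
  have S_meas [measurable]: "S k n \<in> borel_measurable M" for k n
    unfolding S_def[abs_def] by (intro borel_measurable_divide measurable_trunc_count X_meas) auto
  have S01: "0 \<le> S k n \<omega>" "S k n \<omega> \<le> 1" for k n \<omega>
    using trunc_count_bounds[of k n "\<lambda>i. X n i \<omega>"] by (auto simp: S_def divide_le_eq_1)
  have S_int: "integrable M (S k n)" "integrable M (\<lambda>\<omega>. S k n \<omega> * S k' n \<omega>)" for k k' n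
    using S01 by (auto intro!: integrable_const_bound[where B=1] AE_I2 mult_le_one simp: abs_mult)
  have S_prod: "(\<lambda>n. \<integral>\<omega>. S k n \<omega> * S k' n \<omega> \<partial>M) \<longlonglongrightarrow> c k * c k'" for k k'
  proof -
    have "\<forall>\<^sub>F n in sequentially. (\<integral>z. trunc_count k n z * trunc_count k' n z \<partial>PiM {1..n} (\<lambda>_. law)) / (real n)\<^sup>2 = (\<integral>\<omega>. S k n \<omega> * S k' n \<omega> \<partial>M)"
      using eventually_gt_at_top[of 0]
    proof eventually_elim
      case (elim n)
      show ?case unfolding transfer[OF elim, symmetric] by (simp add: S_def power2_eq_square)
    qed
    with trunc_count_product_limit[OF assms(1-3) bounds, of k k'] show ?thesis
      unfolding c_def law_def by (rule Lim_transform_eventually)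
  qed
  \<comment> \<open>At depth \<open>0\<close> every ball is packed, so convergence of the products contains convergence of the
    means.\<close>
  have c0: "c 0 = 1"
  proof -
    have "\<forall>\<^sub>F n in sequentially. (\<integral>\<omega>. S 0 n \<omega> * S 0 n \<omega> \<partial>M) = 1"
      using eventually_gt_at_top[of 0] by eventually_elim (simp add: S_def trunc_count_0 prob_space)
    then have "(\<lambda>n. \<integral>\<omega>. S 0 n \<omega> * S 0 n \<omega> \<partial>M) \<longlonglongrightarrow> 1" by (rule tendsto_eventually)
    then have "c 0 * c 0 = 1" using S_prod[of 0 0] LIMSEQ_unique by blast
    moreover have "0 \<le> c 0"
      unfolding c_eq
    proof (rule Bochner_Integration.integral_nonneg)
      fix x show "0 \<le> ?p 0 x" using bounds[of "f x" 0] assms(2)[of x] by (cases "f x = 0") auto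
    qed
    ultimately show ?thesis by (metis abs_of_nonneg real_sqrt_abs2 real_sqrt_one)
  qed
  have S_mean: "(\<lambda>n. \<integral>\<omega>. S k n \<omega> \<partial>M) \<longlonglongrightarrow> c k" for k
  proof -
    have "\<forall>\<^sub>F n in sequentially. (\<integral>\<omega>. S k n \<omega> * S 0 n \<omega> \<partial>M) = (\<integral>\<omega>. S k n \<omega> \<partial>M)"
      using eventually_gt_at_top[of 0] by eventually_elim (simp add: S_def trunc_count_0)
    with S_prod[of k 0] show ?thesis unfolding c0 mult_1_right by (rule Lim_transform_eventually)
  qed
  have S_L2: "(\<lambda>n. \<integral>\<omega>. (S k n \<omega> - c k)\<^sup>2 \<partial>M) \<longlonglongrightarrow> 0" for k
  proof -
    have "(\<integral>\<omega>. (S k n \<omega> - c k)\<^sup>2 \<partial>M) = (\<integral>\<omega>. S k n \<omega> * S k n \<omega> \<partial>M) - 2 * c k * (\<integral>\<omega>. S k n \<omega> \<partial>M) + c k * c k" for n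
    proof -
      have "(\<integral>\<omega>. (S k n \<omega> - c k)\<^sup>2 \<partial>M) = (\<integral>\<omega>. (S k n \<omega> * S k n \<omega> - 2 * c k * S k n \<omega>) + c k * c k \<partial>M)"
        by (intro Bochner_Integration.integral_cong) (auto simp: power2_eq_square algebra_simps)
      then show ?thesis using S_int by (simp add: prob_space)
    qed
    moreover have "(\<lambda>n. (\<integral>\<omega>. S k n \<omega> * S k n \<omega> \<partial>M) - 2 * c k * (\<integral>\<omega>. S k n \<omega> \<partial>M) + c k * c k) \<longlonglongrightarrow> c k * c k - 2 * c k * c k + c k * c k"
      by (intro tendsto_intros S_prod S_mean)
    ultimately show ?thesis by simp
  qed
  let ?Y = "\<lambda>n \<omega>. real (num_packed n (\<lambda>i. X n i \<omega>)) / real n"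
  have Y_eq: "?Y n \<omega> = S (Suc n) n \<omega>" for n \<omega> by (simp add: S_def num_packed_eq_trunc_count)
  have Y_S: "even k \<Longrightarrow> ?Y n \<omega> \<le> S k n \<omega>" "odd k \<Longrightarrow> S k n \<omega> \<le> ?Y n \<omega>" for k n \<omega>
    unfolding S_def by (auto intro!: divide_right_mono num_packed_trunc_count)
  have sq_int: "integrable M (\<lambda>\<omega>. (S k n \<omega> - a)\<^sup>2)" for k n a
  proof -
    have "(\<lambda>\<omega>. (S k n \<omega> - a)\<^sup>2) = (\<lambda>\<omega>. S k n \<omega> * S k n \<omega> - 2 * a * S k n \<omega> + a * a)"
      by (auto simp: fun_eq_iff power2_eq_square algebra_simps)
    then show ?thesis using S_int by simp
  qed
  have "(\<lambda>n. \<integral>\<omega>. (?Y n \<omega> - C)\<^sup>2 \<partial>M) \<longlonglongrightarrow> 0"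
    by (rule L2_limit_sandwich[OF assms(4) sq_int _ S_L2 c_lim Y_S]) (simp_all add: Y_eq sq_int)
  moreover have "?Y n \<in> borel_measurable M" "integrable M (\<lambda>\<omega>. (?Y n \<omega>)\<^sup>2)" for n
    using S_meas[of "Suc n" n] sq_int[of "Suc n" n 0] by (simp_all add: Y_eq)
  ultimately show ?thesis
    unfolding tendsto_L2_def C_def by simp
qed

end
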